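(* Let $\gamma:I\subseteq\mathbb{R}\to\mathbb{S}^2$ be a critical curve for $\mathcal{B}_{1/2,\lambda}$ with non-constant curvature $\kappa$, defined on its maximal domain $I\subseteq\mathbb{R}$. Then $I=\mathbb{R}$ and, possibly reversing the orientation, $\gamma$ is a B-curve that can be parameterized in terms of its arc-length parameter $s\in\mathbb{R}$, up to rigid motions, as $$\gamma(s)\equiv\gamma_\xi(s)=\frac{1}{2\xi\mu}\left(1,\,-\sqrt{4\xi^2\mu^2-1}\,\cos\theta(s),\,\sqrt{4\xi^2\mu^2-1}\,\sin\theta(s)\right),$$ where $$\theta(s):=2\xi\int\frac{\mu^2(\mu+2\lambda)}{1-4\xi^2\mu^2}\,ds,$$ and $\mu\equiv\mu(s)=\sqrt{\kappa(s)}$ is a solution of $$\dot\mu^2=-\mu^2\left(\mu^4+4\lambda\mu^3+4\left[\lambda^2-\xi^2\right]\mu^2+1\right),$$ for a suitable constant $\xi>0$.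
   Context: $\mathbb{S}^2\subset\mathbb{R}^3$ is the unit sphere centered at the origin with the induced metric, and $\lambda\in\mathbb{R}$ is a constant (a Lagrange multiplier encoding the conservation of length). For an arc-length parameterized curve $\gamma$ in $\mathbb{S}^2$, let $T=\dot\gamma$ (the dot denotes the derivative with respect to the arc-length $s$), let $N$ be the counter-clockwise rotation of $T$ by $\pi/2$ in the tangent bundle of $\mathbb{S}^2$, and let the signed geodesic curvature $\kappa$ be defined by $\nabla_TT=\kappa N$, with $\nabla$ the Levi-Civita connection of $\mathbb{S}^2$. The functional is $\mathcal{B}_{1/2,\lambda}(\gamma)=\int_\gamma\left(\sqrt{|\kappa|}+\lambda\right)ds$. A critical curve is a curve of class at least $\mathcal{C}^4$ which is stationary for the functional with respect to compactly supported variations whose support does not contain inflection points (points where $\kappa=0$). A B-curve is a critical curve for $\mathcal{B}_{1/2,\lambda}$ with positive, non-constant, periodic curvature.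
   Formalization: When λ<0 and ξ=1/(4|λ|), the integrand for θ is 0/0 at the minima of μ (curve through the pole) and the formula with continuous θ has a corner; θ is taken as an antiderivative only where 1−4ξ²μ²≠0, so its constant may change across these points. *)

theory Defs
  imports "HOL-Analysis.Analysis"
begin

text \<open>
  Everything below that involves an ``at'' derivative is meant to be used on open sets,
  so that two-sided derivatives are the right ones and the (arbitrary) values of the total
  HOL functions outside the set do not matter.
\<close>

text \<open>Functions of class \<open>C\<^sup>k\<close> on an open subset of a finite-dimensional space.\<close>

primrec C_k_on :: "nat \<Rightarrow> ('a::euclidean_space \<Rightarrow> 'b::real_normed_vector) \<Rightarrow> 'a set \<Rightarrow> bool" where
  "C_k_on 0 f U \<longleftrightarrow> continuous_on U f"
| "C_k_on (Suc k) f U \<longleftrightarrow>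
     (\<forall>x\<in>U. f differentiable (at x)) \<and>
     (\<forall>v. C_k_on k (\<lambda>x. frechet_derivative f (at x) v) U)"


subsection \<open>Geometry of regular curves in the unit sphere\<close>

text \<open>
  Curves in the variations below need not be parameterized by arc-length, so the Frenet data
  are written for an arbitrary regular parameter, with \<open>d/ds\<close> rendered as differentiation
  divided by the speed. When the speed is 1, \<open>arc_deriv c f\<close> is just the derivative of \<open>f\<close>.
\<close>

definition speed :: "(real \<Rightarrow> real^3) \<Rightarrow> real \<Rightarrow> real" where
  "speed c u = norm (vector_derivative c (at u))"

definition arc_deriv :: "(real \<Rightarrow> real^3) \<Rightarrow> (real \<Rightarrow> real^3) \<Rightarrow> real \<Rightarrow> real^3" where
  "arc_deriv c f u = vector_derivative f (at u) /\<^sub>R speed c u"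

definition unit_tangent :: "(real \<Rightarrow> real^3) \<Rightarrow> real \<Rightarrow> real^3" where
  "unit_tangent c = arc_deriv c c"

text \<open>
  Counter-clockwise is understood as seen from outside the sphere (outward normal \<open>c u\<close>):
  for a unit vector \<open>p\<close>, rotation by \<open>\<pi>/2\<close> of the tangent plane at \<open>p\<close> is \<open>v \<mapsto> p \<times> v\<close>.
\<close>

definition unit_normal :: "(real \<Rightarrow> real^3) \<Rightarrow> real \<Rightarrow> real^3" where
  "unit_normal c u = cross3 (c u) (unit_tangent c u)"

text \<open>
  Covariant derivative with respect to arc-length of a vector field \<open>V\<close> along \<open>c\<close>: the
  Levi-Civita connection of the metric induced on the sphere is the tangential part of the
  derivative in the ambient space.
\<close>

definition cov_deriv :: "(real \<Rightarrow> real^3) \<Rightarrow> (real \<Rightarrow> real^3) \<Rightarrow> real \<Rightarrow> real^3" where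
  "cov_deriv c V u = arc_deriv c V u - (arc_deriv c V u \<bullet> c u) *\<^sub>R c u"

definition geodesic_curvature :: "(real \<Rightarrow> real^3) \<Rightarrow> real \<Rightarrow> real" where
  "geodesic_curvature c u =
     (THE k. cov_deriv c (unit_tangent c) u = k *\<^sub>R unit_normal c u)"


subsection \<open>The functional and its critical curves\<close>

definition B_functional :: "real \<Rightarrow> (real \<Rightarrow> real^3) \<Rightarrow> real set \<Rightarrow> real" where
  "B_functional lam c J =
     integral J (\<lambda>u. (sqrt \<bar>geodesic_curvature c u\<bar> + lam) * speed c u)"

definition arclength_curve :: "real set \<Rightarrow> (real \<Rightarrow> real^3) \<Rightarrow> bool" where
  "arclength_curve I \<gamma> \<longleftrightarrow>
     open I \<and> is_interval I \<and> I \<noteq> {} \<and> \<gamma> ` I \<subseteq> sphere 0 1 \<and>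
     C_k_on 4 \<gamma> I \<and> (\<forall>s\<in>I. speed \<gamma> s = 1)"

text \<open>
  A variation \<open>\<Gamma> t\<close>, \<open>\<bar>t\<bar> < e\<close>, of \<open>\<gamma>\<close> through curves in the sphere. For a compactly supported
  variation the curves \<open>\<Gamma> t\<close> are regular for all small \<open>t\<close>, which is all that enters a
  derivative at \<open>t = 0\<close>.
\<close>

definition variation ::
    "real \<Rightarrow> real set \<Rightarrow> (real \<Rightarrow> real^3) \<Rightarrow> (real \<Rightarrow> real \<Rightarrow> real^3) \<Rightarrow> bool" where
  "variation e I \<gamma> \<Gamma> \<longleftrightarrow>
     e > 0 \<and> C_k_on 4 (\<lambda>(t, s). \<Gamma> t s) ({-e<..<e} \<times> I) \<and>
     (\<forall>t\<in>{-e<..<e}. \<Gamma> t ` I \<subseteq> sphere 0 1) \<and> (\<forall>s\<in>I. \<Gamma> 0 s = \<gamma> s)"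

definition variation_support ::
    "real \<Rightarrow> real set \<Rightarrow> (real \<Rightarrow> real^3) \<Rightarrow> (real \<Rightarrow> real \<Rightarrow> real^3) \<Rightarrow> real set" where
  "variation_support e I \<gamma> \<Gamma> = closure {s \<in> I. \<exists>t\<in>{-e<..<e}. \<Gamma> t s \<noteq> \<gamma> s}"

text \<open>
  The integral over all of \<open>I\<close> may diverge, so as usual the functional is evaluated on compact
  subintervals containing the support of the variation.
\<close>

definition critical_curve :: "real \<Rightarrow> real set \<Rightarrow> (real \<Rightarrow> real^3) \<Rightarrow> bool" where
  "critical_curve lam I \<gamma> \<longleftrightarrow>
     arclength_curve I \<gamma> \<and>
     (\<forall>e \<Gamma> a b.
        variation e I \<gamma> \<Gamma> \<and>
        variation_support e I \<gamma> \<Gamma> \<subseteq> {a..b} \<and> {a..b} \<subseteq> I \<and>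
        (\<forall>s\<in>variation_support e I \<gamma> \<Gamma>. geodesic_curvature \<gamma> s \<noteq> 0)
        \<longrightarrow> ((\<lambda>t. B_functional lam (\<Gamma> t) {a..b}) has_real_derivative 0) (at 0))"

definition maximal_critical_curve :: "real \<Rightarrow> real set \<Rightarrow> (real \<Rightarrow> real^3) \<Rightarrow> bool" where
  "maximal_critical_curve lam I \<gamma> \<longleftrightarrow>
     critical_curve lam I \<gamma> \<and>
     (\<forall>J c. critical_curve lam J c \<and> I \<subseteq> J \<and> (\<forall>s\<in>I. c s = \<gamma> s) \<longrightarrow> J = I)"

definition B_curve :: "real \<Rightarrow> (real \<Rightarrow> real^3) \<Rightarrow> bool" where
  "B_curve lam \<gamma> \<longleftrightarrow>
     critical_curve lam UNIV \<gamma> \<and>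
     (\<forall>s. geodesic_curvature \<gamma> s > 0) \<and>
     \<not> geodesic_curvature \<gamma> constant_on UNIV \<and>
     (\<exists>p>0. \<forall>s. geodesic_curvature \<gamma> (s + p) = geodesic_curvature \<gamma> s)"


subsection \<open>The model curves\<close>

definition gamma_xi :: "real \<Rightarrow> (real \<Rightarrow> real) \<Rightarrow> (real \<Rightarrow> real) \<Rightarrow> real \<Rightarrow> real^3" where
  "gamma_xi \<xi> \<mu> \<theta> s =
     (1 / (2 * \<xi> * \<mu> s)) *\<^sub>R
       vector [1,
               - sqrt (4 * \<xi>\<^sup>2 * (\<mu> s)\<^sup>2 - 1) * cos (\<theta> s),
               sqrt (4 * \<xi>\<^sup>2 * (\<mu> s)\<^sup>2 - 1) * sin (\<theta> s)]"

text \<open>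
  \<open>\<theta>\<close> is an antiderivative of the given integrand wherever the latter is defined. The
  denominator can vanish only where the curve passes through the pole \<open>(1,0,0)\<close> (this happens for
  \<open>lam < 0\<close>, \<open>4 * \<xi> * \<bar>lam\<bar> = 1\<close>, at the minima of \<open>\<mu>\<close>); there the polar angle \<open>\<theta>\<close> is undefined and
  jumps by \<open>\<pi>\<close>, so the constant of integration may differ on the intervals in between. In all
  other cases \<open>\<theta>\<close> is an antiderivative on the whole line.
\<close>

definition angle_function :: "real \<Rightarrow> real \<Rightarrow> (real \<Rightarrow> real) \<Rightarrow> (real \<Rightarrow> real) \<Rightarrow> bool" where
  "angle_function lam \<xi> \<mu> \<theta> \<longleftrightarrow>
     (\<forall>s. 1 - 4 * \<xi>\<^sup>2 * (\<mu> s)\<^sup>2 \<noteq> 0 \<longrightarrow>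
        (\<theta> has_real_derivative
           2 * \<xi> * ((\<mu> s)\<^sup>2 * (\<mu> s + 2 * lam) / (1 - 4 * \<xi>\<^sup>2 * (\<mu> s)\<^sup>2))) (at s))"

definition solves_mu_ode :: "real \<Rightarrow> real \<Rightarrow> (real \<Rightarrow> real) \<Rightarrow> bool" where
  "solves_mu_ode lam \<xi> \<mu> \<longleftrightarrow>
     (\<forall>s. \<mu> differentiable (at s) \<and>
        (deriv \<mu> s)\<^sup>2 =
          - (\<mu> s)\<^sup>2 * ((\<mu> s)^4 + 4 * lam * (\<mu> s)^3 + 4 * (lam\<^sup>2 - \<xi>\<^sup>2) * (\<mu> s)\<^sup>2 + 1))"

end

theory Submission
  imports Defs
begin

text \<open>
  Where \<open>\<kappa> \<noteq> 0\<close>, the Euler-Lagrange equation for \<open>y = 1 / \<mu> = \<bar>\<kappa>\<bar> powr (-1/2)\<close> is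
  the autonomous equation \<open>y'' = 1 / y^3 + 2 lam / y^2 - y\<close>, whose energy
  \<open>4 \<xi>^2 = y'^2 + y^2 + (1 / y + 2 lam)^2\<close> bounds \<open>y\<close> above and away from 0. Hence the curvature
  cannot reach 0 inside the domain, and solutions exist for all time, so that a curve on a proper
  interval could be extended by solving the Frenet equations. The potential has a single critical
  point, so every solution has infinitely many turning times; reflection at two of them gives a
  period. For \<open>\<kappa> > 0\<close>, Noether's theorem for rotations says that \<open>J = y \<gamma> + y' T + (\<mu> + 2 lam) N\<close> is a constant
  vector of length \<open>2 \<xi>\<close>. In a frame with first axis \<open>J / \<bar>J\<bar>\<close> the first coordinate of \<open>\<gamma>\<close> is
  \<open>y / (2 \<xi>)\<close>, and the \<open>J\<close>-component of \<open>\<gamma> \<times> \<gamma>' = N\<close> gives the derivative of the polar angle.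
\<close>

subsection \<open>Functions of class \<open>C\<^sup>k\<close>\<close>

text \<open>The variable \<open>1 / sqrt \<bar>\<kappa>\<bar>\<close> is forced by the functional: a
  variation field \<open>V\<close> changes the curvature by \<open>(V + V'') \<bullet> N\<close>
  plus tangential terms, weighted by the derivative \<open>\<sigma> * y / 2\<close> of
  \<open>sqrt \<bar>\<kappa>\<bar>\<close>, so integration by parts puts both derivatives on
  \<open>y\<close>. Since \<open>sqrt\<close> is not differentiable at 0, criticality gives no
  information at inflection points; the sign \<open>\<sigma>\<close> of the curvature is carried
  along, and the differential equation is first known only on the open set where
  \<open>\<sigma> * \<kappa> > 0\<close>. A \<open>C^4\<close> curve has \<open>C^2\<close>
  curvature, which gives just the continuous \<open>y''\<close> that the equation needs. The
  equation is used in both directions: for the given curve, and to certify that the curve rebuilt on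
  the whole line from a solution is critical, since maximality compares only with critical curves.
  The force is singular at \<open>y = 0\<close>; global existence is therefore obtained from a
  globally Lipschitz truncation. The polar angle is undefined at the pole, so it is lifted
  separately on each component of the remaining times.\<close>

lemma C_k_on_subset: "C_k_on k f U \<Longrightarrow> V \<subseteq> U \<Longrightarrow> C_k_on k f V"
  by (induction k arbitrary: f) (auto intro: continuous_on_subset)

text \<open>Openness of \<open>U\<close> is the point: a two-sided derivative at a point of
  \<open>U\<close> is determined by the values in \<open>U\<close>. The functions vary in the
  induction, which continues with their derivatives.\<close>

lemma C_k_on_cong:
  assumes "open U" "\<And>x. x \<in> U \<Longrightarrow> f x = g x" "C_k_on k f U"
  shows "C_k_on k g U"
  using assms(2,3)
proof (induction k arbitrary: f g)
  case 0
  then show ?case by (simp cong: continuous_on_cong)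
next
  case (Suc k)
  have *: "(g has_derivative frechet_derivative f (at x)) (at x)" if "x \<in> U" for x
  proof -
    have "(f has_derivative frechet_derivative f (at x)) (at x)"
      using Suc.prems(2) that frechet_derivative_works by auto
    then show ?thesis
      using has_derivative_transform_within_open \<open>open U\<close> that Suc.prems(1) by metis
  qed
  then have eq: "frechet_derivative f (at x) = frechet_derivative g (at x)" if "x \<in> U" for x
    using frechet_derivative_at that by metis
  have "C_k_on k (\<lambda>x. frechet_derivative g (at x) v) U" for v
  proof (rule Suc.IH)
    show "frechet_derivative f (at x) v = frechet_derivative g (at x) v" if "x \<in> U" for x
      by (simp only: eq[OF that])
    show "C_k_on k (\<lambda>x. frechet_derivative f (at x) v) U"
      using Suc.prems(2) by simp
  qed
  then show ?case
    using * by (auto simp: differentiable_def)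
qed

lemma C_k_on_derivI:
  assumes "open U" "\<And>x. x \<in> U \<Longrightarrow> (f has_derivative f' x) (at x)"
    and "\<And>v. C_k_on k (\<lambda>x. f' x v) U"
  shows "C_k_on (Suc k) f U"
proof -
  have "f' x = frechet_derivative f (at x)" if "x \<in> U" for x
    using assms(2)[OF that] frechet_derivative_at by metis
  then have "C_k_on k (\<lambda>x. frechet_derivative f (at x) v) U" for v
    by (intro C_k_on_cong[OF assms(1) _ assms(3)[of v]]) simp
  then show ?thesis
    using assms(2) by (auto simp: differentiable_def)
qed

lemma C_k_on_SucD:
  assumes "C_k_on (Suc k) f U"
  shows "x \<in> U \<Longrightarrow> (f has_derivative frechet_derivative f (at x)) (at x)"
    and "C_k_on k (\<lambda>x. frechet_derivative f (at x) v) U"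
  using assms frechet_derivative_works by auto

lemma C_k_on_Suc_imp: "C_k_on (Suc k) f U \<Longrightarrow> C_k_on k f U"
proof (induction k arbitrary: f)
  case 0
  then show ?case
    by (auto intro!: differentiable_imp_continuous_within continuous_at_imp_continuous_on)
next
  case (Suc k)
  then show ?case by auto
qed

lemma C_k_on_mono: "C_k_on m f U \<Longrightarrow> k \<le> m \<Longrightarrow> C_k_on k f U"
  by (induction m) (auto simp: le_Suc_eq dest: C_k_on_Suc_imp simp del: C_k_on.simps(2))

lemma C_k_on_continuous_on: "C_k_on k f U \<Longrightarrow> continuous_on U f"
  using C_k_on_mono[of k f U 0] by simp

lemma C_k_on_linear:
  assumes "bounded_linear h" "open U" "C_k_on k f U"
  shows "C_k_on k (\<lambda>x. h (f x)) U"
  using assms(3)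
proof (induction k arbitrary: f)
  case 0
  then show ?case
    by (auto intro: bounded_linear.continuous_on[OF assms(1)])
next
  case (Suc k)
  note f = C_k_on_SucD[OF Suc.prems]
  show ?case
    by (rule C_k_on_derivI[OF \<open>open U\<close> bounded_linear.has_derivative[OF assms(1) f(1)]])
      (auto intro: Suc.IH f(2))
qed

lemma C_k_on_add:
  assumes "open U" "C_k_on k f U" "C_k_on k g U"
  shows "C_k_on k (\<lambda>x. f x + g x) U"
  using assms(2,3)
proof (induction k arbitrary: f g)
  case 0
  then show ?case by (auto intro: continuous_intros)
next
  case (Suc k)
  note f = C_k_on_SucD[OF Suc.prems(1)] and g = C_k_on_SucD[OF Suc.prems(2)]
  show ?case
    by (rule C_k_on_derivI[OF \<open>open U\<close> has_derivative_add[OF f(1) g(1)]])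
      (auto intro: Suc.IH f(2) g(2))
qed

lemma C_k_on_const: "open U \<Longrightarrow> C_k_on k (\<lambda>x. c) U"
proof (induction k arbitrary: c)
  case 0
  then show ?case by auto
next
  case (Suc k)
  then show ?case
    by (intro C_k_on_derivI[where f' = "\<lambda>_ _. 0"]) auto
qed

lemma C_k_on_bounded_linear:
  assumes "bounded_linear h" "open U"
  shows "C_k_on k h U"
proof (cases k)
  case 0
  then show ?thesis using assms linear_continuous_on by auto
next
  case (Suc m)
  show ?thesis unfolding Suc
    by (rule C_k_on_derivI[OF \<open>open U\<close> bounded_linear.has_derivative[OF assms(1) has_derivative_ident]])
      (rule C_k_on_const[OF assms(2)])
qed

text \<open>The Leibniz rule writes each directional derivative as a sum of two bilinear terms, so
  one induction covers scaling, inner, cross and real products.\<close>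

lemma C_k_on_bilinear:
  assumes "bounded_bilinear h" "open U" "C_k_on k f U" "C_k_on k g U"
  shows "C_k_on k (\<lambda>x. h (f x) (g x)) U"
  using assms(3,4)
proof (induction k arbitrary: f g)
  case 0
  then show ?case
    by (auto intro: bounded_bilinear.continuous_on[OF assms(1)])
next
  case (Suc k)
  note f = C_k_on_SucD[OF Suc.prems(1)] and g = C_k_on_SucD[OF Suc.prems(2)]
  show ?case
    by (rule C_k_on_derivI[OF \<open>open U\<close> bounded_bilinear.FDERIV[OF assms(1) f(1) g(1)]])
      (auto intro!: C_k_on_add \<open>open U\<close> Suc.IH f(2) g(2) C_k_on_Suc_imp[OF Suc.prems(1)] C_k_on_Suc_imp[OF Suc.prems(2)])
qed

lemma bounded_bilinear_cross: "bounded_bilinear (cross3 :: real^3 \<Rightarrow> real^3 \<Rightarrow> real^3)"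
  using bilinear_cross bilinear_conv_bounded_bilinear by blast

lemmas C_k_on_scaleR = C_k_on_bilinear[OF bounded_bilinear_scaleR]
lemmas C_k_on_inner = C_k_on_bilinear[OF bounded_bilinear_inner]
lemmas C_k_on_cross = C_k_on_bilinear[OF bounded_bilinear_cross]
lemmas C_k_on_mult = C_k_on_bilinear[OF bounded_bilinear_mult]

lemma C_k_on_minus: "open U \<Longrightarrow> C_k_on k f U \<Longrightarrow> C_k_on k (\<lambda>x. - f x) U"
  by (rule C_k_on_linear) (auto intro: bounded_linear_minus bounded_linear_ident)

lemma C_k_on_diff:
  "open U \<Longrightarrow> C_k_on k f U \<Longrightarrow> C_k_on k g U \<Longrightarrow> C_k_on k (\<lambda>x. f x - g x) U"
  using C_k_on_add[of U k f "\<lambda>x. - g x"] C_k_on_minus by auto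

lemma C_k_on_power:
  fixes f :: "'a::euclidean_space \<Rightarrow> real"
  shows "open U \<Longrightarrow> C_k_on k f U \<Longrightarrow> C_k_on k (\<lambda>x. f x ^ n) U"
  by (induction n) (auto intro: C_k_on_mult C_k_on_const)

text \<open>On the real line a direction \<open>v\<close> only scales the derivative, so smoothness
  there can be tested with \<open>has_vector_derivative\<close> alone.\<close>

lemma C_k_on_vderivI:
  fixes f :: "real \<Rightarrow> 'b::real_normed_vector"
  assumes "open U" "\<And>x. x \<in> U \<Longrightarrow> (f has_vector_derivative f' x) (at x)" "C_k_on k f' U"
  shows "C_k_on (Suc k) f U"
proof (rule C_k_on_derivI[OF assms(1)])
  show "(f has_derivative (\<lambda>v. v *\<^sub>R f' x)) (at x)" if "x \<in> U" for x
    using assms(2)[OF that] by (simp add: has_vector_derivative_def)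
qed (rule C_k_on_scaleR[OF assms(1) C_k_on_const[OF assms(1)] assms(3)])

lemma C_k_on_vderivD:
  fixes f :: "real \<Rightarrow> 'b::real_normed_vector"
  assumes "open U" "C_k_on (Suc k) f U"
  shows "x \<in> U \<Longrightarrow> (f has_vector_derivative vector_derivative f (at x)) (at x)"
    and "C_k_on k (\<lambda>x. vector_derivative f (at x)) U"
proof -
  have *: "(f has_vector_derivative frechet_derivative f (at x) 1) (at x)" if "x \<in> U" for x
  proof -
    have 1: "(f has_derivative frechet_derivative f (at x)) (at x)"
      using C_k_on_SucD(1)[OF assms(2) that] .
    then have "frechet_derivative f (at x) v = v *\<^sub>R frechet_derivative f (at x) 1" for v
      using linear_scale[OF has_derivative_linear[OF 1], of v 1] by simp
    then have "frechet_derivative f (at x) = (\<lambda>v. v *\<^sub>R frechet_derivative f (at x) 1)"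
      by blast
    with 1 show ?thesis unfolding has_vector_derivative_def by simp
  qed
  show "x \<in> U \<Longrightarrow> (f has_vector_derivative vector_derivative f (at x)) (at x)"
    using * vector_derivative_at by metis
  show "C_k_on k (\<lambda>x. vector_derivative f (at x)) U"
    by (rule C_k_on_cong[OF assms(1) _ C_k_on_SucD(2)[OF assms(2), of 1]])
      (use * vector_derivative_at in metis)
qed

text \<open>The chain rule produces the derivative of \<open>h\<close> composed with the same
  \<open>g\<close>; hence \<open>h\<close> varies in the induction and \<open>g\<close> stays
  fixed.\<close>

lemma C_k_on_compose_real:
  fixes h :: "real \<Rightarrow> 'b::real_normed_vector" and g :: "'a::euclidean_space \<Rightarrow> real"
  assumes "open U" "open S" "g ` U \<subseteq> S" "C_k_on k h S" "C_k_on k g U"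
  shows "C_k_on k (\<lambda>x. h (g x)) U"
  using assms(4,5)
proof (induction k arbitrary: h)
  case 0
  then show ?case using assms(3)
    by (auto intro: continuous_on_compose2)
next
  case (Suc k)
  note h = C_k_on_vderivD[OF assms(2) Suc.prems(1)] and g = C_k_on_SucD[OF Suc.prems(2)]
  show ?case
  proof (rule C_k_on_derivI[OF \<open>open U\<close>])
    show "((\<lambda>x. h (g x)) has_derivative
        (\<lambda>v. frechet_derivative g (at x) v *\<^sub>R vector_derivative h (at (g x)))) (at x)" 
      if "x \<in> U" for x
      using has_derivative_compose[OF g(1)[OF that], of h] h(1)[of "g x"] that assms(3)
      by (auto simp: has_vector_derivative_def)
    show "C_k_on k (\<lambda>x. frechet_derivative g (at x) v *\<^sub>R vector_derivative h (at (g x))) U" for v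
      by (intro C_k_on_scaleR \<open>open U\<close> g(2) Suc.IH h(2) C_k_on_Suc_imp[OF Suc.prems(2)])
  qed
qed

lemma C_k_on_sin_cos:
  assumes "open (U::real set)"
  shows "C_k_on k sin U \<and> C_k_on k cos U"
proof (induction k)
  case 0
  then show ?case by (auto intro: continuous_intros)
next
  case (Suc k)
  then show ?case
    using C_k_on_vderivI[OF assms, of sin cos k] C_k_on_vderivI[OF assms, of cos "\<lambda>x. - sin x" k]
      C_k_on_minus[OF assms, of k sin]
    by (auto simp flip: has_real_derivative_iff_has_vector_derivative intro: derivative_eq_intros
        simp del: C_k_on.simps)
qed

lemma C_k_on_inverse: "C_k_on k (inverse :: real \<Rightarrow> real) {0<..}"
proof (induction k)
  case 0
  then show ?case by (auto intro!: continuous_intros)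
next
  case (Suc k)
  then show ?case
    by (intro C_k_on_vderivI[where f' = "\<lambda>x. - (inverse x * inverse x)"] C_k_on_minus C_k_on_mult)
      (auto simp flip: has_real_derivative_iff_has_vector_derivative intro!: derivative_eq_intros)
qed

lemma C_k_on_sqrt: "C_k_on k sqrt {0<..}"
proof (induction k)
  case 0
  then show ?case by (auto intro!: continuous_intros)
next
  case (Suc k)
  have "C_k_on k (\<lambda>x. inverse (sqrt x) * (1/2)) {0<..}"
    by (intro C_k_on_mult C_k_on_const C_k_on_compose_real[OF _ _ _ C_k_on_inverse] Suc.IH) auto
  then show ?case
    by (intro C_k_on_vderivI[where f' = "\<lambda>x. inverse (sqrt x) / 2"])
      (auto simp flip: has_real_derivative_iff_has_vector_derivative intro!: derivative_eq_intros)
qed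

text \<open>Differentiation lowers the exponent by one within the same family. The fifth power later
  supplies a compactly supported cut-off of class \<open>C^4\<close>.\<close>

lemma C_k_on_pos_part_power: "C_k_on k (\<lambda>x::real. max 0 x ^ Suc k) UNIV"
proof (induction k)
  case 0
  then show ?case by (auto intro!: continuous_intros)
next
  case (Suc k)
  have "((\<lambda>x::real. max 0 x ^ Suc (Suc k)) has_real_derivative
      of_nat (Suc (Suc k)) * max 0 x ^ Suc k) (at x)" for x
  proof -
    consider "x > 0" | "x < 0" | "x = 0" by linarith
    then show ?thesis
    proof cases
      case 1
      have "((\<lambda>x::real. x ^ Suc (Suc k)) has_real_derivative of_nat (Suc (Suc k)) * x ^ Suc k) (at x)"
        using DERIV_pow[of "Suc (Suc k)" x] by simp
      then show ?thesis using 1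
        by (auto intro: has_field_derivative_transform_within_open[where S = "{0<..}"])
    next
      case 2
      then have *: "of_nat (Suc (Suc k)) * max 0 x ^ Suc k = 0"
        by simp
      show ?thesis unfolding *
        by (rule has_field_derivative_transform_within_open[OF DERIV_const[of 0] open_lessThan[of 0]])
          (use 2 in auto)
    next
      \<comment> \<open>At 0 the difference quotient is \<open>max 0 h ^ Suc k\<close> for
        \<open>h > 0\<close> and 0 for \<open>h < 0\<close>; the factor
        \<open>of_bool (h > 0)\<close> joins both cases, and squeezing gives the limit 0.\<close>
      case 3
      have "((\<lambda>h::real. max 0 h ^ Suc k * of_bool (h > 0)) \<longlongrightarrow> 0) (at 0)"
      proof (rule Lim_null_comparison)
        show "\<forall>\<^sub>F h in at 0. norm (max 0 h ^ Suc k * of_bool (0 < h)) \<le> max 0 h ^ Suc k"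
          by (auto simp: max_def)
        have "((\<lambda>h::real. max 0 h ^ Suc k) \<longlongrightarrow> max 0 0 ^ Suc k) (at 0)"
          by (intro tendsto_intros)
        then show "((\<lambda>h::real. max 0 h ^ Suc k) \<longlongrightarrow> 0) (at 0)" by simp
      qed
      then have "((\<lambda>h::real. (max 0 (0+h) ^ Suc (Suc k) - max 0 0 ^ Suc (Suc k)) / h) \<longlongrightarrow> 0) (at 0)"
        by (rule Lim_transform_eventually) (auto simp: eventually_at_filter max_def)
      then show ?thesis using 3 by (simp add: DERIV_def)
    qed
  qed
  then show ?case
    by (intro C_k_on_vderivI[where f' = "\<lambda>x. of_nat (Suc (Suc k)) * max 0 x ^ Suc k"] C_k_on_mult
         C_k_on_const Suc.IH)
       (simp_all only: has_real_derivative_iff_has_vector_derivative open_UNIV)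
qed

subsection \<open>Curvature in an arbitrary parameter\<close>

text \<open>The remainder \<open>z\<close> is perpendicular to all three directions. By the triple
  product formula \<open>cross3 (cross3 p q) z\<close> vanishes, so \<open>z\<close> is both
  parallel and perpendicular to the nonzero vector \<open>cross3 p q\<close>. The vector
  \<open>q\<close> is not normalized because it will be a velocity of arbitrary speed.\<close>

lemma orthogonal_expansion_3:
  fixes p q w :: "real^3"
  assumes "norm p = 1" "p \<bullet> q = 0" "q \<noteq> 0"
  shows "w = (w \<bullet> p) *\<^sub>R p + (w \<bullet> q / (q \<bullet> q)) *\<^sub>R q
           + (w \<bullet> cross3 p q / (q \<bullet> q)) *\<^sub>R cross3 p q"
proof -
  have pp: "p \<bullet> p = 1" using assms(1) by (simp add: norm_eq_1)
  have qq: "q \<bullet> q \<noteq> 0" using assms(3) by simp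
  have "(norm (cross3 p q))\<^sup>2 = q \<bullet> q"
    using norm_cross_dot[of p q] assms by (simp add: power2_norm_eq_inner)
  then have rr: "cross3 p q \<bullet> cross3 p q = q \<bullet> q"
    by (simp add: power2_norm_eq_inner)
  define z where "z = w - ((w \<bullet> p) *\<^sub>R p + (w \<bullet> q / (q \<bullet> q)) *\<^sub>R q
           + (w \<bullet> cross3 p q / (q \<bullet> q)) *\<^sub>R cross3 p q)"
  have zp: "z \<bullet> p = 0" and zq: "z \<bullet> q = 0" and zr: "cross3 p q \<bullet> z = 0"
    using qq assms(2)
    by (simp_all add: z_def inner_diff_left inner_diff_right inner_add_left inner_add_right pp rr dot_cross_self
        inner_commute[of q p] inner_commute[of "cross3 p q" w] inner_commute[of "cross3 p q" p] inner_commute[of "cross3 p q" q])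
  have "cross3 (cross3 p q) z = (p \<bullet> z) *\<^sub>R q - (q \<bullet> z) *\<^sub>R p"
    by (simp add: cross3_simps forall_3)
  then have "cross3 (cross3 p q) z = 0"
    using zp zq by (simp add: inner_commute)
  then have "z = 0"
    using norm_and_cross_eq_0[of "cross3 p q" z] zr rr qq by auto
  then show ?thesis by (simp add: z_def)
qed

text \<open>The classical formula det(c, c', c'') / |c'|^3: normalizing the velocity removes the
  part of \<open>c2\<close> along \<open>c1 u\<close>, the tangential projection removes the part
  along \<open>c u\<close>, and only the normal part is left. It replaces the definite description
  by an expression that can be differentiated in a variation parameter.\<close>

lemma geodesic_curvature_eq:
  fixes c c1 :: "real \<Rightarrow> real^3"
  assumes "open U" "u \<in> U" and c_unit: "\<And>x. x \<in> U \<Longrightarrow> norm (c x) = 1"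
    and c1: "\<And>x. x \<in> U \<Longrightarrow> (c has_vector_derivative c1 x) (at x)"
    and c2: "(c1 has_vector_derivative c2) (at u)" and "c1 u \<noteq> 0"
  shows "geodesic_curvature c u = cross3 (c u) (c1 u) \<bullet> c2 / norm (c1 u) ^ 3"
proof -
  define n where "n = norm (c1 u)"
  have n: "n > 0" using assms by (simp add: n_def)
  have sp: "speed c x = norm (c1 x)" if "x \<in> U" for x
    using c1[OF that] by (simp add: speed_def vector_derivative_at)
  have ut: "unit_tangent c x = c1 x /\<^sub>R norm (c1 x)" if "x \<in> U" for x
    using c1[OF that] sp[OF that] by (simp add: unit_tangent_def arc_deriv_def vector_derivative_at)
  have "((\<lambda>x. c x \<bullet> c x) has_vector_derivative c u \<bullet> c1 u + c1 u \<bullet> c u) (at u)"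
    using has_derivative_inner[OF c1[OF \<open>u \<in> U\<close>, unfolded has_vector_derivative_def] c1[OF \<open>u \<in> U\<close>, unfolded has_vector_derivative_def]]
    by (simp add: has_vector_derivative_def algebra_simps)
  moreover have "((\<lambda>x. c x \<bullet> c x) has_vector_derivative 0) (at u)"
    using c_unit
    by (intro has_vector_derivative_transform_within_open[OF has_vector_derivative_const[of 1] \<open>open U\<close> \<open>u \<in> U\<close>])
      (simp add: norm_eq_1)
  ultimately have orth: "c u \<bullet> c1 u = 0"
    using vector_derivative_unique_at[of "\<lambda>x. c x \<bullet> c x"] by (force simp: inner_commute)
  \<comment> \<open>The derivative of \<open>c1 / norm c1\<close> at \<open>u\<close>, from the
    quotient rule.\<close>
  define X where "X = inverse n *\<^sub>R c2 - (c1 u \<bullet> c2 / n ^ 3) *\<^sub>R c1 u"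
  have nd: "((\<lambda>x. inverse (norm (c1 x))) has_derivative
       (\<lambda>h. - (inverse n * (h *\<^sub>R c2 \<bullet> (c1 u /\<^sub>R n)) * inverse n))) (at u)"
    unfolding n_def
    by (rule derivative_eq_intros has_derivative_compose[OF c2[unfolded has_vector_derivative_def] has_derivative_norm] 
         | use \<open>c1 u \<noteq> 0\<close> in \<open>simp add: sgn_div_norm\<close>)+
  have "((\<lambda>x. c1 x /\<^sub>R norm (c1 x)) has_vector_derivative X) (at u)"
    using has_derivative_scaleR[OF nd c2[unfolded has_vector_derivative_def]] n
    by (simp add: has_vector_derivative_def X_def n_def[symmetric] power3_eq_cube field_simps inner_commute
        scaleR_diff_right)
  then have "(unit_tangent c has_vector_derivative X) (at u)"
    by (rule has_vector_derivative_transform_within_open[OF _ \<open>open U\<close> \<open>u \<in> U\<close>]) (simp add: ut)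
  then have cov: "cov_deriv c (unit_tangent c) u = X /\<^sub>R n - ((X /\<^sub>R n) \<bullet> c u) *\<^sub>R c u"
    using sp[OF \<open>u \<in> U\<close>] by (simp add: cov_deriv_def arc_deriv_def vector_derivative_at n_def)
  have un: "unit_normal c u = cross3 (c u) (c1 u) /\<^sub>R n"
    using ut[OF \<open>u \<in> U\<close>] by (simp add: unit_normal_def cross_mult_right n_def)
  define k where "k = cross3 (c u) (c1 u) \<bullet> c2 / n ^ 3"
  have qq: "c1 u \<bullet> c1 u = n\<^sup>2" by (simp add: n_def power2_norm_eq_inner)
  have "(norm (cross3 (c u) (c1 u)))\<^sup>2 = n\<^sup>2"
    using norm_cross_dot[of "c u" "c1 u"] orth c_unit[OF \<open>u \<in> U\<close>] by (simp add: n_def)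
  then have un0: "unit_normal c u \<noteq> 0" using n by (auto simp: un)
  have e: "c2 = (c2 \<bullet> c u) *\<^sub>R c u + (c2 \<bullet> c1 u / n\<^sup>2) *\<^sub>R c1 u + (c2 \<bullet> cross3 (c u) (c1 u) / n\<^sup>2) *\<^sub>R cross3 (c u) (c1 u)"
    using orthogonal_expansion_3[OF c_unit[OF \<open>u \<in> U\<close>] orth \<open>c1 u \<noteq> 0\<close>, of c2] unfolding qq .
  have "X = inverse n *\<^sub>R (c2 - (c2 \<bullet> c1 u / n\<^sup>2) *\<^sub>R c1 u)"
    using n by (simp add: X_def algebra_simps inner_commute power3_eq_cube power2_eq_square divide_simps)
  also have "c2 - (c2 \<bullet> c1 u / n\<^sup>2) *\<^sub>R c1 u = (c2 \<bullet> c u) *\<^sub>R c u + (c2 \<bullet> cross3 (c u) (c1 u) / n\<^sup>2) *\<^sub>R cross3 (c u) (c1 u)"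
    by (subst e) (simp add: algebra_simps)
  finally have X: "X = inverse n *\<^sub>R ((c2 \<bullet> c u) *\<^sub>R c u + (c2 \<bullet> cross3 (c u) (c1 u) / n\<^sup>2) *\<^sub>R cross3 (c u) (c1 u))" .
  have "X \<bullet> c u = inverse n * (c2 \<bullet> c u)"
    using c_unit[OF \<open>u \<in> U\<close>] by (simp add: X inner_add_left dot_cross_self norm_eq_1)
  moreover have "cov_deriv c (unit_tangent c) u = inverse n *\<^sub>R (X - (X \<bullet> c u) *\<^sub>R c u)"
    by (simp add: cov algebra_simps)
  ultimately have "cov_deriv c (unit_tangent c) u = inverse n *\<^sub>R (X - (inverse n * (c2 \<bullet> c u)) *\<^sub>R c u)"
    by simp
  also have "\<dots> = k *\<^sub>R unit_normal c u"
    unfolding un X using n by (simp add: k_def scaleR_add_right power3_eq_cube power2_eq_square inner_commute divide_simps)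
  finally have "cov_deriv c (unit_tangent c) u = k *\<^sub>R unit_normal c u" .
  then show ?thesis
    unfolding geodesic_curvature_def k_def[unfolded n_def, symmetric]
    using un0 by (intro the_equality) auto
qed

section \<open>Partial derivatives of maps of two real variables\<close>

lemma C_k_on_partial_derivatives:
  fixes f :: "real \<times> real \<Rightarrow> 'b::real_normed_vector"
  assumes "C_k_on (Suc k) f U" "(t, s) \<in> U"
  shows "((\<lambda>t. f (t, s)) has_vector_derivative frechet_derivative f (at (t, s)) (1, 0)) (at t)"
    and "((\<lambda>s. f (t, s)) has_vector_derivative frechet_derivative f (at (t, s)) (0, 1)) (at s)"
proof -
  have d: "(f has_derivative frechet_derivative f (at (t, s))) (at (t, s))"
    using C_k_on_SucD(1)[OF assms(1)] assms(2) by auto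
  have l: "frechet_derivative f (at (t, s)) (h *\<^sub>R v) = h *\<^sub>R frechet_derivative f (at (t, s)) v" for h v
    using linear_scale[OF has_derivative_linear[OF d]] .
  have "((\<lambda>t. (t, s)) has_derivative (\<lambda>h. h *\<^sub>R (1, 0))) (at t)"
    by (auto intro!: derivative_eq_intros)
  from has_derivative_compose[OF this d]
  show "((\<lambda>t. f (t, s)) has_vector_derivative frechet_derivative f (at (t, s)) (1, 0)) (at t)"
    by (simp only: has_vector_derivative_def l)
  have "((\<lambda>s. (t, s)) has_derivative (\<lambda>h. h *\<^sub>R (0, 1))) (at s)"
    by (auto intro!: derivative_eq_intros)
  from has_derivative_compose[OF this d]
  show "((\<lambda>s. f (t, s)) has_vector_derivative frechet_derivative f (at (t, s)) (0, 1)) (at s)"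
    by (simp only: has_vector_derivative_def l)
qed

text \<open>Write \<open>F (t, s)\<close> as \<open>F (t, p)\<close> plus the integral of the
  \<open>s\<close>-derivative over \<open>{p..s}\<close>, differentiate in \<open>t\<close> under
  the integral sign, and then in \<open>s\<close> by the fundamental theorem of calculus. This makes
  the \<open>s\<close>-derivatives of the variation field available as \<open>t\<close>-derivatives
  of the velocity and acceleration.\<close>

lemma mixed_partial_derivatives:
  fixes F :: "real \<times> real \<Rightarrow> 'b::banach"
  assumes "open A" "convex A" "open I" and C2: "C_k_on 2 F (A \<times> I)" and "t0 \<in> A" "s0 \<in> I"
  shows "((\<lambda>s. frechet_derivative F (at (t0, s)) (1, 0)) has_vector_derivative
           frechet_derivative (\<lambda>x. frechet_derivative F (at x) (0, 1)) (at (t0, s0)) (1, 0)) (at s0)"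
proof -
  define Ft where "Ft x = frechet_derivative F (at x) (1, 0)" for x
  define Fs where "Fs x = frechet_derivative F (at x) (0, 1)" for x
  define Fst where "Fst x = frechet_derivative Fs (at x) (1, 0)" for x
  have C2': "C_k_on (Suc (Suc 0)) F (A \<times> I)" using C2 by (simp add: numeral_2_eq_2)
  have CFs: "C_k_on (Suc 0) Fs (A \<times> I)"
    unfolding Fs_def using C_k_on_SucD(2)[OF C2'] .
  have cFst: "continuous_on (A \<times> I) Fst"
    unfolding Fst_def using C_k_on_SucD(2)[OF CFs] by simp
  have cFs: "continuous_on (A \<times> I) Fs"
    using C_k_on_continuous_on[OF CFs] .
  note pt = C_k_on_partial_derivatives(1) and ps = C_k_on_partial_derivatives(2)
  obtain r where r: "r > 0" "cball s0 r \<subseteq> I"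
    using \<open>open I\<close> \<open>s0 \<in> I\<close> open_contains_cball by blast
  define p where "p = s0 - r"
  define q where "q = s0 + r"
  have pq: "{p..q} \<subseteq> I" "p < s0" "s0 < q"
    using r by (auto simp: p_def q_def cball_eq_atLeastAtMost)
  have cont_slice: "continuous_on {p..s} (\<lambda>r. f (t, r))"
    if "continuous_on (A \<times> I) f" "t \<in> A" "s \<le> q" for f :: "real \<times> real \<Rightarrow> 'b" and s t
    using that pq by (intro continuous_on_compose2[OF that(1)]) (auto intro!: continuous_intros)
  \<comment> \<open>Two expressions for the same \<open>t\<close>-derivative of
    \<open>F (t, s)\<close> at \<open>t0\<close> are compared; the right-hand side can be
    differentiated in \<open>s\<close>.\<close>
  have main: "Ft (t0, s) = Ft (t0, p) + integral {p..s} (\<lambda>r. Fst (t0, r))" if "s \<in> {p..q}" for s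
  proof -
    have F: "F (t, s) = F (t, p) + integral (cbox p s) (\<lambda>r. Fs (t, r))" if "t \<in> A" for t
    proof -
      have "((\<lambda>r. Fs (t, r)) has_integral F (t, s) - F (t, p)) {p..s}"
      proof (rule fundamental_theorem_of_calculus)
        show "((\<lambda>r. F (t, r)) has_vector_derivative Fs (t, x)) (at x within {p..s})"
          if "x \<in> {p..s}" for x
          unfolding Fs_def using \<open>s \<in> {p..q}\<close> pq \<open>t \<in> A\<close> that
          by (intro has_vector_derivative_at_within[OF ps[OF C2']]) auto
      qed (use \<open>s \<in> {p..q}\<close> in auto)
      then show ?thesis by (simp add: integral_unique)
    qed
    have "((\<lambda>t. integral (cbox p s) (\<lambda>r. Fs (t, r))) has_vector_derivative
        integral (cbox p s) (\<lambda>r. Fst (t0, r))) (at t0 within A)"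
    proof (rule leibniz_rule_vector_derivative)
      show "((\<lambda>t. Fs (t, r)) has_vector_derivative Fst (t, r)) (at t within A)"
        if "t \<in> A" "r \<in> cbox p s" for t r
        unfolding Fst_def using that \<open>s \<in> {p..q}\<close> pq
        by (intro has_vector_derivative_at_within[OF pt[OF CFs]]) auto
      show "(\<lambda>r. Fs (t, r)) integrable_on cbox p s" if "t \<in> A" for t
        using cont_slice[OF cFs that] \<open>s \<in> {p..q}\<close> by (auto intro: integrable_continuous_real)
      show "continuous_on (A \<times> cbox p s) (\<lambda>(t, r). Fst (t, r))"
        using \<open>s \<in> {p..q}\<close> pq by (auto intro!: continuous_on_subset[OF cFst])
    qed (use assms in auto)
    then have "((\<lambda>t. integral (cbox p s) (\<lambda>r. Fs (t, r))) has_vector_derivative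
        integral (cbox p s) (\<lambda>r. Fst (t0, r))) (at t0)"
      using at_within_open[OF \<open>t0 \<in> A\<close> \<open>open A\<close>] by simp
    moreover have "((\<lambda>t. F (t, p)) has_vector_derivative Ft (t0, p)) (at t0)"
      unfolding Ft_def using pq \<open>t0 \<in> A\<close> by (intro pt[OF C2']) auto
    ultimately have "((\<lambda>t. F (t, p) + integral (cbox p s) (\<lambda>r. Fs (t, r))) has_vector_derivative
        Ft (t0, p) + integral (cbox p s) (\<lambda>r. Fst (t0, r))) (at t0)"
      by (intro has_vector_derivative_add)
    then have "((\<lambda>t. F (t, s)) has_vector_derivative
        Ft (t0, p) + integral (cbox p s) (\<lambda>r. Fst (t0, r))) (at t0)"
      by (rule has_vector_derivative_transform_within_open[OF _ \<open>open A\<close> \<open>t0 \<in> A\<close>]) (simp add: F)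
    moreover have "((\<lambda>t. F (t, s)) has_vector_derivative Ft (t0, s)) (at t0)"
      unfolding Ft_def using pq \<open>t0 \<in> A\<close> that by (intro pt[OF C2']) auto
    ultimately show ?thesis
      using vector_derivative_unique_at by fastforce
  qed
  have "((\<lambda>s. Ft (t0, p) + integral {p..s} (\<lambda>r. Fst (t0, r))) has_vector_derivative 0 + Fst (t0, s0))
      (at s0 within {p..q})"
    using pq by (intro has_vector_derivative_add has_vector_derivative_const integral_has_vector_derivative
        cont_slice[OF cFst \<open>t0 \<in> A\<close>]) auto
  then have "((\<lambda>s. Ft (t0, s)) has_vector_derivative 0 + Fst (t0, s0)) (at s0 within {p..q})"
    by (rule has_vector_derivative_transform[rotated 2]) (use pq in simp, rule main)
  then have "((\<lambda>s. Ft (t0, s)) has_vector_derivative Fst (t0, s0)) (at s0)"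
    using pq at_within_interior[of s0 "{p..q}"] by simp
  then show ?thesis
    by (simp add: Ft_def Fst_def Fs_def[abs_def])
qed

subsection \<open>The first variation\<close>

lemmas has_vector_derivative_inner = bounded_bilinear.has_vector_derivative[OF bounded_bilinear_inner]
lemmas has_vector_derivative_cross = bounded_bilinear.has_vector_derivative[OF bounded_bilinear_cross]

lemma cross_inner_assoc: "cross3 a b \<bullet> c = a \<bullet> cross3 b c"
  by (simp add: cross3_simps)

lemma inner_derivative_const:
  fixes f g :: "real \<Rightarrow> 'a::real_inner"
  assumes "open U" "u \<in> U" "(f has_vector_derivative f') (at u)" "(g has_vector_derivative g') (at u)"
    and "\<And>x. x \<in> U \<Longrightarrow> f x \<bullet> g x = k"
  shows "f u \<bullet> g' + f' \<bullet> g u = 0"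
proof -
  have "((\<lambda>x. f x \<bullet> g x) has_vector_derivative 0) (at u)"
    by (rule has_vector_derivative_transform_within_open[OF has_vector_derivative_const[of k] assms(1,2)])
      (simp add: assms(5))
  with has_vector_derivative_inner[OF assms(3,4)] show ?thesis
    using vector_derivative_unique_at by blast
qed

lemma orthonormal_cross:
  fixes p q :: "real^3"
  assumes "norm p = 1" "norm q = 1" "p \<bullet> q = 0"
  shows "cross3 q (cross3 p q) = p" "cross3 (cross3 p q) p = q"
    "cross3 p q \<bullet> p = 0" "cross3 p q \<bullet> q = 0" "cross3 p q \<bullet> cross3 p q = 1"
proof -
  have "cross3 q (cross3 p q) = (q \<bullet> q) *\<^sub>R p - (p \<bullet> q) *\<^sub>R q"
    by (simp add: cross3_simps forall_3)
  then show "cross3 q (cross3 p q) = p" using assms by (simp add: norm_eq_1)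
  have "cross3 (cross3 p q) p = (p \<bullet> p) *\<^sub>R q - (p \<bullet> q) *\<^sub>R p"
    by (simp add: cross3_simps forall_3)
  then show "cross3 (cross3 p q) p = q" using assms by (simp add: norm_eq_1)
  show "cross3 p q \<bullet> p = 0" "cross3 p q \<bullet> q = 0" by (simp_all add: dot_cross_self)
  have "(norm (cross3 p q))\<^sup>2 = 1" using norm_cross_dot[of p q] assms by simp
  then show "cross3 p q \<bullet> cross3 p q = 1" by (simp add: power2_norm_eq_inner)
qed

text \<open>The components of the derivative of the tangent come from differentiating constant inner
  products: -1 along \<open>\<gamma>\<close> (from \<open>\<gamma> \<bullet> T = 0\<close>), 0 along
  \<open>T\<close>, and the curvature along \<open>N\<close>. The term \<open>- \<gamma> s\<close>
  is the normal curvature of the sphere. Two derivatives of \<open>\<gamma>\<close> are spent on the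
  curvature, which is therefore \<open>C^2\<close>.\<close>

lemma arclength_frenet:
  assumes "arclength_curve I \<gamma>"
  shows "\<And>s. s \<in> I \<Longrightarrow> norm (\<gamma> s) = 1"
    and "\<And>s. s \<in> I \<Longrightarrow> norm (unit_tangent \<gamma> s) = 1"
    and "\<And>s. s \<in> I \<Longrightarrow> \<gamma> s \<bullet> unit_tangent \<gamma> s = 0"
    and "\<And>s. s \<in> I \<Longrightarrow> (\<gamma> has_vector_derivative unit_tangent \<gamma> s) (at s)"
    and "\<And>s. s \<in> I \<Longrightarrow> (unit_tangent \<gamma> has_vector_derivative
           geodesic_curvature \<gamma> s *\<^sub>R unit_normal \<gamma> s - \<gamma> s) (at s)"
    and "\<And>s. s \<in> I \<Longrightarrow> (unit_normal \<gamma> has_vector_derivative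
           - geodesic_curvature \<gamma> s *\<^sub>R unit_tangent \<gamma> s) (at s)"
    and "C_k_on 3 (unit_tangent \<gamma>) I" and "C_k_on 2 (geodesic_curvature \<gamma>) I"
proof -
  let ?T = "unit_tangent \<gamma>" and ?N = "unit_normal \<gamma>" and ?\<kappa> = "geodesic_curvature \<gamma>"
  have I: "open I" and C4: "C_k_on (Suc 3) \<gamma> I" and sp: "\<And>s. s \<in> I \<Longrightarrow> speed \<gamma> s = 1"
    and n1: "\<And>s. s \<in> I \<Longrightarrow> norm (\<gamma> s) = 1"
    using assms by (auto simp: arclength_curve_def image_subset_iff simp flip: numeral_eq_Suc)
  show "\<And>s. s \<in> I \<Longrightarrow> norm (\<gamma> s) = 1" by fact
  have T: "?T s = vector_derivative \<gamma> (at s)" if "s \<in> I" for s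
    using sp[OF that] by (simp add: unit_tangent_def arc_deriv_def)
  show d1: "(\<gamma> has_vector_derivative ?T s) (at s)" if "s \<in> I" for s
    using C_k_on_vderivD(1)[OF I C4 that] T[OF that] by simp
  show nT: "norm (?T s) = 1" if "s \<in> I" for s
    using sp[OF that] T[OF that] by (simp add: speed_def)
  show C3: "C_k_on 3 ?T I"
    by (rule C_k_on_cong[OF I _ C_k_on_vderivD(2)[OF I C4]]) (simp add: T)
  show gT: "\<gamma> s \<bullet> ?T s = 0" if "s \<in> I" for s
    using inner_derivative_const[OF I that d1[OF that] d1[OF that], of 1] n1
    by (simp add: norm_eq_1 inner_commute)
  have C3': "C_k_on (Suc 2) ?T I" using C3 by simp
  define T' where "T' s = vector_derivative ?T (at s)" for s
  have dT: "(?T has_vector_derivative T' s) (at s)" if "s \<in> I" for s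
    unfolding T'_def using C_k_on_vderivD(1)[OF I C3' that] .
  have CT': "C_k_on 2 T' I"
    unfolding T'_def[abs_def] using C_k_on_vderivD(2)[OF I C3'] .
  have k: "?\<kappa> s = ?N s \<bullet> T' s" if "s \<in> I" for s
    using geodesic_curvature_eq[OF I that n1 d1 dT[OF that]] nT[OF that]
    by (force simp: unit_normal_def)
  show "C_k_on 2 ?\<kappa> I"
  proof (rule C_k_on_cong[OF I])
    show "C_k_on 2 (\<lambda>s. cross3 (\<gamma> s) (?T s) \<bullet> T' s) I"
      by (intro C_k_on_inner C_k_on_cross I CT' C_k_on_mono[OF C3] C_k_on_mono[OF C4]) auto
  qed (simp add: k unit_normal_def)
  have T'_eq: "T' s = ?\<kappa> s *\<^sub>R ?N s - \<gamma> s" if "s \<in> I" for s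
  proof -
    have "\<gamma> s \<bullet> T' s = -1"
      using inner_derivative_const[OF I that d1[OF that] dT[OF that] gT] nT[OF that]
      by (simp add: norm_eq_1)
    moreover have "?T s \<bullet> T' s = 0"
      using inner_derivative_const[OF I that dT[OF that] dT[OF that], of 1] nT
      by (simp add: norm_eq_1 inner_commute)
    moreover have "?T s \<bullet> ?T s = 1" using nT[OF that] by (simp add: norm_eq_1)
    moreover have "?T s \<noteq> 0" using nT[OF that] by auto
    ultimately show ?thesis
      using orthogonal_expansion_3[OF n1[OF that] gT[OF that], of "T' s"] k[OF that]
      by (simp add: unit_normal_def inner_commute)
  qed
  then show "(?T has_vector_derivative ?\<kappa> s *\<^sub>R ?N s - \<gamma> s) (at s)" if "s \<in> I" for s
    using dT[OF that] that by simp
  show "(?N has_vector_derivative - ?\<kappa> s *\<^sub>R ?T s) (at s)" if "s \<in> I" for s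
  proof -
    have "((\<lambda>s. cross3 (\<gamma> s) (?T s)) has_vector_derivative
        cross3 (\<gamma> s) (T' s) + cross3 (?T s) (?T s)) (at s)"
      by (intro has_vector_derivative_cross d1 dT that)
    moreover have "cross3 (\<gamma> s) (T' s) = - ?\<kappa> s *\<^sub>R ?T s"
      using orthonormal_cross(2)[OF n1[OF that] nT[OF that] gT[OF that]]
        cross_skew[of "\<gamma> s" "?N s"]
      by (simp add: T'_eq[OF that] Cross3.right_diff_distrib cross_mult_right unit_normal_def)
    ultimately show ?thesis by (simp add: unit_normal_def[abs_def])
  qed
qed

text \<open>With \<open>\<sigma>\<close> the sign of the curvature,
  \<open>\<bar>\<kappa>\<bar> = \<sigma> * \<kappa>\<close> stays positive on the compact interval
  for small \<open>t\<close>, so the integrand is smooth there and differentiation under the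
  integral is allowed. \<open>V1\<close> and \<open>V2\<close> are the first two derivatives of the
  variation field.\<close>

lemma first_variation:
  fixes lam \<sigma> :: real
  assumes \<gamma>: "arclength_curve I \<gamma>" and var: "variation e I \<gamma> \<Gamma>" and "a \<le> b" and ab: "{a..b} \<subseteq> I"
    and \<sigma>: "\<sigma> = 1 \<or> \<sigma> = -1" and pos: "\<And>s. s \<in> {a..b} \<Longrightarrow> 0 < \<sigma> * geodesic_curvature \<gamma> s"
  defines "V \<equiv> \<lambda>s. vector_derivative (\<lambda>t. \<Gamma> t s) (at 0)"
  obtains V1 V2 where "\<And>s. s \<in> I \<Longrightarrow> (V has_vector_derivative V1 s) (at s)"
    and "\<And>s. s \<in> I \<Longrightarrow> (V1 has_vector_derivative V2 s) (at s)"
    and "continuous_on I V2" and "\<And>s. s \<in> I \<Longrightarrow> V s \<bullet> \<gamma> s = 0"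
    and "((\<lambda>t. B_functional lam (\<Gamma> t) {a..b}) has_real_derivative
      integral {a..b} (\<lambda>s. \<sigma> / (2 * sqrt (\<sigma> * geodesic_curvature \<gamma> s)) * ((V s + V2 s) \<bullet> unit_normal \<gamma> s)
        + lam * (V1 s \<bullet> unit_tangent \<gamma> s))) (at 0)"
proof -
  let ?T = "unit_tangent \<gamma>" and ?N = "unit_normal \<gamma>" and ?\<kappa> = "geodesic_curvature \<gamma>"
  have I: "open I" using \<gamma> by (simp add: arclength_curve_def)
  note fr = arclength_frenet[OF \<gamma>]
  define A where "A = {-e<..<e}"
  have A: "open A" "convex A" "0 \<in> A" using var by (auto simp: A_def variation_def)
  define F where "F = (\<lambda>(t, s). \<Gamma> t s)"
  define Fs where "Fs x = frechet_derivative F (at x) (0, 1)" for x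
  define Ft where "Ft x = frechet_derivative F (at x) (1, 0)" for x
  define Fss where "Fss x = frechet_derivative Fs (at x) (0, 1)" for x
  define Fst where "Fst x = frechet_derivative Fs (at x) (1, 0)" for x
  define Fsst where "Fsst x = frechet_derivative Fss (at x) (1, 0)" for x
  have C4: "C_k_on (Suc 3) F (A \<times> I)" and C4': "C_k_on (Suc (Suc 2)) F (A \<times> I)"
    using var by (simp_all add: variation_def F_def A_def flip: numeral_eq_Suc)
  have CFs: "C_k_on (Suc 2) Fs (A \<times> I)" and CFs': "C_k_on (Suc (Suc 1)) Fs (A \<times> I)" 
    using C_k_on_SucD(2)[OF C4, of "(0,1)"] by (simp_all add: Fs_def[abs_def] numeral_3_eq_3 numeral_2_eq_2)
  have CFss: "C_k_on (Suc 1) Fss (A \<times> I)"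
    using C_k_on_SucD(2)[OF CFs, of "(0,1)"] by (simp add: Fss_def[abs_def] numeral_2_eq_2)
  have C2: "C_k_on 2 F (A \<times> I)" "C_k_on 2 Fs (A \<times> I)"
    using C_k_on_mono[OF C4, of 2] C_k_on_mono[OF CFs, of 2] by auto
  have cont: "continuous_on (A \<times> I) F" "continuous_on (A \<times> I) Fs" "continuous_on (A \<times> I) Fss"
    "continuous_on (A \<times> I) Ft" "continuous_on (A \<times> I) Fst" "continuous_on (A \<times> I) Fsst"
    unfolding Ft_def[abs_def] Fst_def[abs_def] Fsst_def[abs_def]
    by (rule C_k_on_continuous_on[OF C4] C_k_on_continuous_on[OF CFs] C_k_on_continuous_on[OF CFss]
        C_k_on_continuous_on[OF C_k_on_SucD(2)[OF C4]] C_k_on_continuous_on[OF C_k_on_SucD(2)[OF CFs]]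
        C_k_on_continuous_on[OF C_k_on_SucD(2)[OF CFss]])+
  have dFs: "((\<lambda>s. \<Gamma> t s) has_vector_derivative Fs (t, s)) (at s)"
    and dFss: "((\<lambda>s. Fs (t, s)) has_vector_derivative Fss (t, s)) (at s)"
    and dFt: "((\<lambda>t. \<Gamma> t s) has_vector_derivative Ft (t, s)) (at t)"
    and dFst: "((\<lambda>t. Fs (t, s)) has_vector_derivative Fst (t, s)) (at t)"
    and dFsst: "((\<lambda>t. Fss (t, s)) has_vector_derivative Fsst (t, s)) (at t)"
    and dFts: "((\<lambda>s. Ft (t, s)) has_vector_derivative Fst (t, s)) (at s)"
    and dFtss: "((\<lambda>s. Fst (t, s)) has_vector_derivative Fsst (t, s)) (at s)"
    if "t \<in> A" "s \<in> I" for t s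
    using that C_k_on_partial_derivatives[OF C4, of t s] C_k_on_partial_derivatives[OF CFs, of t s]
      C_k_on_partial_derivatives(1)[OF CFss, of t s] mixed_partial_derivatives[OF A(1,2) I C2(1), of t s]
      mixed_partial_derivatives[OF A(1,2) I C2(2), of t s]
    by (simp_all add: Fs_def[abs_def] Fss_def[abs_def] Ft_def Fst_def Fsst_def F_def)
  have unit: "norm (\<Gamma> t s) = 1" if "t \<in> A" "s \<in> I" for t s
    using var that by (force simp: variation_def A_def image_subset_iff)
  have F0: "\<Gamma> 0 s = \<gamma> s" if "s \<in> I" for s
    using var that by (simp add: variation_def)
  have Fs0: "Fs (0, s) = ?T s" if "s \<in> I" for s
  proof -
    have "(\<gamma> has_vector_derivative Fs (0, s)) (at s)"
      by (rule has_vector_derivative_transform_within_open[OF dFs[OF A(3) that] I that]) (simp add: F0)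
    then show ?thesis using fr(4)[OF that] vector_derivative_unique_at by blast
  qed
  have Fss0: "Fss (0, s) = ?\<kappa> s *\<^sub>R ?N s - \<gamma> s" if "s \<in> I" for s
  proof -
    have "(?T has_vector_derivative Fss (0, s)) (at s)"
      by (rule has_vector_derivative_transform_within_open[OF dFss[OF A(3) that] I that]) (simp add: Fs0)
    then show ?thesis using fr(5)[OF that] vector_derivative_unique_at by blast
  qed
  have V: "V s = Ft (0, s)" if "s \<in> I" for s
    unfolding V_def using dFt[OF A(3) that] by (rule vector_derivative_at)
  \<comment> \<open>The curvature is \<open>D / q ^ 3\<close> and the length element
    \<open>q\<close>, so the curvature part of the integrand is
    \<open>sqrt (\<sigma> * D / q)\<close>, the first term of \<open>G\<close> below.\<close>
  define D where "D x = cross3 (F x) (Fs x) \<bullet> Fss x" for x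
  define q where "q x = norm (Fs x)" for x
  have contD: "continuous_on (A \<times> I) D" and contq: "continuous_on (A \<times> I) q"
    unfolding D_def[abs_def] q_def[abs_def] by (intro continuous_intros continuous_on_cross cont)+
  define W where "W = (A \<times> I) \<inter> (\<lambda>x. (\<sigma> * D x, q x)) -` ({0<..} \<times> {0<..})"
  have W: "open W"
    unfolding W_def using A I
    by (intro continuous_open_preimage continuous_intros contD contq open_Times) auto
  have q0: "q (0, s) = 1" if "s \<in> I" for s
    using fr(2)[OF that] by (simp add: q_def Fs0[OF that])
  have D0: "D (0, s) = ?\<kappa> s" if "s \<in> I" for s
    using orthonormal_cross[OF fr(1)[OF that] fr(2)[OF that] fr(3)[OF that]] that
    by (simp add: D_def F_def F0 Fs0 Fss0 inner_diff_right unit_normal_def)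
  \<comment> \<open>Regularity and the sign of \<open>D\<close> hold at \<open>t = 0\<close>;
    compactness of \<open>{a..b}\<close> and the tube lemma give one time bound for the whole
    interval.\<close>
  have "\<exists>\<delta>>0. {-\<delta><..<\<delta>} \<times> {a..b} \<subseteq> W"
  proof -
    let ?U = "({a..b} \<times> A) \<inter> ((\<lambda>x. (snd x, fst x)) -` W)"
    obtain X where X: "openin (top_of_set A) X" "0 \<in> X" "{a..b} \<times> X \<subseteq> ?U"
    proof (rule tube_lemma[of "{a..b}" 0 ?U A])
      show "(\<lambda>x. (x, 0)) ` {a..b} \<subseteq> ?U"
        using A ab pos by (auto simp: W_def D0 q0)
      show "openin (top_of_set ({a..b} \<times> A)) ?U"
        using W by (intro openin_open_Int open_vimage continuous_intros)
    qed (use \<open>a \<le> b\<close> in auto)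
    then have "open X" using A(1) openin_open_eq by blast
    then obtain \<delta> where "\<delta> > 0" "ball 0 \<delta> \<subseteq> X" using X(2) openE by blast
    with X(3) show ?thesis
      by (intro exI[of _ \<delta>]) (auto simp: ball_eq_greaterThanLessThan subset_iff)
  qed
  then obtain \<delta> where \<delta>: "\<delta> > 0" "{-\<delta><..<\<delta>} \<times> {a..b} \<subseteq> W" by blast
  define U where "U = {-\<delta><..<\<delta>}"
  have inW: "t \<in> A" "s \<in> I" "0 < \<sigma> * D (t, s)" "0 < q (t, s)" if "t \<in> U" "s \<in> {a..b}" for t s
  proof -
    have "(t, s) \<in> W" using \<delta>(2) that by (auto simp: U_def)
    then show "t \<in> A" "s \<in> I" "0 < \<sigma> * D (t, s)" "0 < q (t, s)" by (auto simp: W_def)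
  qed
  have inAI: "U \<times> {a..b} \<subseteq> A \<times> I" using inW by auto
  define G where "G t s = sqrt (\<sigma> * D (t, s) / q (t, s)) + lam * q (t, s)" for t s
  have B: "B_functional lam (\<Gamma> t) {a..b} = integral (cbox a b) (G t)" if "t \<in> U" for t
  proof -
    have "(sqrt \<bar>geodesic_curvature (\<Gamma> t) s\<bar> + lam) * speed (\<Gamma> t) s = G t s" if s: "s \<in> {a..b}" for s
    proof -
      note w = inW[OF \<open>t \<in> U\<close> s]
      have k: "geodesic_curvature (\<Gamma> t) s = D (t, s) / q (t, s) ^ 3"
        using geodesic_curvature_eq[OF I w(2) unit[OF w(1)] dFs[OF w(1)] dFss[OF w(1,2)]] w(4)
        by (simp add: D_def q_def F_def)
      have "\<bar>D (t, s) / q (t, s) ^ 3\<bar> = \<sigma> * D (t, s) / q (t, s) ^ 3"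
        using w(3,4) \<sigma> by auto
      moreover have "sqrt (\<sigma> * D (t, s) / q (t, s) ^ 3) * q (t, s) = sqrt (\<sigma> * D (t, s) / q (t, s) ^ 3 * (q (t, s))\<^sup>2)"
        using w(4) unfolding real_sqrt_mult[of _ "(q (t, s))\<^sup>2"] by simp
      moreover have "\<sigma> * D (t, s) / q (t, s) ^ 3 * (q (t, s))\<^sup>2 = \<sigma> * D (t, s) / q (t, s)"
        using w(4) by (simp add: power3_eq_cube power2_eq_square)
      moreover have "speed (\<Gamma> t) s = q (t, s)"
        using dFs[OF w(1,2)] by (simp add: speed_def q_def vector_derivative_at)
      ultimately show ?thesis by (simp add: k G_def distrib_right)
    qed
    then show ?thesis unfolding B_functional_def by (auto intro: integral_cong)
  qed
  define qt where "qt x = Fs x \<bullet> Fst x / q x" for x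
  define Dt where "Dt x = (cross3 (F x) (Fst x) + cross3 (Ft x) (Fs x)) \<bullet> Fss x + cross3 (F x) (Fs x) \<bullet> Fsst x" for x
  define Gt where "Gt t s = (\<sigma> * Dt (t, s) / q (t, s) - \<sigma> * D (t, s) * qt (t, s) / (q (t, s))\<^sup>2)
     * (inverse (sqrt (\<sigma> * D (t, s) / q (t, s))) / 2) + lam * qt (t, s)" for t s
  have dG: "((\<lambda>t. G t s) has_real_derivative Gt t s) (at t)" if "t \<in> U" "s \<in> {a..b}" for t s
  proof -
    note w = inW[OF that]
    have "((\<lambda>t. D (t, s)) has_vector_derivative Dt (t, s)) (at t)"
      using has_vector_derivative_inner[OF has_vector_derivative_cross[OF dFt[OF w(1,2)] dFst[OF w(1,2)]] dFsst[OF w(1,2)]]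
      by (simp add: D_def F_def Dt_def add.commute)
    then have 1: "((\<lambda>t. D (t, s)) has_real_derivative Dt (t, s)) (at t)"
      by (simp add: has_real_derivative_iff_has_vector_derivative)
    have "((\<lambda>t. q (t, s)) has_derivative (\<lambda>h. (h *\<^sub>R Fst (t, s)) \<bullet> sgn (Fs (t, s)))) (at t)"
      unfolding q_def using w(4)
      by (intro has_derivative_compose[OF dFst[OF w(1,2), unfolded has_vector_derivative_def] has_derivative_norm]) (auto simp: q_def)
    then have 2: "((\<lambda>t. q (t, s)) has_real_derivative qt (t, s)) (at t)"
      unfolding has_field_derivative_def
      by (rule has_derivative_eq_rhs) (simp add: fun_eq_iff qt_def sgn_div_norm q_def inner_commute divide_inverse)
    show ?thesis
      unfolding G_def[abs_def] Gt_def using w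
      by (auto intro!: derivative_eq_intros 1 2 simp: power2_eq_square field_simps)
  qed
  have "((\<lambda>t. integral (cbox a b) (G t)) has_field_derivative integral (cbox a b) (Gt 0)) (at 0 within U)"
  proof (rule leibniz_rule_field_derivative)
    show "((\<lambda>t. G t s) has_real_derivative Gt t s) (at t within U)" if "t \<in> U" "s \<in> cbox a b" for t s
      using dG that by (auto intro: has_field_derivative_at_within)
    have cG: "continuous_on {a..b} (G t)" if "t \<in> U" for t
    proof -
      have "continuous_on {a..b} (\<lambda>s. D (t, s))" "continuous_on {a..b} (\<lambda>s. q (t, s))"
        using inW[OF that]
        by (auto intro!: continuous_on_compose2[OF contD] continuous_on_compose2[OF contq] continuous_intros)
      then show ?thesis unfolding G_def using inW[OF that]
        by (intro continuous_intros) (auto simp: less_imp_neq[symmetric])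
    qed
    show "G t integrable_on cbox a b" if "t \<in> U" for t
      using cG[OF that] by (auto intro: integrable_continuous_real)
    have cs: "continuous_on (U \<times> {a..b}) f" if "continuous_on (A \<times> I) f" for f :: "_ \<Rightarrow> 'z::topological_space"
      using that inAI continuous_on_subset by blast
    have nz: "q x \<noteq> 0" "sqrt (\<sigma> * D x / q x) \<noteq> 0" if x: "x \<in> U \<times> {a..b}" for x
    proof -
      obtain t s where "x = (t, s)" "t \<in> U" "s \<in> {a..b}" using x by auto
      then show "q x \<noteq> 0" "sqrt (\<sigma> * D x / q x) \<noteq> 0" using inW(3,4)[of t s] by auto
    qed
    note c = cs[OF cont(1)] cs[OF cont(2)] cs[OF cont(3)] cs[OF cont(4)] cs[OF cont(5)] cs[OF cont(6)]
      cs[OF contD] cs[OF contq]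
    have c': "continuous_on (U \<times> {a..b}) qt" "continuous_on (U \<times> {a..b}) Dt"
      unfolding qt_def[abs_def] Dt_def[abs_def]
      by (intro continuous_intros continuous_on_cross c ballI nz; assumption)+
    have e: "(\<lambda>(t, s). Gt t s) = (\<lambda>x. (\<sigma> * Dt x / q x - \<sigma> * D x * qt x / (q x)\<^sup>2)
       * (inverse (sqrt (\<sigma> * D x / q x)) / 2) + lam * qt x)"
      by (simp add: Gt_def fun_eq_iff)
    show "continuous_on (U \<times> cbox a b) (\<lambda>(t, s). Gt t s)"
      unfolding e box_real
      by (intro continuous_on_add continuous_on_mult continuous_on_diff continuous_on_divide continuous_on_inverse
          continuous_on_real_sqrt continuous_on_power continuous_on_const c c' ballI power_not_zero nz; (assumption | simp))
  qed (use \<delta> in \<open>auto simp: U_def\<close>)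
  moreover have "open U" "0 \<in> U" using \<delta> by (auto simp: U_def)
  ultimately have "((\<lambda>t. integral (cbox a b) (G t)) has_field_derivative integral (cbox a b) (Gt 0)) (at 0)"
    using at_within_open by metis
  then have der: "((\<lambda>t. B_functional lam (\<Gamma> t) {a..b}) has_field_derivative integral (cbox a b) (Gt 0)) (at 0)"
    by (rule has_field_derivative_transform_within_open[OF _ \<open>open U\<close> \<open>0 \<in> U\<close>]) (simp add: B)
  have V\<gamma>: "V s \<bullet> \<gamma> s = 0" if "s \<in> I" for s
    using inner_derivative_const[OF A(1,3) dFt[OF A(3) that] dFt[OF A(3) that], of 1] unit that
    by (simp add: norm_eq_1 V F0 inner_commute)
  \<comment> \<open>The tangential terms cancel: \<open>Dt\<close> contains \<open>\<kappa>\<close>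
    times \<open>V1 \<bullet> T\<close>, and the derivative of the speed,
    \<open>V1 \<bullet> T\<close>, enters with the factor \<open>- \<kappa>\<close>. What remains
    beside the length term is \<open>(V + V2) \<bullet> N\<close>.\<close>
  have Gt0: "Gt 0 s = \<sigma> / (2 * sqrt (\<sigma> * ?\<kappa> s)) * ((V s + Fsst (0, s)) \<bullet> ?N s)
        + lam * (Fst (0, s) \<bullet> ?T s)" if s: "s \<in> {a..b}" for s
  proof -
    have sI: "s \<in> I" using s ab by auto
    note o = orthonormal_cross[OF fr(1)[OF sI] fr(2)[OF sI] fr(3)[OF sI], folded unit_normal_def]
    have 1: "cross3 (\<gamma> s) w \<bullet> (?\<kappa> s *\<^sub>R ?N s - \<gamma> s) = ?\<kappa> s * (w \<bullet> ?T s)" for w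
    proof -
      have "cross3 (\<gamma> s) w \<bullet> ?N s = w \<bullet> cross3 (?N s) (\<gamma> s)"
        by (simp add: cross3_simps)
      then show ?thesis by (simp add: inner_diff_right dot_cross_self o)
    qed
    have 2: "cross3 w (?T s) \<bullet> (?\<kappa> s *\<^sub>R ?N s - \<gamma> s) = ?\<kappa> s * (w \<bullet> \<gamma> s) + w \<bullet> ?N s" for w
      using cross_skew[of "?T s" "\<gamma> s"]
      by (simp add: inner_diff_right cross_inner_assoc o unit_normal_def[symmetric])
    have "Dt (0, s) = ?\<kappa> s * (Fst (0, s) \<bullet> ?T s) + V s \<bullet> ?N s + ?N s \<bullet> Fsst (0, s)"
      by (simp add: Dt_def F_def F0 Fs0 Fss0 sI inner_add_left 1 2 V\<gamma> V[symmetric] unit_normal_def[symmetric])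
    moreover have "qt (0, s) = Fst (0, s) \<bullet> ?T s"
      by (simp add: qt_def q0 sI Fs0 inner_commute)
    ultimately show ?thesis
      by (simp add: Gt_def q0 D0 sI inner_add_left inner_add_right inner_commute field_simps)
  qed
  show thesis
  proof (rule that[of "\<lambda>s. Fst (0, s)" "\<lambda>s. Fsst (0, s)"])
    show "(V has_vector_derivative Fst (0, s)) (at s)" if "s \<in> I" for s
      by (rule has_vector_derivative_transform_within_open[OF dFts[OF A(3) that] I that]) (simp add: V)
    show "((\<lambda>s. Fst (0, s)) has_vector_derivative Fsst (0, s)) (at s)" if "s \<in> I" for s
      using dFtss[OF A(3) that] .
    show "continuous_on I (\<lambda>s. Fsst (0, s))"
      using A by (intro continuous_on_compose2[OF cont(6)]) (auto intro!: continuous_intros)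
    show "V s \<bullet> \<gamma> s = 0" if "s \<in> I" for s by (rule V\<gamma>[OF that])
    have "integral (cbox a b) (Gt 0) = integral {a..b} (\<lambda>s. \<sigma> / (2 * sqrt (\<sigma> * ?\<kappa> s)) * ((V s + Fsst (0, s)) \<bullet> ?N s)
        + lam * (Fst (0, s) \<bullet> ?T s))"
      using Gt0 by (auto intro: integral_cong)
    then show "((\<lambda>t. B_functional lam (\<Gamma> t) {a..b}) has_real_derivative
      integral {a..b} (\<lambda>s. \<sigma> / (2 * sqrt (\<sigma> * ?\<kappa> s)) * ((V s + Fsst (0, s)) \<bullet> ?N s)
        + lam * (Fst (0, s) \<bullet> ?T s))) (at 0)"
      using der by simp
  qed
qed

text \<open>The support of a variation may reach the end points of the interval of integration.
  There the field and its derivative vanish as limits from outside, which removes the boundary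
  terms.\<close>

lemma vanishing_on_closure:
  fixes f :: "real \<Rightarrow> 'a::real_normed_vector"
  assumes "open S" "closure S \<subseteq> U" and f: "\<And>s. s \<in> U \<Longrightarrow> (f has_vector_derivative f1 s) (at s)"
    and f1: "continuous_on U f1" and 0: "\<And>s. s \<in> S \<Longrightarrow> f s = 0" and x: "x \<in> closure S"
  shows "f x = 0 \<and> f1 x = 0"
proof
  have "continuous_on U f"
    using f by (auto intro!: continuous_at_imp_continuous_on has_vector_derivative_continuous)
  then show "f x = 0"
    using continuous_constant_on_closure[of S f 0 x] continuous_on_subset[OF _ assms(2)] 0 x by blast
  have "f1 s = 0" if "s \<in> S" for s
  proof -
    have "(f has_vector_derivative 0) (at s)"
      by (rule has_vector_derivative_transform_within_open[OF has_vector_derivative_const[of 0] assms(1) that])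
        (simp add: 0)
    moreover have "s \<in> U" using that assms(2) closure_subset by auto
    ultimately show ?thesis using f vector_derivative_unique_at by blast
  qed
  then show "f1 x = 0"
    using continuous_constant_on_closure[of S f1 0 x] continuous_on_subset[OF f1 assms(2)] x by blast
qed

text \<open>Integration by parts in the form \<open>W' = f - g\<close>, with \<open>f\<close> the
  integrand of the first variation and \<open>g\<close> the Euler-Lagrange integrand. Only the
  normal component of the variation field survives. The set \<open>S\<close> allows \<open>y\<close>
  to be known on part of the curve only.\<close>

lemma first_variation_by_parts:
  fixes lam \<sigma> :: real and y y1 y2 :: "real \<Rightarrow> real"
  assumes \<gamma>: "arclength_curve I \<gamma>" and var: "variation e I \<gamma> \<Gamma>" and "a \<le> b"
    and supp: "variation_support e I \<gamma> \<Gamma> \<subseteq> {a..b}"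
    and S: "{a..b} \<subseteq> S" "S \<subseteq> I" and \<sigma>: "\<sigma> = 1 \<or> \<sigma> = -1"
    and y: "\<And>s. s \<in> S \<Longrightarrow> 0 < y s" "\<And>s. s \<in> S \<Longrightarrow> geodesic_curvature \<gamma> s = \<sigma> / (y s)\<^sup>2"
    and y1: "\<And>s. s \<in> S \<Longrightarrow> (y has_real_derivative y1 s) (at s)"
    and y2: "\<And>s. s \<in> S \<Longrightarrow> (y1 has_real_derivative y2 s) (at s)"
  defines "V \<equiv> \<lambda>s. vector_derivative (\<lambda>t. \<Gamma> t s) (at 0)"
  shows "((\<lambda>t. B_functional lam (\<Gamma> t) {a..b}) has_real_derivative
      integral {a..b} (\<lambda>s. \<sigma> / 2 * (y2 s + y s - 1 / y s ^ 3 - 2 * lam / (y s)\<^sup>2) * (V s \<bullet> unit_normal \<gamma> s))) (at 0)"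
proof -
  let ?T = "unit_tangent \<gamma>" and ?N = "unit_normal \<gamma>" and ?\<kappa> = "geodesic_curvature \<gamma>"
  have I: "open I" using \<gamma> by (simp add: arclength_curve_def)
  have ab: "{a..b} \<subseteq> I" using S by auto
  note fr = arclength_frenet[OF \<gamma>]
  have \<sigma>\<sigma>: "\<sigma> * \<sigma> = 1" using \<sigma> by auto
  have pos: "0 < \<sigma> * ?\<kappa> s" if "s \<in> {a..b}" for s
    using that S y[of s] \<sigma>\<sigma> by auto
  have V_eq: "vector_derivative (\<lambda>t. \<Gamma> t s) (at 0) = V s" for s
    by (simp add: V_def)
  obtain V1 V2 where V1: "\<And>s. s \<in> I \<Longrightarrow> (V has_vector_derivative V1 s) (at s)"
    and V2: "\<And>s. s \<in> I \<Longrightarrow> (V1 has_vector_derivative V2 s) (at s)"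
    and cV2: "continuous_on I V2" and V\<gamma>: "\<And>s. s \<in> I \<Longrightarrow> V s \<bullet> \<gamma> s = 0"
    and der: "((\<lambda>t. B_functional lam (\<Gamma> t) {a..b}) has_real_derivative
      integral {a..b} (\<lambda>s. \<sigma> / (2 * sqrt (\<sigma> * ?\<kappa> s)) * ((V s + V2 s) \<bullet> ?N s)
        + lam * (V1 s \<bullet> ?T s))) (at 0)"
  proof (rule first_variation[OF \<gamma> var \<open>a \<le> b\<close> ab \<sigma>, where lam = lam, unfolded V_eq])
    show "0 < \<sigma> * ?\<kappa> s" if "s \<in> {a..b}" for s by (rule pos[OF that])
  qed blast
  define f where "f s = \<sigma> / (2 * sqrt (\<sigma> * ?\<kappa> s)) * ((V s + V2 s) \<bullet> ?N s) + lam * (V1 s \<bullet> ?T s)" for s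
  define g where "g s = \<sigma> / 2 * (y2 s + y s - 1 / y s ^ 3 - 2 * lam / (y s)\<^sup>2) * (V s \<bullet> ?N s)" for s
  \<comment> \<open>The terms with \<open>y\<close> and \<open>y1\<close> transfer two derivatives
    from the field to \<open>y\<close>. Since \<open>N\<close> has derivative
    \<open>- \<kappa> T\<close>, this leaves a multiple of \<open>V1 \<bullet> T\<close>; together
    with the length term its coefficient is \<open>(1 / y + 2 * lam) / 2\<close>, which the first
    term of \<open>W\<close> absorbs.\<close>
  define W where "W s = \<sigma> / 2 * (\<sigma> * (1 / y s + 2 * lam) * (V s \<bullet> ?T s) + y s * (V1 s \<bullet> ?N s) - y1 s * (V s \<bullet> ?N s))" for s
  have cont: "continuous_on I V" "continuous_on I V1" "continuous_on I ?N" "continuous_on I ?T"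
    using V1 V2 fr(5,6) by (auto intro!: continuous_at_imp_continuous_on has_vector_derivative_continuous)
  have V0: "V s = 0" if "s \<in> I" "s \<notin> {a..b}" for s
  proof -
    have "s \<notin> closure {s \<in> I. \<exists>t\<in>{-e<..<e}. \<Gamma> t s \<noteq> \<gamma> s}"
      using supp that(2) by (auto simp: variation_support_def)
    then have "s \<notin> {s \<in> I. \<exists>t\<in>{-e<..<e}. \<Gamma> t s \<noteq> \<gamma> s}"
      by (metis (no_types, lifting) closure_subset subsetD)
    then have "\<gamma> s = \<Gamma> t s" if "t \<in> {-e<..<e}" for t
      using \<open>s \<in> I\<close> that by simp
    then have "((\<lambda>t. \<Gamma> t s) has_vector_derivative 0) (at 0)"
      using var
      by (intro has_vector_derivative_transform_within_open[OF has_vector_derivative_const[of "\<gamma> s"], of "{-e<..<e}"])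
        (auto simp: variation_def)
    then show ?thesis by (simp add: V_def vector_derivative_at)
  qed
  \<comment> \<open>\<open>I\<close> is open, so it contains a small interval beyond each end point,
    on which the field is zero by the support condition.\<close>
  have ends: "V a = 0 \<and> V1 a = 0" "V b = 0 \<and> V1 b = 0"
  proof -
    obtain r where r: "r > 0" "cball a r \<subseteq> I"
      using I ab \<open>a \<le> b\<close> by (metis atLeastAtMost_iff open_contains_cball order_refl subsetD)
    have "closure {a-r<..<a} = {a-r..a}" using r by simp
    then show "V a = 0 \<and> V1 a = 0"
      using r by (intro vanishing_on_closure[of "{a-r<..<a}" I V V1 a] V1 V0 cont) (auto simp: dist_real_def)
    obtain r where r: "r > 0" "cball b r \<subseteq> I"
      using I ab \<open>a \<le> b\<close> by (metis atLeastAtMost_iff open_contains_cball order_refl subsetD)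
    have "closure {b<..<b+r} = {b..b+r}" using r by simp
    then show "V b = 0 \<and> V1 b = 0"
      using r by (intro vanishing_on_closure[of "{b<..<b+r}" I V V1 b] V1 V0 cont) (auto simp: dist_real_def)
  qed
  have W': "(W has_vector_derivative f s - g s) (at s within {a..b})" if "s \<in> {a..b}" for s
  proof -
    have sI: "s \<in> I" and sS: "s \<in> S" using that S by auto
    have rs: "sqrt (\<sigma> * ?\<kappa> s) = 1 / y s"
      using y[OF sS] \<sigma>\<sigma> by (simp add: real_sqrt_divide)
    have dT: "((\<lambda>s. V s \<bullet> ?T s) has_real_derivative V s \<bullet> (?\<kappa> s *\<^sub>R ?N s - \<gamma> s) + V1 s \<bullet> ?T s) (at s)"
      and dN: "((\<lambda>s. V s \<bullet> ?N s) has_real_derivative V s \<bullet> (- ?\<kappa> s *\<^sub>R ?T s) + V1 s \<bullet> ?N s) (at s)"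
      and dN1: "((\<lambda>s. V1 s \<bullet> ?N s) has_real_derivative V1 s \<bullet> (- ?\<kappa> s *\<^sub>R ?T s) + V2 s \<bullet> ?N s) (at s)"
      using has_vector_derivative_inner[OF V1[OF sI] fr(5)[OF sI]]
        has_vector_derivative_inner[OF V1[OF sI] fr(6)[OF sI]]
        has_vector_derivative_inner[OF V2[OF sI] fr(6)[OF sI]]
      by (simp_all add: has_real_derivative_iff_has_vector_derivative)
    have yn: "y s \<noteq> 0" using y(1)[OF sS] by simp
    have d\<mu>: "((\<lambda>s. \<sigma> * (1 / y s + 2 * lam)) has_real_derivative - \<sigma> * y1 s / (y s)\<^sup>2) (at s)"
      using DERIV_cmult[OF DERIV_add[OF DERIV_divide[OF DERIV_const[of 1] y1[OF sS] yn] DERIV_const[of "2 * lam"]], of \<sigma>]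
      by (simp add: power2_eq_square)
    have "(W has_real_derivative \<sigma> / 2 * (
        - \<sigma> * y1 s / (y s)\<^sup>2 * (V s \<bullet> ?T s) + (V s \<bullet> (?\<kappa> s *\<^sub>R ?N s - \<gamma> s) + V1 s \<bullet> ?T s) * (\<sigma> * (1 / y s + 2 * lam))
        + (y1 s * (V1 s \<bullet> ?N s) + (V1 s \<bullet> (- ?\<kappa> s *\<^sub>R ?T s) + V2 s \<bullet> ?N s) * y s)
        - (y2 s * (V s \<bullet> ?N s) + (V s \<bullet> (- ?\<kappa> s *\<^sub>R ?T s) + V1 s \<bullet> ?N s) * y1 s))) (at s)"
      unfolding W_def[abs_def]
      by (intro DERIV_cmult DERIV_diff DERIV_add DERIV_mult d\<mu> dT dN dN1 y1[OF sS] y2[OF sS])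
    moreover have "\<sigma> / 2 * (
        - \<sigma> * y1 s / (y s)\<^sup>2 * (V s \<bullet> ?T s) + (V s \<bullet> (?\<kappa> s *\<^sub>R ?N s - \<gamma> s) + V1 s \<bullet> ?T s) * (\<sigma> * (1 / y s + 2 * lam))
        + (y1 s * (V1 s \<bullet> ?N s) + (V1 s \<bullet> (- ?\<kappa> s *\<^sub>R ?T s) + V2 s \<bullet> ?N s) * y s)
        - (y2 s * (V s \<bullet> ?N s) + (V s \<bullet> (- ?\<kappa> s *\<^sub>R ?T s) + V1 s \<bullet> ?N s) * y1 s)) = f s - g s"
    proof -
      have *: "\<sigma> / 2 * (- \<sigma> * y1 s / (y s)\<^sup>2 * p + (\<sigma> / (y s)\<^sup>2 * n + p1) * (\<sigma> * (1 / y s + 2 * lam))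
          + (y1 s * n1 + (n2 - \<sigma> / (y s)\<^sup>2 * p1) * y s) - (y2 s * n + (n1 - \<sigma> / (y s)\<^sup>2 * p) * y1 s))
        = \<sigma> * y s / 2 * (n + n2) + lam * p1
          - \<sigma> / 2 * (y2 s + y s - 1 / y s ^ 3 - 2 * lam / (y s)\<^sup>2) * n" for p n p1 n1 n2
        using \<sigma> yn by (elim disjE; simp add: power2_eq_square power3_eq_cube field_simps)
      have fs: "f s = \<sigma> * y s / 2 * ((V s + V2 s) \<bullet> ?N s) + lam * (V1 s \<bullet> ?T s)"
        unfolding f_def rs by simp
      show ?thesis
        using *[of "V s \<bullet> ?T s" "V s \<bullet> ?N s" "V1 s \<bullet> ?T s" "V1 s \<bullet> ?N s" "V2 s \<bullet> ?N s"]
        by (simp add: fs g_def y(2)[OF sS] inner_diff_right inner_add_left V\<gamma>[OF sI])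
    qed
    ultimately have "(W has_real_derivative f s - g s) (at s)" by (rule DERIV_cong)
    then show ?thesis
      by (simp add: has_real_derivative_iff_has_vector_derivative has_vector_derivative_at_within)
  qed
  have "((\<lambda>s. f s - g s) has_integral W b - W a) {a..b}"
    using fundamental_theorem_of_calculus[OF \<open>a \<le> b\<close> W'] .
  then have i1: "((\<lambda>s. f s - g s) has_integral 0) {a..b}"
    using ends by (simp add: W_def)
  have cy: "continuous_on {a..b} ?\<kappa>" 
    using C_k_on_continuous_on[OF fr(8)] ab continuous_on_subset by blast
  have nz: "2 * sqrt (\<sigma> * ?\<kappa> s) \<noteq> 0" if "s \<in> {a..b}" for s
    using pos[OF that] by auto
  have "continuous_on {a..b} f"
    unfolding f_def[abs_def]
    by (intro ballI nz cy continuous_intros continuous_on_subset[OF cont(1) ab] continuous_on_subset[OF cont(2) ab]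
        continuous_on_subset[OF cont(3) ab] continuous_on_subset[OF cont(4) ab] continuous_on_subset[OF cV2 ab])
  then have "(f has_integral integral {a..b} f) {a..b}"
    by (intro integrable_integral integrable_continuous_real)
  from has_integral_diff[OF this i1] have "(g has_integral integral {a..b} f) {a..b}"
    by simp
  then have "integral {a..b} g = integral {a..b} f" by (rule integral_unique)
  then show ?thesis
    using der by (simp add: f_def[abs_def] g_def[abs_def])
qed

section \<open>Equivalence of criticality and the Euler-Lagrange equation\<close>

text \<open>The vector is Rodrigues' formula for \<open>p\<close> rotated about the axis
  \<open>w\<close> by the angle \<open>x\<close>; the lemma keeps the test variations on the
  sphere.\<close>

lemma norm_axis_rotation:
  fixes w p :: "real^3"
  assumes "norm w = 1"
  shows "norm (cos x *\<^sub>R p + sin x *\<^sub>R cross3 w p + ((1 - cos x) * (w \<bullet> p)) *\<^sub>R w) = norm p"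
proof -
  have ww: "w \<bullet> w = 1" using assms by (simp add: norm_eq_1)
  have "(norm (cross3 w p))\<^sup>2 = p \<bullet> p - (w \<bullet> p)\<^sup>2"
    using norm_cross_dot[of w p] assms by (simp add: power2_norm_eq_inner)
  then have cc: "cross3 w p \<bullet> cross3 w p = p \<bullet> p - (w \<bullet> p)\<^sup>2"
    by (simp add: power2_norm_eq_inner)
  have "(norm (cos x *\<^sub>R p + sin x *\<^sub>R cross3 w p + ((1 - cos x) * (w \<bullet> p)) *\<^sub>R w))\<^sup>2
     = (cos x)\<^sup>2 * (p \<bullet> p) + (sin x)\<^sup>2 * (p \<bullet> p - (w \<bullet> p)\<^sup>2) + (1 - cos x)\<^sup>2 * (w \<bullet> p)\<^sup>2
       + 2 * cos x * (1 - cos x) * (w \<bullet> p)\<^sup>2"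
    unfolding power2_norm_eq_inner
    by (simp add: inner_add_left inner_add_right cc ww dot_cross_self inner_commute[of p w]
         power2_eq_square algebra_simps)
  also have "\<dots> = p \<bullet> p"
    by (simp only: sin_squared_eq) (simp add: algebra_simps power2_eq_square)
  finally show ?thesis
    by (simp add: power2_norm_eq_inner[symmetric])
qed

lemma nonneg_continuous_integral_zero:
  fixes f :: "real \<Rightarrow> real"
  assumes "continuous_on {a..b} f" "\<And>x. x \<in> {a..b} \<Longrightarrow> 0 \<le> f x" "integral {a..b} f = 0" "x \<in> {a..b}" "a < b"
  shows "f x = 0"
proof -
  have "(f has_integral 0) (cbox a b)"
    using integrable_integral[OF integrable_continuous_real[OF assms(1)]] assms(3) by simp
  then show ?thesis
    using has_integral_0_cbox_imp_0[of a b f x] assms by auto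
qed

text \<open>
  Testing with the rotations of \<open>\<gamma>\<close> about a fixed axis by an angle \<open>t \<phi>(s)\<close>, rather than with
  normal variations \<open>\<gamma> + t \<phi> N\<close>, avoids the loss of one derivative in \<open>N\<close>.
\<close>

lemma critical_imp_euler_lagrange:
  fixes lam \<sigma> :: real and y y1 y2 :: "real \<Rightarrow> real"
  assumes crit: "critical_curve lam I \<gamma>" and S: "open S" "S \<subseteq> I" and \<sigma>: "\<sigma> = 1 \<or> \<sigma> = -1"
    and y: "\<And>s. s \<in> S \<Longrightarrow> 0 < y s" "\<And>s. s \<in> S \<Longrightarrow> geodesic_curvature \<gamma> s = \<sigma> / (y s)\<^sup>2"
    and y1: "\<And>s. s \<in> S \<Longrightarrow> (y has_real_derivative y1 s) (at s)"
    and y2: "\<And>s. s \<in> S \<Longrightarrow> (y1 has_real_derivative y2 s) (at s)"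
    and cy2: "continuous_on S y2" and "s0 \<in> S"
  shows "y2 s0 + y s0 - 1 / y s0 ^ 3 - 2 * lam / (y s0)\<^sup>2 = 0"
proof (rule ccontr)
  define E where "E s = y2 s + y s - 1 / y s ^ 3 - 2 * lam / (y s)\<^sup>2" for s
  assume "y2 s0 + y s0 - 1 / y s0 ^ 3 - 2 * lam / (y s0)\<^sup>2 \<noteq> 0"
  then have E0: "E s0 \<noteq> 0" by (simp add: E_def)
  let ?T = "unit_tangent \<gamma>" and ?N = "unit_normal \<gamma>" and ?\<kappa> = "geodesic_curvature \<gamma>"
  have \<gamma>: "arclength_curve I \<gamma>" using crit by (simp add: critical_curve_def)
  have I: "open I" and C4: "C_k_on 4 \<gamma> I" using \<gamma> by (auto simp: arclength_curve_def)
  note fr = arclength_frenet[OF \<gamma>]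
  \<comment> \<open>Rotation about the tangent at \<open>s0\<close> moves \<open>\<gamma> s0\<close>
    in the direction \<open>cross3 w (\<gamma> s0)\<close>, which is minus the normal. The normal
    component therefore does not vanish near \<open>s0\<close>.\<close>
  define w where "w = ?T s0"
  have nw: "norm w = 1" using fr(2) \<open>s0 \<in> S\<close> S by (auto simp: w_def)
  define g where "g s = E s * (w \<bullet> ?T s)" for s
  have "continuous_on S y"
    using y1 DERIV_continuous_on has_field_derivative_at_within by metis
  then have cE: "continuous_on S E"
    unfolding E_def[abs_def] using cy2 by (intro continuous_intros) (auto dest: y(1))
  have cg: "continuous_on S g"
    unfolding g_def[abs_def]
    using cE S C_k_on_continuous_on[OF fr(7)] by (intro continuous_intros) (auto intro: continuous_on_subset)
  have g0: "g s0 = E s0" using nw by (simp add: g_def w_def norm_eq_1)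
  \<comment> \<open>The neighbourhood of \<open>s0\<close> on which
    \<open>E s * (w \<bullet> T s)\<close> keeps the sign of \<open>E s0\<close>.\<close>
  define X where "X = S \<inter> (\<lambda>s. E s0 * g s) -` {0<..}"
  have "open X"
    unfolding X_def by (intro continuous_open_preimage continuous_intros cg S open_greaterThan)
  moreover have "s0 \<in> X"
    using \<open>s0 \<in> S\<close> E0 by (simp add: X_def g0 zero_less_mult_iff linorder_neq_iff) linarith
  ultimately obtain r where r: "r > 0" "cball s0 r \<subseteq> X" using open_contains_cball by blast
  define a where "a = s0 - r"
  define b where "b = s0 + r"
  have abX: "{a..b} \<subseteq> X" and ab: "a < b" using r by (auto simp: a_def b_def cball_eq_atLeastAtMost)
  have abS: "{a..b} \<subseteq> S" using abX by (auto simp: X_def)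
  \<comment> \<open>A cut-off, positive exactly for \<open>\<bar>s - s0\<bar> < r\<close>; the fifth
    power makes it \<open>C^4\<close>, as a variation requires.\<close>
  define \<phi> where "\<phi> s = max 0 (r\<^sup>2 - (s - s0)\<^sup>2) ^ Suc 4" for s
  have C\<phi>: "C_k_on 4 \<phi> UNIV"
  proof -
    have "C_k_on 4 (\<lambda>s::real. s) UNIV" by (rule C_k_on_bounded_linear[OF bounded_linear_ident open_UNIV])
    then have "C_k_on 4 (\<lambda>s. r\<^sup>2 - (s - s0)\<^sup>2) UNIV"
      by (intro C_k_on_diff C_k_on_power C_k_on_const open_UNIV)
    then show ?thesis
      unfolding \<phi>_def by (rule C_k_on_compose_real[OF open_UNIV open_UNIV subset_UNIV C_k_on_pos_part_power])
  qed
  have \<phi>_out: "\<phi> s = 0" if "s \<notin> {a..b}" for s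
  proof -
    have "r < \<bar>s - s0\<bar>" using that by (auto simp: a_def b_def)
    then have "r\<^sup>2 \<le> (s - s0)\<^sup>2" using r by (metis abs_le_square_iff abs_of_pos less_imp_le)
    then show ?thesis by (simp add: \<phi>_def)
  qed
  have \<phi>0: "\<phi> s0 > 0" using r by (simp add: \<phi>_def)
  have \<phi>_ge: "\<phi> s \<ge> 0" for s by (simp add: \<phi>_def)
  define \<Gamma> where "\<Gamma> t s = cos (t * \<phi> s) *\<^sub>R \<gamma> s + sin (t * \<phi> s) *\<^sub>R cross3 w (\<gamma> s)
      + ((1 - cos (t * \<phi> s)) * (w \<bullet> \<gamma> s)) *\<^sub>R w" for t s
  have var: "variation 1 I \<gamma> \<Gamma>"
    unfolding variation_def
  proof (intro conjI ballI image_subsetI)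
    have o: "open ({-1<..<1::real} \<times> I)" using I by (intro open_Times) auto
    have c1: "C_k_on 4 (\<lambda>x. fst x * \<phi> (snd x)) ({-1<..<1} \<times> I)"
      by (intro C_k_on_mult o C_k_on_bounded_linear bounded_linear_fst
          C_k_on_compose_real[OF o _ _ C\<phi>] bounded_linear_snd) auto
    have c2: "C_k_on 4 (\<lambda>x. \<gamma> (snd x)) ({-1<..<1::real} \<times> I)"
      by (rule C_k_on_compose_real[OF o I _ C4 C_k_on_bounded_linear[OF bounded_linear_snd o]]) auto
    have c3: "C_k_on 4 (\<lambda>x. cos (fst x * \<phi> (snd x))) ({-1<..<1} \<times> I)"
       "C_k_on 4 (\<lambda>x. sin (fst x * \<phi> (snd x))) ({-1<..<1} \<times> I)"
      using C_k_on_sin_cos[of UNIV 4] by (auto intro: C_k_on_compose_real[OF o open_UNIV _ _ c1] simp del: C_k_on.simps)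
    show "C_k_on 4 (\<lambda>(t, s). \<Gamma> t s) ({- 1<..<1} \<times> I)"
      unfolding \<Gamma>_def split_beta
      by (intro C_k_on_add C_k_on_scaleR C_k_on_diff C_k_on_mult C_k_on_inner C_k_on_cross C_k_on_const c2 c3 o)
    show "\<Gamma> t s \<in> sphere 0 1" if "s \<in> I" for t s
      using norm_axis_rotation[OF nw] fr(1)[OF that] by (simp add: \<Gamma>_def)
    show "\<Gamma> 0 s = \<gamma> s" for s by (simp add: \<Gamma>_def)
  qed simp
  have supp: "variation_support 1 I \<gamma> \<Gamma> \<subseteq> {a..b}"
    unfolding variation_support_def
  proof (rule closure_minimal)
    show "{s \<in> I. \<exists>t\<in>{-1<..<1}. \<Gamma> t s \<noteq> \<gamma> s} \<subseteq> {a..b}"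
    proof (rule subsetI, rule ccontr)
      fix s assume "s \<in> {s \<in> I. \<exists>t\<in>{-1<..<1}. \<Gamma> t s \<noteq> \<gamma> s}" "s \<notin> {a..b}"
      then show False using \<phi>_out[of s] by (auto simp: \<Gamma>_def)
    qed
  qed simp
  have \<kappa>0: "?\<kappa> s \<noteq> 0" if "s \<in> S" for s
    using y[OF that] \<sigma> by auto
  define V where "V s = vector_derivative (\<lambda>t. \<Gamma> t s) (at 0)" for s
  have V: "V s = \<phi> s *\<^sub>R cross3 w (\<gamma> s)" for s
  proof -
    have "((\<lambda>t. \<Gamma> t s) has_vector_derivative \<phi> s *\<^sub>R cross3 w (\<gamma> s)) (at 0)"
      unfolding \<Gamma>_def by (auto intro!: derivative_eq_intros)
    then show ?thesis by (simp add: V_def vector_derivative_at)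
  qed
  have VN: "V s \<bullet> ?N s = - \<phi> s * (w \<bullet> ?T s)" if "s \<in> I" for s
  proof -
    have "cross3 w (\<gamma> s) \<bullet> ?N s = w \<bullet> cross3 (\<gamma> s) (?N s)" by (rule cross_inner_assoc)
    also have "cross3 (\<gamma> s) (?N s) = - ?T s"
      using orthonormal_cross(2)[OF fr(1)[OF that] fr(2)[OF that] fr(3)[OF that]] cross_skew[of "\<gamma> s" "?N s"]
      by (simp add: unit_normal_def)
    finally show ?thesis by (simp add: V)
  qed
  have "((\<lambda>t. B_functional lam (\<Gamma> t) {a..b}) has_real_derivative 0) (at 0)"
    using crit var supp abS S \<kappa>0 unfolding critical_curve_def by blast
  moreover have "((\<lambda>t. B_functional lam (\<Gamma> t) {a..b}) has_real_derivative
      integral {a..b} (\<lambda>s. \<sigma> / 2 * E s * (V s \<bullet> ?N s))) (at 0)"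
    unfolding E_def V_def
    using first_variation_by_parts[OF \<gamma> var less_imp_le[OF ab] supp abS S(2) \<sigma> y y1 y2] .
  ultimately have "integral {a..b} (\<lambda>s. \<sigma> / 2 * E s * (V s \<bullet> ?N s)) = 0"
    using DERIV_unique by blast
  \<comment> \<open>A nonzero constant is split off, so that the remaining integrand is nonnegative
    on \<open>{a..b}\<close> and positive at \<open>s0\<close>.\<close>
  moreover have "integral {a..b} (\<lambda>s. \<sigma> / 2 * E s * (V s \<bullet> ?N s)) = integral {a..b} (\<lambda>s. (- \<sigma> / 2 / E s0) * (\<phi> s * (E s0 * g s)))"
    using abS S E0 by (intro integral_cong) (auto simp: VN g_def subset_iff)
  ultimately have "(- \<sigma> / 2 / E s0) * integral {a..b} (\<lambda>s. \<phi> s * (E s0 * g s)) = 0"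
    by (simp only: integral_mult_right)
  moreover have "- \<sigma> / 2 / E s0 \<noteq> 0" using E0 \<sigma> by auto
  ultimately have "integral {a..b} (\<lambda>s. \<phi> s * (E s0 * g s)) = 0"
    by (simp only: mult_eq_0_iff simp_thms)
  moreover have "continuous_on {a..b} (\<lambda>s. \<phi> s * (E s0 * g s))"
    using continuous_on_subset[OF cg abS] continuous_on_subset[OF C_k_on_continuous_on[OF C\<phi>] subset_UNIV]
    by (intro continuous_intros)
  moreover have "0 \<le> \<phi> s * (E s0 * g s)" if "s \<in> {a..b}" for s
  proof -
    have "s \<in> X" using that abX by blast
    then have "0 < E s0 * g s" by (simp add: X_def)
    then show ?thesis using \<phi>_ge[of s] by simp
  qed
  moreover have "s0 \<in> {a..b}" using r by (auto simp: a_def b_def)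
  ultimately have "\<phi> s0 * (E s0 * g s0) = 0"
    using nonneg_continuous_integral_zero ab by blast
  then show False using \<phi>0 E0 g0 by simp
qed

text \<open>The integrand after integration by parts vanishes identically. This is what certifies
  curves constructed from differential equations as critical.\<close>

lemma euler_lagrange_imp_critical:
  fixes lam \<sigma> :: real and y y1 y2 :: "real \<Rightarrow> real"
  assumes \<gamma>: "arclength_curve I \<gamma>" and \<sigma>: "\<sigma> = 1 \<or> \<sigma> = -1"
    and y: "\<And>s. s \<in> I \<Longrightarrow> 0 < y s" "\<And>s. s \<in> I \<Longrightarrow> geodesic_curvature \<gamma> s = \<sigma> / (y s)\<^sup>2"
    and y1: "\<And>s. s \<in> I \<Longrightarrow> (y has_real_derivative y1 s) (at s)"
    and y2: "\<And>s. s \<in> I \<Longrightarrow> (y1 has_real_derivative y2 s) (at s)"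
    and EL: "\<And>s. s \<in> I \<Longrightarrow> y2 s + y s - 1 / y s ^ 3 - 2 * lam / (y s)\<^sup>2 = 0"
  shows "critical_curve lam I \<gamma>"
  unfolding critical_curve_def
proof (intro conjI allI impI \<gamma>, elim conjE)
  fix e \<Gamma> a b
  assume var: "variation e I \<gamma> \<Gamma>" and supp: "variation_support e I \<gamma> \<Gamma> \<subseteq> {a..b}" and ab: "{a..b} \<subseteq> I"
  show "((\<lambda>t. B_functional lam (\<Gamma> t) {a..b}) has_real_derivative 0) (at 0)"
  proof (cases "a \<le> b")
    case True
    have "integral {a..b} (\<lambda>s. \<sigma> / 2 * (y2 s + y s - 1 / y s ^ 3 - 2 * lam / (y s)\<^sup>2) *
        (vector_derivative (\<lambda>t. \<Gamma> t s) (at 0) \<bullet> unit_normal \<gamma> s)) = integral {a..b} (\<lambda>s. 0)"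
      using ab EL by (intro integral_cong) auto
    then show ?thesis
      using first_variation_by_parts[OF \<gamma> var True supp ab subset_refl \<sigma> y y1 y2, of lam] by simp
  next
    \<comment> \<open>For \<open>b < a\<close> the interval is empty and the functional is
      constantly 0.\<close>
    case False
    then show ?thesis by (simp add: B_functional_def)
  qed
qed

subsection \<open>Ordinary differential equations\<close>

text \<open>\<open>exp (- 2 * L * t)\<close> times the squared norm of \<open>d\<close> is
  nonincreasing after \<open>t0\<close>, and \<open>exp (2 * L * t)\<close> times it is
  nondecreasing before \<open>t0\<close>. Either product is 0 at \<open>t0\<close>, so it is at most
  0 on its side.\<close>

lemma gronwall_zero:
  fixes d :: "real \<Rightarrow> 'a::real_inner"
  assumes "is_interval I" "t0 \<in> I" "d t0 = 0"
    and d: "\<And>t. t \<in> I \<Longrightarrow> (d has_vector_derivative d' t) (at t)"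
    and L: "\<And>t. t \<in> I \<Longrightarrow> norm (d' t) \<le> L * norm (d t)" and "t \<in> I"
  shows "d t = 0"
proof -
  have u: "((\<lambda>t. d t \<bullet> d t) has_real_derivative 2 * (d t \<bullet> d' t)) (at t)" if "t \<in> I" for t
    using has_vector_derivative_inner[OF d[OF that] d[OF that]]
    by (simp add: has_real_derivative_iff_has_vector_derivative inner_commute)
  have u': "\<bar>2 * (d t \<bullet> d' t)\<bar> \<le> 2 * L * (d t \<bullet> d t)" if "t \<in> I" for t
  proof -
    have "\<bar>d t \<bullet> d' t\<bar> \<le> norm (d t) * norm (d' t)" by (rule Cauchy_Schwarz_ineq2)
    also have "\<dots> \<le> norm (d t) * (L * norm (d t))"
      by (intro mult_left_mono L that) simp
    also have "\<dots> = L * (d t \<bullet> d t)" by (simp add: dot_square_norm power2_eq_square)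
    finally show ?thesis by simp
  qed
  have sub: "x \<in> I" if "a \<in> I" "b \<in> I" "a \<le> x" "x \<le> b" for a b x
    using assms(1) that by (meson mem_is_interval_1_I)
  have "d t \<bullet> d t \<le> 0"
  proof (cases "t0 \<le> t")
    case True
    have "exp (- 2 * L * t) * (d t \<bullet> d t) \<le> exp (- 2 * L * t0) * (d t0 \<bullet> d t0)"
    proof (rule DERIV_nonpos_imp_nonincreasing[OF True, where f = "\<lambda>t. exp (- 2 * L * t) * (d t \<bullet> d t)"])
      fix x assume x: "t0 \<le> x" "x \<le> t"
      have xI: "x \<in> I" using sub[OF assms(2) \<open>t \<in> I\<close>] x by blast
      have "((\<lambda>x. exp (- 2 * L * x) * (d x \<bullet> d x)) has_real_derivative
          exp (- 2 * L * x) * (2 * (d x \<bullet> d' x) - 2 * L * (d x \<bullet> d x))) (at x)"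
        by (auto intro!: derivative_eq_intros u[OF xI] simp: algebra_simps)
      moreover have "exp (- 2 * L * x) * (2 * (d x \<bullet> d' x) - 2 * L * (d x \<bullet> d x)) \<le> 0"
        using u'[OF xI] by (intro mult_nonneg_nonpos) auto
      ultimately show "\<exists>y. ((\<lambda>x. exp (- 2 * L * x) * (d x \<bullet> d x)) has_real_derivative y) (at x) \<and> y \<le> 0"
        by blast
    qed
    then show ?thesis using assms(3) by (simp add: mult_le_0_iff)
  next
    case False
    have "exp (2 * L * t) * (d t \<bullet> d t) \<le> exp (2 * L * t0) * (d t0 \<bullet> d t0)"
    proof (rule DERIV_nonneg_imp_nondecreasing[where f = "\<lambda>t. exp (2 * L * t) * (d t \<bullet> d t)"])
      fix x assume x: "t \<le> x" "x \<le> t0"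
      have xI: "x \<in> I" using sub[OF \<open>t \<in> I\<close> assms(2)] x by blast
      have "((\<lambda>x. exp (2 * L * x) * (d x \<bullet> d x)) has_real_derivative
          exp (2 * L * x) * (2 * (d x \<bullet> d' x) + 2 * L * (d x \<bullet> d x))) (at x)"
        by (auto intro!: derivative_eq_intros u[OF xI] simp: algebra_simps)
      moreover have "exp (2 * L * x) * (2 * (d x \<bullet> d' x) + 2 * L * (d x \<bullet> d x)) \<ge> 0"
        using u'[OF xI] by (intro mult_nonneg_nonneg) auto
      ultimately show "\<exists>y. ((\<lambda>x. exp (2 * L * x) * (d x \<bullet> d x)) has_real_derivative y) (at x) \<and> 0 \<le> y"
        by blast
    qed (use False in simp)
    then show ?thesis using assms(3) by (simp add: mult_le_0_iff)
  qed
  then show ?thesis by (metis inner_gt_zero_iff not_le)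
qed

text \<open>The Lipschitz bound is required only along the two solutions. This matters for the
  oscillator, whose force is not Lipschitz near \<open>y = 0\<close>.\<close>

lemma ode_unique:
  fixes x z :: "real \<Rightarrow> 'a::real_inner"
  assumes "is_interval I" "t0 \<in> I" "x t0 = z t0"
    and "\<And>t. t \<in> I \<Longrightarrow> (x has_vector_derivative F t (x t)) (at t)"
    and "\<And>t. t \<in> I \<Longrightarrow> (z has_vector_derivative F t (z t)) (at t)"
    and "\<And>t. t \<in> I \<Longrightarrow> norm (F t (x t) - F t (z t)) \<le> L * norm (x t - z t)" and "t \<in> I"
  shows "x t = z t"
proof -
  have "x t - z t = 0"
    by (rule gronwall_zero[where d = "\<lambda>t. x t - z t" and I = I and ?t0.0 = t0 and L = L and
          d' = "\<lambda>t. F t (x t) - F t (z t)"])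
      (use assms in \<open>auto intro: has_vector_derivative_diff\<close>)
  then show ?thesis by simp
qed

lemma exists_antiderivative:
  fixes G :: "real \<Rightarrow> 'a::euclidean_space"
  assumes "continuous_on UNIV G"
  shows "\<exists>P. P 0 = 0 \<and> (\<forall>t. (P has_vector_derivative G t) (at t))"
proof -
  have "isCont G t" for t using assms by (simp add: continuous_on_eq_continuous_at)
  then obtain P where P: "\<And>t. (P has_vector_derivative G t) (at t)"
    using einterval_antiderivative[of "-\<infinity>" "\<infinity>" G] by auto
  have "((\<lambda>t. P t - P 0) has_vector_derivative G t) (at t)" for t
    using has_vector_derivative_diff[OF P has_vector_derivative_const[of "P 0"]] by simp
  then show ?thesis by (intro exI[of _ "\<lambda>t. P t - P 0"]) simp
qed

text \<open>Integrating \<open>exp (K * \<bar>t\<bar>)\<close> gains the factor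
  \<open>1 / K\<close>; this gain is what makes the Picard map below a contraction.\<close>

lemma antiderivative_exp_bound:
  fixes P :: "real \<Rightarrow> 'a::real_normed_vector"
  assumes P: "\<And>t. (P has_vector_derivative G t) (at t)" "P 0 = 0"
    and G: "\<And>t. norm (G t) \<le> A * K * exp (K * \<bar>t\<bar>)" and "0 \<le> A"
  shows "norm (P t) \<le> A * exp (K * \<bar>t\<bar>)"
proof -
  have cP: "continuous_on S P" for S
    using P(1) by (intro continuous_at_imp_continuous_on) (auto intro: has_vector_derivative_continuous)
  consider "t > 0" | "t < 0" | "t = 0" by linarith
  then show ?thesis
  proof cases
    case 1
    have "norm (P t - P 0) \<le> A * exp (K * t) - A * exp (K * 0)"
    proof (rule differentiable_bound_general[OF 1 cP _ P(1)])
      show "((\<lambda>s. A * exp (K * s)) has_vector_derivative A * K * exp (K * s)) (at s)" for s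
        unfolding has_real_derivative_iff_has_vector_derivative[symmetric]
        by (auto intro!: derivative_eq_intros)
      show "norm (G s) \<le> A * K * exp (K * s)" if "0 < s" for s
        using G[of s] that by simp
    qed (intro continuous_intros)
    then show ?thesis using 1 P(2) \<open>0 \<le> A\<close> by simp
  next
    case 2
    have "norm (P 0 - P t) \<le> - A * exp (- K * 0) - - A * exp (- K * t)"
    proof (rule differentiable_bound_general[OF 2 cP _ P(1)])
      show "((\<lambda>s. - A * exp (- K * s)) has_vector_derivative A * K * exp (- K * s)) (at s)" for s
        unfolding has_real_derivative_iff_has_vector_derivative[symmetric]
        by (auto intro!: derivative_eq_intros)
      show "norm (G s) \<le> A * K * exp (- K * s)" if "s < 0" for s
        using G[of s] that by simp
    qed (intro continuous_intros)
    then show ?thesis using 2 P(2) \<open>0 \<le> A\<close> by simp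
  next
    case 3
    then show ?thesis using P(2) \<open>0 \<le> A\<close> by simp
  qed
qed

text \<open>
  Picard iteration contracts globally for the norm weighted by \<open>exp (- 2 L \<bar>t\<bar>)\<close>.
\<close>

theorem global_ode_solution:
  fixes F :: "real \<Rightarrow> 'a::euclidean_space \<Rightarrow> 'a"
  assumes cont: "continuous_on UNIV (\<lambda>(t, x). F t x)"
    and lip: "\<And>t x z. norm (F t x - F t z) \<le> L * norm (x - z)"
    and M: "\<And>t. norm (F t 0) \<le> M" and "0 < L"
  shows "\<exists>x. x t0 = x0 \<and> (\<forall>t. (x has_vector_derivative F t (x t)) (at t))"
proof -
  \<comment> \<open>The Picard map then has contraction constant \<open>L / K = 1/2\<close>.\<close>
  define K where "K = 2 * L"
  have K: "K > 0" using \<open>0 < L\<close> by (simp add: K_def)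
  define w where "w t = exp (K * \<bar>t\<bar>)" for t :: real
  have w: "w t \<ge> 1" for t using K by (simp add: w_def)
  have cw: "continuous_on S w" for S
    unfolding w_def[abs_def] by (intro continuous_intros)
  have M0: "0 \<le> M" using M[of 0] norm_ge_zero order_trans by blast
  \<comment> \<open>The unknown is the bounded function \<open>z = x / w\<close>, with time shifted
    so that the initial time is 0; \<open>G z\<close> is the right-hand side along
    \<open>x = w z\<close>.\<close>
  define G where "G z s = F (s + t0) (w s *\<^sub>R apply_bcontfun z s)" for z :: "real \<Rightarrow>\<^sub>C 'a" and s
  have cG: "continuous_on UNIV (G z)" for z
    unfolding G_def[abs_def]
    by (rule continuous_on_compose2[OF cont, of _ "\<lambda>s. (s + t0, w s *\<^sub>R apply_bcontfun z s)", simplified])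
      (intro continuous_intros cw continuous_on_apply_bcontfun)
  obtain P where P: "\<And>z. P z 0 = 0" "\<And>z t. (P z has_vector_derivative G z t) (at t)"
    using exists_antiderivative[OF cG] by metis
  have cP: "continuous_on S (P z)" for S z
    using P(2) by (intro continuous_at_imp_continuous_on) (auto intro: has_vector_derivative_continuous)
  have Gb: "norm (G z s) \<le> (M + L * norm z) / K * K * exp (K * \<bar>s\<bar>)" for z s
  proof -
    have "norm (G z s) \<le> norm (F (s + t0) 0) + norm (G z s - F (s + t0) 0)"
      using norm_triangle_ineq[of "F (s + t0) 0" "G z s - F (s + t0) 0"] by simp
    also have "norm (G z s - F (s + t0) 0) \<le> L * norm (w s *\<^sub>R apply_bcontfun z s)"
      unfolding G_def using lip[of "s + t0" "w s *\<^sub>R apply_bcontfun z s" 0] by (simp del: norm_scaleR)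
    also have "norm (w s *\<^sub>R apply_bcontfun z s) \<le> w s * norm z"
      using w[of s] norm_bounded[of z s] by (simp add: mult_left_mono)
    finally have "norm (G z s) \<le> norm (F (s + t0) 0) + L * (w s * norm z)"
      using \<open>0 < L\<close> by (simp add: mult_left_mono)
    moreover have "norm (F (s + t0) 0) \<le> M * w s"
      using M[of "s + t0"] w[of s] M0 mult_left_mono[of 1 "w s" M] by simp
    moreover have "(M + L * norm z) / K * K = M + L * norm z" using K by simp
    ultimately show ?thesis by (simp only:) (simp add: w_def algebra_simps)
  qed
  define \<Phi> where "\<Phi> z = Bcontfun (\<lambda>t. (x0 + P z t) /\<^sub>R w t)" for z
  have \<Phi>: "apply_bcontfun (\<Phi> z) = (\<lambda>t. (x0 + P z t) /\<^sub>R w t)" for z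
    unfolding \<Phi>_def
  proof (rule Bcontfun_inverse, rule bcontfun_normI)
    have "w t \<noteq> 0" for t using w[of t] by linarith
    then show "continuous_on UNIV (\<lambda>t. (x0 + P z t) /\<^sub>R w t)"
      by (intro continuous_intros cP cw) auto
    fix t
    have A: "norm (P z t) \<le> (M + L * norm z) / K * w t"
      unfolding w_def using K M0 \<open>0 < L\<close> by (intro antiderivative_exp_bound[OF P(2) P(1) Gb]) auto
    have "norm x0 \<le> norm x0 * w t" using w[of t] mult_left_mono[of 1 "w t" "norm x0"] by simp
    then have "norm (x0 + P z t) \<le> (norm x0 + (M + L * norm z) / K) * w t"
      using A norm_triangle_ineq[of x0 "P z t"] unfolding distrib_right by linarith
    then have "norm (x0 + P z t) / w t \<le> norm x0 + (M + L * norm z) / K"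
      using w[of t] pos_divide_le_eq[of "w t"] by simp
    moreover have "norm ((x0 + P z t) /\<^sub>R w t) = norm (x0 + P z t) / w t"
      using w[of t] by (simp add: divide_inverse mult.commute del: scaleR_add_right)
    ultimately show "norm ((x0 + P z t) /\<^sub>R w t) \<le> norm x0 + (M + L * norm z) / K"
      by simp
  qed
  have "dist (\<Phi> u) (\<Phi> z) \<le> 1 / 2 * dist u z" for u z
  proof (rule dist_bound)
    fix t
    have d: "((\<lambda>t. P u t - P z t) has_vector_derivative G u t - G z t) (at t)" for t
      by (intro has_vector_derivative_diff P)
    have b: "norm (G u s - G z s) \<le> 1 / 2 * dist u z * K * exp (K * \<bar>s\<bar>)" for s
    proof -
      have "norm (G u s - G z s) \<le> L * norm (w s *\<^sub>R apply_bcontfun u s - w s *\<^sub>R apply_bcontfun z s)"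
        unfolding G_def by (rule lip)
      also have "w s *\<^sub>R apply_bcontfun u s - w s *\<^sub>R apply_bcontfun z s = w s *\<^sub>R (apply_bcontfun u s - apply_bcontfun z s)"
        by (simp add: scaleR_diff_right)
      also have "norm \<dots> \<le> w s * dist u z"
        using w[of s] dist_bounded[of u s z] by (simp add: dist_norm mult_left_mono)
      finally show ?thesis using \<open>0 < L\<close> by (simp add: K_def w_def algebra_simps)
    qed
    have "norm (P u t - P z t) \<le> 1 / 2 * dist u z * w t"
      unfolding w_def by (rule antiderivative_exp_bound[OF d _ b]) (simp_all add: P)
    moreover have "dist (apply_bcontfun (\<Phi> u) t) (apply_bcontfun (\<Phi> z) t) = norm (P u t - P z t) / w t"
      using w[of t] by (simp add: \<Phi> dist_norm scaleR_diff_right[symmetric] divide_inverse)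
    ultimately show "dist (apply_bcontfun (\<Phi> u) t) (apply_bcontfun (\<Phi> z) t) \<le> 1 / 2 * dist u z"
      using w[of t] pos_divide_le_eq[of "w t" "norm (P u t - P z t)" "1 / 2 * dist u z"] by simp
  qed
  then obtain z where z: "\<Phi> z = z"
    using banach_fix_type[of "1/2" \<Phi>] by auto
  define x where "x t = x0 + P z t" for t
  have wz: "w t *\<^sub>R apply_bcontfun z t = x t" for t
  proof -
    have "apply_bcontfun z t = x t /\<^sub>R w t"
      using \<Phi>[of z] by (simp add: z x_def)
    then show ?thesis using w[of t] by simp
  qed
  have dx: "(x has_vector_derivative F (t + t0) (x t)) (at t)" for t
    using has_vector_derivative_add[OF has_vector_derivative_const[of x0] P(2)[of z t]]
    by (simp add: x_def[abs_def] G_def wz[unfolded x_def])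
  \<comment> \<open>Undoes the time shift.\<close>
  have "((\<lambda>t. x (t - t0)) has_vector_derivative F t (x (t - t0))) (at t)" for t
  proof -
    have "((\<lambda>t. t - t0) has_real_derivative 1) (at t)" by (auto intro!: derivative_eq_intros)
    from vector_diff_chain_at[OF this[unfolded has_real_derivative_iff_has_vector_derivative] dx[of "t - t0"]]
    show ?thesis by (simp add: o_def)
  qed
  moreover have "x (t0 - t0) = x0" by (simp add: x_def P)
  ultimately show ?thesis by (intro exI[of _ "\<lambda>t. x (t - t0)"]) auto
qed

subsection \<open>The oscillator satisfied by \<open>1 / \<mu>\<close>\<close>

definition osc_force :: "real \<Rightarrow> real \<Rightarrow> real" where
  "osc_force lam y = 1 / y ^ 3 + 2 * lam / y\<^sup>2 - y"

text \<open>The terms without \<open>p\<close> form the potential, whose derivative in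
  \<open>y\<close> is \<open>- 2 * osc_force\<close>. The additive constant completes the square,
  which makes the energy the squared length of the momentum vector \<open>J\<close>.\<close>

definition osc_energy :: "real \<Rightarrow> real \<Rightarrow> real \<Rightarrow> real" where
  "osc_energy lam y p = p\<^sup>2 + y\<^sup>2 + (1 / y + 2 * lam)\<^sup>2"

definition oscillator :: "real \<Rightarrow> real set \<Rightarrow> (real \<Rightarrow> real) \<Rightarrow> (real \<Rightarrow> real) \<Rightarrow> bool" where
  "oscillator lam I y p \<longleftrightarrow> (\<forall>s\<in>I. 0 < y s \<and> (y has_real_derivative p s) (at s) \<and>
     (p has_real_derivative osc_force lam (y s)) (at s))"

lemma oscillatorD:
  assumes "oscillator lam I y p" "s \<in> I"
  shows "0 < y s" "(y has_real_derivative p s) (at s)"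
    "(p has_real_derivative osc_force lam (y s)) (at s)"
  using assms by (auto simp: oscillator_def)

lemma osc_energy_deriv:
  assumes "(y has_real_derivative p s) (at s)" "(p has_real_derivative osc_force lam (y s)) (at s)" "0 < y s"
  shows "((\<lambda>s. osc_energy lam (y s) (p s)) has_real_derivative 0) (at s)"
proof -
  have yn: "y s \<noteq> 0" using assms by simp
  have "((\<lambda>s. 1 / y s + 2 * lam) has_real_derivative - p s / (y s)\<^sup>2) (at s)"
    using DERIV_add[OF DERIV_divide[OF DERIV_const[of 1] assms(1) yn] DERIV_const[of "2 * lam"]]
    by (simp add: power2_eq_square)
  note d = DERIV_add[OF DERIV_add[OF DERIV_power[OF assms(2), of 2] DERIV_power[OF assms(1), of 2]] DERIV_power[OF this, of 2]]
  show ?thesis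
    unfolding osc_energy_def
    by (rule DERIV_cong[OF d])
      (use yn in \<open>simp add: osc_force_def power2_eq_square power3_eq_cube field_simps\<close>)
qed

lemma osc_energy_constant:
  assumes "oscillator lam I y p" "is_interval I" "s \<in> I" "t \<in> I"
  shows "osc_energy lam (y s) (p s) = osc_energy lam (y t) (p t)"
proof -
  have "\<exists>c. \<forall>s\<in>I. osc_energy lam (y s) (p s) = c"
  proof (rule has_field_derivative_zero_constant)
    show "convex I" using assms(2) by (rule is_interval_convex)
    show "((\<lambda>s. osc_energy lam (y s) (p s)) has_real_derivative 0) (at s within I)" if "s \<in> I" for s
      using osc_energy_deriv oscillatorD[OF assms(1) that] has_field_derivative_at_within by blast
  qed
  then show ?thesis using assms by auto
qed

text \<open>Each of the three squares in the energy is at most \<open>h\<close>; the last one bounds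
  \<open>1 / y\<close> and so keeps \<open>y\<close> away from 0.\<close>

lemma osc_energy_bounds:
  assumes "osc_energy lam y p = h" "0 < y"
  shows "y \<le> sqrt h" "\<bar>p\<bar> \<le> sqrt h" "1 / (sqrt h + 2 * \<bar>lam\<bar>) \<le> y" "0 < sqrt h"
proof -
  have "y\<^sup>2 \<le> h" "p\<^sup>2 \<le> h" and u: "(1 / y + 2 * lam)\<^sup>2 \<le> h"
    using assms(1) by (auto simp: osc_energy_def intro: add_increasing add_increasing2 simp flip: assms(1))
  then show 1: "y \<le> sqrt h" "\<bar>p\<bar> \<le> sqrt h"
    by (simp_all add: real_le_rsqrt flip: real_sqrt_abs)
  then show "0 < sqrt h" using assms(2) by linarith
  have "\<bar>1 / y + 2 * lam\<bar> \<le> sqrt h" using u by (simp flip: real_sqrt_abs)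
  then have "1 / y \<le> sqrt h + 2 * \<bar>lam\<bar>" by linarith
  then show "1 / (sqrt h + 2 * \<bar>lam\<bar>) \<le> y"
    using assms(2) \<open>0 < sqrt h\<close> by (simp add: field_simps add_pos_nonneg)
qed

lemma osc_force_lipschitz:
  assumes "0 < \<delta>"
  obtains L where "0 < L" "\<And>y z. \<delta> \<le> y \<Longrightarrow> \<delta> \<le> z \<Longrightarrow> \<bar>osc_force lam y - osc_force lam z\<bar> \<le> L * \<bar>y - z\<bar>"
proof
  \<comment> \<open>A bound on \<open>[\<delta>, \<infinity>)\<close> for the derivative of the
    force, taken term by term at \<open>u = \<delta>\<close>.\<close>
  define L where "L = 3 / \<delta> ^ 4 + 4 * \<bar>lam\<bar> / \<delta> ^ 3 + 1"
  show "0 < L" using assms by (simp add: L_def add_nonneg_pos)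
  fix y z assume yz: "\<delta> \<le> y" "\<delta> \<le> z"
  have "norm (osc_force lam y - osc_force lam z) \<le> L * norm (y - z)"
  proof (rule field_differentiable_bound)
    show "convex {\<delta>..}" "y \<in> {\<delta>..}" "z \<in> {\<delta>..}" using yz by auto
    fix u assume u: "u \<in> {\<delta>..}"
    then have un: "u > 0" using assms by simp
    show "(osc_force lam has_real_derivative - 3 / u ^ 4 - 4 * lam / u ^ 3 - 1) (at u within {\<delta>..})"
      unfolding osc_force_def[abs_def]
      using un by (auto intro!: derivative_eq_intros simp: field_simps eval_nat_numeral)
    have "\<bar>- 3 / u ^ 4 - 4 * lam / u ^ 3 - 1\<bar> \<le> 3 / u ^ 4 + 4 * \<bar>lam\<bar> / u ^ 3 + 1"
      using un by (simp add: abs_le_iff abs_if divide_simps)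
    also have "\<dots> \<le> L"
      unfolding L_def using u un assms
      by (intro add_mono divide_left_mono power_mono mult_pos_pos) auto
    finally show "norm (- 3 / u ^ 4 - 4 * lam / u ^ 3 - 1) \<le> L" by simp
  qed
  then show "\<bar>osc_force lam y - osc_force lam z\<bar> \<le> L * \<bar>y - z\<bar>" by simp
qed

text \<open>The function \<open>f\<close> is left general so that the estimate serves both the force
  and its truncation.\<close>

lemma osc_field_lipschitz:
  fixes f :: "real \<Rightarrow> real" and y z p q :: real
  assumes "\<bar>f y - f z\<bar> \<le> L * \<bar>y - z\<bar>" "0 \<le> L"
  shows "norm ((p, f y) - (q, f z)) \<le> (1 + L) * norm ((y, p) - (z, q))"
proof -
  have "norm ((p, f y) - (q, f z)) \<le> \<bar>p - q\<bar> + \<bar>f y - f z\<bar>"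
    using norm_Pair_le[of "p - q" "f y - f z"] by simp
  also have "\<dots> \<le> norm ((y, p) - (z, q)) + L * norm ((y, p) - (z, q))"
    using norm_snd_le[of "p - q" "y - z"] norm_fst_le[of "y - z" "p - q"] assms
      mult_left_mono[of "\<bar>y - z\<bar>" "norm (y - z, p - q)" L]
    by (intro add_mono) auto
  finally show ?thesis by (simp add: distrib_right)
qed

text \<open>Equal initial data give equal energy, hence one positive lower bound for both solutions,
  above which the force is Lipschitz.\<close>

lemma oscillator_unique:
  assumes "is_interval I" and y: "oscillator lam I y p" and z: "oscillator lam I z q"
    and "s0 \<in> I" "y s0 = z s0" "p s0 = q s0" "s \<in> I"
  shows "y s = z s" "p s = q s"
proof -
  define h where "h = osc_energy lam (y s0) (p s0)"
  define \<delta> where "\<delta> = 1 / (sqrt h + 2 * \<bar>lam\<bar>)"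
  have "0 < sqrt h" using osc_energy_bounds(4)[of lam "y s0" "p s0" h] oscillatorD(1)[OF y \<open>s0 \<in> I\<close>] by (simp add: h_def)
  then have \<delta>: "\<delta> > 0" by (simp add: \<delta>_def add_pos_nonneg)
  have yb: "\<delta> \<le> y t" if "t \<in> I" for t
    unfolding \<delta>_def using osc_energy_bounds(3) oscillatorD(1)[OF y that] osc_energy_constant[OF y assms(1,4) that]
    by (simp add: h_def)
  have zb: "\<delta> \<le> z t" if "t \<in> I" for t
    unfolding \<delta>_def using osc_energy_bounds(3) oscillatorD(1)[OF z that] osc_energy_constant[OF z assms(1,4) that]
    by (simp add: h_def assms)
  obtain L where L: "0 < L" "\<And>y z. \<delta> \<le> y \<Longrightarrow> \<delta> \<le> z \<Longrightarrow> \<bar>osc_force lam y - osc_force lam z\<bar> \<le> L * \<bar>y - z\<bar>"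
    using osc_force_lipschitz[OF \<delta>, of lam] by blast
  have "(y s, p s) = (z s, q s)"
  proof (rule ode_unique[where x = "\<lambda>t. (y t, p t)" and z = "\<lambda>t. (z t, q t)" and I = I and ?t0.0 = s0 and F = "\<lambda>t x. (snd x, osc_force lam (fst x))" and L = "1 + L"])
    show "((\<lambda>t. (y t, p t)) has_vector_derivative (snd (y t, p t), osc_force lam (fst (y t, p t)))) (at t)" if "t \<in> I" for t
      using oscillatorD[OF y that]
      by (auto intro!: has_vector_derivative_Pair simp: has_real_derivative_iff_has_vector_derivative)
    show "((\<lambda>t. (z t, q t)) has_vector_derivative (snd (z t, q t), osc_force lam (fst (z t, q t)))) (at t)" if "t \<in> I" for t
      using oscillatorD[OF z that]
      by (auto intro!: has_vector_derivative_Pair simp: has_real_derivative_iff_has_vector_derivative)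
    show "norm ((snd (y t, p t), osc_force lam (fst (y t, p t))) - (snd (z t, q t), osc_force lam (fst (z t, q t))))
        \<le> (1 + L) * norm ((y t, p t) - (z t, q t))" if "t \<in> I" for t
      unfolding fst_conv snd_conv using osc_field_lipschitz[OF L(2)[OF yb[OF that] zb[OF that]]] L(1) by simp
  qed (use assms in auto)
  then show "y s = z s" "p s = q s" by auto
qed

text \<open>Replacing \<open>y\<close> by \<open>max \<delta> y\<close> in the force makes the field
  globally Lipschitz. The times at which the energy is still \<open>h\<close> and
  \<open>2 * \<delta> \<le> y\<close> form a nonempty clopen set.\<close>

lemma oscillator_global_exists:
  assumes "0 < y0"
  obtains y p where "oscillator lam UNIV y p" "y s0 = y0" "p s0 = p0"
proof -
  define h where "h = osc_energy lam y0 p0"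
  define m where "m = 1 / (sqrt h + 2 * \<bar>lam\<bar>)"
  \<comment> \<open>Half of the lower bound given by the energy: \<open>2 * \<delta> \<le> y\<close>
    is a closed condition, and it leaves a neighbourhood on which \<open>\<delta> < y\<close>, where
    the truncated and the true equation agree.\<close>
  define \<delta> where "\<delta> = m / 2"
  have "0 < sqrt h" using osc_energy_bounds(4)[of lam y0 p0 h] assms by (simp add: h_def)
  then have \<delta>: "\<delta> > 0" by (simp add: \<delta>_def m_def add_pos_nonneg)
  have hb: "2 * \<delta> \<le> y" if "osc_energy lam y p = h" "0 < y" for y p
    using osc_energy_bounds(3)[OF that, folded m_def] by (simp add: \<delta>_def)
  obtain L where L: "0 < L" "\<And>y z. \<delta> \<le> y \<Longrightarrow> \<delta> \<le> z \<Longrightarrow> \<bar>osc_force lam y - osc_force lam z\<bar> \<le> L * \<bar>y - z\<bar>"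
    using osc_force_lipschitz[OF \<delta>, of lam] by blast
  define F where "F = (\<lambda>(t::real) (x::real \<times> real). (snd x, osc_force lam (max \<delta> (fst x))))"
  have "\<exists>x. x s0 = (y0, p0) \<and> (\<forall>t. (x has_vector_derivative F t (x t)) (at t))"
  proof (rule global_ode_solution)
    have nz: "max \<delta> u \<noteq> 0" for u using \<delta> by linarith
    show "continuous_on UNIV (\<lambda>(t, x). F t x)"
      unfolding F_def osc_force_def split_beta by (intro continuous_intros) (auto simp: nz)
    show "norm (F t x - F t z) \<le> (1 + L) * norm (x - z)" for t x z
    proof -
      have "\<bar>osc_force lam (max \<delta> (fst x)) - osc_force lam (max \<delta> (fst z))\<bar> \<le> L * \<bar>max \<delta> (fst x) - max \<delta> (fst z)\<bar>"
        by (rule L(2)) auto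
      also have "\<dots> \<le> L * \<bar>fst x - fst z\<bar>"
        using L(1) by (intro mult_left_mono) auto
      finally show ?thesis
        using osc_field_lipschitz[of "\<lambda>u. osc_force lam (max \<delta> u)" "fst x" "fst z" L "snd x" "snd z"] L(1)
        by (simp add: F_def)
    qed
    show "norm (F t 0) \<le> norm (F 0 0)" for t by (simp add: F_def)
  qed (use L in simp)
  then obtain x where x: "x s0 = (y0, p0)" "\<And>t. (x has_vector_derivative F t (x t)) (at t)"
    by blast
  define y where "y t = fst (x t)" for t
  define p where "p t = snd (x t)" for t
  have dy: "(y has_real_derivative p t) (at t)" and dp: "(p has_real_derivative osc_force lam (max \<delta> (y t))) (at t)" for t
  proof -
    have d: "(x has_derivative (\<lambda>h. h *\<^sub>R F t (x t))) (at t)" using x(2) by (simp add: has_vector_derivative_def)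
    show "(y has_real_derivative p t) (at t)"
      unfolding y_def[abs_def] has_real_derivative_iff_has_vector_derivative has_vector_derivative_def
      using has_derivative_fst[OF d] by (simp add: F_def p_def)
    show "(p has_real_derivative osc_force lam (max \<delta> (y t))) (at t)"
      unfolding p_def[abs_def] has_real_derivative_iff_has_vector_derivative has_vector_derivative_def
      using has_derivative_snd[OF d] by (simp add: F_def y_def)
  qed
  have cont: "continuous_on S y" "continuous_on S p" for S
    using DERIV_isCont[OF dy] DERIV_isCont[OF dp] by (auto intro: continuous_at_imp_continuous_on)
  text \<open>By conservation of energy the truncation at \<open>\<delta>\<close> is never active.\<close>
  define X where "X = {t. 2 * \<delta> \<le> y t \<and> osc_energy lam (y t) (p t) = h}"
  \<comment> \<open>With \<open>max \<delta> (y t)\<close> the energy is continuous at all times,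
    also where \<open>y\<close> might not be known to be nonzero.\<close>
  have "X = {t. 2 * \<delta> \<le> y t \<and> osc_energy lam (max \<delta> (y t)) (p t) = h}"
    using \<delta> by (auto simp: X_def)
  moreover have "closed {t. 2 * \<delta> \<le> y t \<and> osc_energy lam (max \<delta> (y t)) (p t) = h}"
  proof -
    have nz: "max \<delta> u \<noteq> 0" for u using \<delta> by linarith
    show ?thesis
      unfolding osc_energy_def
      by (intro closed_Collect_conj closed_Collect_le closed_Collect_eq continuous_intros cont) (simp_all add: nz)
  qed
  ultimately have "closed X" by simp
  moreover have "open X"
    unfolding open_contains_ball
  proof
    fix t assume t: "t \<in> X"
    have "open (y -` {\<delta><..})"
      using open_vimage[OF open_greaterThan cont(1)] .
    moreover have "t \<in> y -` {\<delta><..}" using t \<delta> by (simp add: X_def)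
    ultimately obtain r where r: "r > 0" "ball t r \<subseteq> y -` {\<delta><..}" using openE by blast
    have "oscillator lam (ball t r) y p"
      unfolding oscillator_def
    proof (intro ballI conjI)
      fix s assume "s \<in> ball t r"
      then have s: "\<delta> < y s" using r by auto
      then show "0 < y s" using \<delta> by simp
      show "(y has_real_derivative p s) (at s)" by (rule dy)
      show "(p has_real_derivative osc_force lam (y s)) (at s)"
        using dp[of s] s by (simp add: max_def)
    qed
    moreover have "is_interval (ball t r)" by (simp add: is_interval_ball_real)
    ultimately have en: "osc_energy lam (y s) (p s) = h" if "s \<in> ball t r" for s
      using osc_energy_constant[of lam "ball t r" y p s t] that r t by (simp add: X_def)
    have pos: "0 < y s" if "s \<in> ball t r" for s
      using r that \<delta> by force
    have "ball t r \<subseteq> X" using hb[OF en pos] en by (auto simp: X_def)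
    then show "\<exists>e>0. ball t e \<subseteq> X" using r by blast
  qed
  moreover have "s0 \<in> X"
    using x(1) assms hb[of y0 p0] by (simp add: X_def y_def p_def h_def)
  ultimately have "X = UNIV" using clopen[of X] by blast
  then have "2 * \<delta> \<le> y t" for t by (auto simp: X_def)
  then have ge: "\<delta> < y t" for t using \<delta> by (smt (verit))
  have "oscillator lam UNIV y p"
    unfolding oscillator_def
  proof (intro ballI conjI)
    fix s
    show "0 < y s" using ge[of s] \<delta> by simp
    show "(y has_real_derivative p s) (at s)" by (rule dy)
    show "(p has_real_derivative osc_force lam (y s)) (at s)"
      using dp[of s] ge[of s] by (simp add: max_def)
  qed
  then show thesis using that x(1) by (simp add: y_def p_def)
qed

section \<open>Turning times and periodicity of the oscillator\<close>

text \<open>If the limit \<open>b\<close> were positive, the slope would eventually exceed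
  \<open>b / 2\<close>, and linear growth would contradict boundedness.\<close>

lemma deriv_limit_nonpos:
  fixes g :: "real \<Rightarrow> real"
  assumes g: "\<And>t. (g has_real_derivative g' t) (at t)" and B: "\<And>t. \<bar>g t\<bar> \<le> B"
    and lim: "(g' \<longlongrightarrow> b) at_top"
  shows "b \<le> 0"
proof (rule ccontr)
  assume "\<not> b \<le> 0"
  then have b: "b > 0" by simp
  then have "eventually (\<lambda>t. b / 2 < g' t) at_top"
    using order_tendstoD(1)[OF lim, of "b / 2"] by simp
  then obtain t0 where t0: "\<And>t. t \<ge> t0 \<Longrightarrow> b / 2 < g' t"
    by (auto simp: eventually_at_top_linorder)
  \<comment> \<open>Chosen so that the growth is at least \<open>2 * B + 2\<close>, more than the
    possible oscillation \<open>2 * B\<close>.\<close>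
  define t where "t = t0 + (4 * B + 4) / b"
  have B0: "0 \<le> B" using B[of 0] by linarith
  have "t0 \<le> t" using b B0 by (simp add: t_def)
  have "g t0 - b / 2 * t0 \<le> g t - b / 2 * t"
  proof (rule DERIV_nonneg_imp_nondecreasing[OF \<open>t0 \<le> t\<close>, where f = "\<lambda>t. g t - b / 2 * t"])
    fix x assume "t0 \<le> x" "x \<le> t"
    have "((\<lambda>t. g t - b / 2 * t) has_real_derivative g' x - b / 2) (at x)"
      by (auto intro!: derivative_eq_intros g)
    then show "\<exists>y. ((\<lambda>t. g t - b / 2 * t) has_real_derivative y) (at x) \<and> 0 \<le> y"
      using t0[OF \<open>t0 \<le> x\<close>] by (intro exI[of _ "g' x - b / 2"]) simp
  qed
  moreover have "b / 2 * (t - t0) = 2 * B + 2" using b by (simp add: t_def field_simps)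
  ultimately have "g t \<ge> g t0 + 2 * B + 2" unfolding right_diff_distrib by linarith
  then show False using B[of t] B[of t0] by linarith
qed

lemma deriv_limit_zero:
  fixes g :: "real \<Rightarrow> real"
  assumes "\<And>t. (g has_real_derivative g' t) (at t)" "\<And>t. \<bar>g t\<bar> \<le> B" "(g' \<longlongrightarrow> b) at_top"
  shows "b = 0"
proof (rule antisym)
  show "b \<le> 0" using assms by (rule deriv_limit_nonpos)
  have "- b \<le> 0"
    by (rule deriv_limit_nonpos[where g = "\<lambda>t. - g t" and g' = "\<lambda>t. - g' t" and B = B])
      (use assms in \<open>auto intro: DERIV_minus tendsto_minus\<close>)
  then show "0 \<le> b" by simp
qed

lemma mono_bounded_tendsto_at_top:
  fixes g :: "real \<Rightarrow> real"
  assumes mono: "\<And>s t. a \<le> s \<Longrightarrow> s \<le> t \<Longrightarrow> g s \<le> g t" and B: "\<And>t. g t \<le> B"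
  shows "\<exists>l. (g \<longlongrightarrow> l) at_top"
proof -
  define l where "l = (SUP t\<in>{a..}. g t)"
  have bdd: "bdd_above (g ` {a..})" using B by (auto intro!: bdd_aboveI[of _ B])
  have "(g \<longlongrightarrow> l) at_top"
  proof (rule increasing_tendsto)
    show "\<forall>\<^sub>F t in at_top. g t \<le> l"
      using eventually_ge_at_top[of a] by eventually_elim (auto simp: l_def intro!: cSUP_upper bdd)
    fix x assume "x < l"
    then obtain s where s: "a \<le> s" "x < g s"
      unfolding l_def using less_cSUP_iff[OF _ bdd, of x] by auto
    show "\<forall>\<^sub>F t in at_top. x < g t"
      using eventually_ge_at_top[of s] by eventually_elim (use s mono in force)
  qed
  then show ?thesis by blast
qed

text \<open>Equilibrium means \<open>2 * lam = Y ^ 3 - 1 / Y\<close>. After this substitution the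
  difference of the potentials is the nonnegative expression
  \<open>(u - v)^2 + (y - Y)^2 * (1 + 2 * Y * u)\<close>, whatever the sign of
  \<open>lam\<close>.\<close>

lemma osc_potential_minimum:
  assumes "0 < y" "0 < Y" "osc_force lam Y = 0"
  shows "osc_energy lam Y 0 \<le> osc_energy lam y 0"
proof -
  have lam: "2 * lam = Y ^ 3 - 1 / Y"
    using assms by (simp add: osc_force_def field_simps eval_nat_numeral)
  define u where "u = 1 / y"
  define v where "v = 1 / Y"
  have uv: "y * u = 1" "Y * v = 1" using assms(1,2) by (simp_all add: u_def v_def)
  have "osc_energy lam y 0 - osc_energy lam Y 0 = y\<^sup>2 - Y\<^sup>2 + (u + (Y ^ 3 - v))\<^sup>2 - (v + (Y ^ 3 - v))\<^sup>2"
    unfolding osc_energy_def lam by (simp add: u_def v_def)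
  also have "\<dots> = (u - v)\<^sup>2 + (y - Y)\<^sup>2 * (1 + 2 * Y * u)"
    using uv by algebra
  also have "\<dots> \<ge> 0" using assms(1,2) by (simp add: u_def)
  finally show ?thesis by simp
qed

text \<open>Otherwise \<open>y\<close> is eventually monotone and bounded, so it tends to some
  \<open>Y > 0\<close>. As \<open>p\<close> is bounded and its derivative converges,
  \<open>Y\<close> is an equilibrium. By conservation of energy \<open>\<bar>p\<bar>\<close>
  converges too, necessarily to 0, so \<open>h\<close> is the potential at \<open>Y\<close>, its
  minimum. But a time with \<open>p \<noteq> 0\<close> has potential below \<open>h\<close>.\<close>

lemma oscillator_turning_time:
  assumes osc: "oscillator lam UNIV y p"
  shows "\<exists>t>t1. p t = 0"
proof (rule ccontr)
  assume "\<not> (\<exists>t>t1. p t = 0)"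
  then have p0: "p t \<noteq> 0" if "t > t1" for t using that by blast
  note o = oscillatorD[OF osc UNIV_I]
  define h where "h = osc_energy lam (y 0) (p 0)"
  have en: "osc_energy lam (y t) (p t) = h" for t
    unfolding h_def by (rule osc_energy_constant[OF osc]) auto
  note b = osc_energy_bounds[OF en o(1)]
  have "continuous_on {t1<..} p"
    using DERIV_isCont[OF o(3)] by (auto intro: continuous_at_imp_continuous_on)
  then have conn: "connected (p ` {t1<..})" by (intro connected_continuous_image) auto
  have "(\<forall>t>t1. p t > 0) \<or> (\<forall>t>t1. p t < 0)"
  proof (rule ccontr)
    assume "\<not> ?thesis"
    then obtain u v where "u > t1" "v > t1" "p u < 0" "p v > 0" using p0 by (metis linorder_neqE_linordered_idom)
    then have "p u \<in> p ` {t1<..}" "p v \<in> p ` {t1<..}" "p u \<le> 0" "0 \<le> p v" by auto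
    then have "0 \<in> p ` {t1<..}" by (rule connectedD_interval[OF conn])
    then obtain t where "t > t1" "p t = 0" by (metis greaterThan_iff imageE)
    then show False using p0 by blast
  qed
  \<comment> \<open>The sign of \<open>p\<close> after \<open>t1\<close>; multiplying by it treats
    increasing and decreasing \<open>y\<close> together.\<close>
  then obtain \<epsilon> :: real where \<epsilon>: "\<epsilon> = 1 \<or> \<epsilon> = -1" "\<And>t. t > t1 \<Longrightarrow> \<epsilon> * p t > 0"
    by (metis mult_1 mult_minus1 neg_0_less_iff_less)
  have d\<epsilon>: "((\<lambda>t. \<epsilon> * y t) has_real_derivative \<epsilon> * p t) (at t)" for t
    by (intro DERIV_cmult o)
  have b\<epsilon>: "\<bar>\<epsilon> * y t\<bar> \<le> sqrt h" for t using \<epsilon>(1) b(1)[of t] o(1)[of t] by (auto simp: abs_mult)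
  have "\<exists>l. ((\<lambda>t. \<epsilon> * y t) \<longlongrightarrow> l) at_top"
  proof (rule mono_bounded_tendsto_at_top)
    show "\<epsilon> * y t \<le> sqrt h" for t using b\<epsilon>[of t] by linarith
    show "\<epsilon> * y s \<le> \<epsilon> * y t" if "t1 + 1 \<le> s" "s \<le> t" for s t
    proof (rule DERIV_nonneg_imp_nondecreasing[OF \<open>s \<le> t\<close>, where f = "\<lambda>t. \<epsilon> * y t"])
      fix x assume "s \<le> x" "x \<le> t"
      then show "\<exists>z. ((\<lambda>t. \<epsilon> * y t) has_real_derivative z) (at x) \<and> 0 \<le> z"
        using d\<epsilon>[of x] \<epsilon>(2)[of x] that by (intro exI[of _ "\<epsilon> * p x"]) auto
    qed
  qed
  then obtain l where l: "((\<lambda>t. \<epsilon> * y t) \<longlongrightarrow> l) at_top" by blast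
  define Y where "Y = \<epsilon> * l"
  have \<epsilon>\<epsilon>: "\<epsilon> * (\<epsilon> * u) = u" for u using \<epsilon>(1) by auto
  have yY: "(y \<longlongrightarrow> Y) at_top"
    using tendsto_mult_left[OF l, of \<epsilon>] unfolding \<epsilon>\<epsilon> Y_def .
  have "1 / (sqrt h + 2 * \<bar>lam\<bar>) \<le> Y"
    using b(3) by (intro tendsto_lowerbound[OF yY]) auto
  moreover have "0 < 1 / (sqrt h + 2 * \<bar>lam\<bar>)" using b(4) by (simp add: add_pos_nonneg)
  ultimately have Y: "Y > 0" by linarith
  have "((\<lambda>t. osc_force lam (y t)) \<longlongrightarrow> osc_force lam Y) at_top"
    unfolding osc_force_def using Y by (intro tendsto_intros yY) auto
  then have f0: "osc_force lam Y = 0"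
    by (rule deriv_limit_zero[where g = p, OF o(3) b(2)])
  have U: "osc_energy lam (y t) 0 = h - (p t)\<^sup>2" for t
    using en[of t] by (simp add: osc_energy_def)
  have "((\<lambda>t. osc_energy lam (y t) 0) \<longlongrightarrow> osc_energy lam Y 0) at_top"
    unfolding osc_energy_def using Y by (intro tendsto_intros yY) auto
  then have "((\<lambda>t. sqrt (h - osc_energy lam (y t) 0)) \<longlongrightarrow> sqrt (h - osc_energy lam Y 0)) at_top"
    by (intro tendsto_intros)
  then have "((\<lambda>t. \<bar>p t\<bar>) \<longlongrightarrow> sqrt (h - osc_energy lam Y 0)) at_top"
    by (simp add: U)
  moreover have "\<forall>\<^sub>F t in at_top. \<bar>p t\<bar> = \<epsilon> * p t"
    using eventually_gt_at_top[of t1]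
  proof eventually_elim
    case (elim t)
    then show ?case using \<epsilon>(1) \<epsilon>(2)[of t] by auto
  qed
  ultimately have "((\<lambda>t. \<epsilon> * p t) \<longlongrightarrow> sqrt (h - osc_energy lam Y 0)) at_top"
    by (rule Lim_transform_eventually)
  then have "sqrt (h - osc_energy lam Y 0) = 0"
    by (rule deriv_limit_zero[OF d\<epsilon> b\<epsilon>])
  then have "h = osc_energy lam Y 0" by simp
  also have "\<dots> \<le> osc_energy lam (y (t1 + 1)) 0"
    by (rule osc_potential_minimum[OF o(1) Y f0])
  finally have "(p (t1 + 1))\<^sup>2 \<le> 0" by (simp add: U)
  then show False using p0[of "t1 + 1"] by simp
qed

lemma oscillator_reflection:
  assumes osc: "oscillator lam UNIV y p" and "p t1 = 0"
  shows "y (2 * t1 - t) = y t"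
proof -
  note o = oscillatorD[OF osc UNIV_I]
  have "oscillator lam UNIV (\<lambda>t. y (2 * t1 - t)) (\<lambda>t. - p (2 * t1 - t))"
    unfolding oscillator_def
  proof (intro ballI conjI)
    fix s
    have d: "((\<lambda>t. 2 * t1 - t) has_real_derivative - 1) (at s)"
      by (auto intro!: derivative_eq_intros)
    show "0 < y (2 * t1 - s)" by (rule o)
    show "((\<lambda>t. y (2 * t1 - t)) has_real_derivative - p (2 * t1 - s)) (at s)"
      using DERIV_chain2[OF o(2) d] by simp
    show "((\<lambda>t. - p (2 * t1 - t)) has_real_derivative osc_force lam (y (2 * t1 - s))) (at s)"
      using DERIV_minus[OF DERIV_chain2[OF o(3) d]] by simp
  qed
  then show ?thesis
    using oscillator_unique(1)[OF _ _ osc, of "\<lambda>t. y (2 * t1 - t)" "\<lambda>t. - p (2 * t1 - t)" t1 t] assms(2)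
    by simp
qed

lemma oscillator_periodic:
  assumes osc: "oscillator lam UNIV y p"
  shows "\<exists>P>0. \<forall>t. y (t + P) = y t"
proof -
  obtain t1 where t1: "p t1 = 0" using oscillator_turning_time[OF osc, of 0] by blast
  obtain t2 where t2: "t2 > t1" "p t2 = 0" using oscillator_turning_time[OF osc, of t1] by blast
  have "y (t + 2 * (t2 - t1)) = y t" for t
    using oscillator_reflection[OF osc t2(2), of "t + 2 * (t2 - t1)"] oscillator_reflection[OF osc t1, of t]
    by (simp add: algebra_simps)
  then show ?thesis using t2(1) by (intro exI[of _ "2 * (t2 - t1)"]) simp
qed

section \<open>Existence of curves with prescribed curvature\<close>

text \<open>The hypothesis says that the matrix \<open>A\<close> with rows \<open>g\<close>,
  \<open>T\<close>, \<open>N\<close> satisfies \<open>transpose A ** A = mat 1\<close>; for a square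
  matrix the opposite product is then also the identity, and its entries are the
  conclusions.\<close>

lemma orthonormal_rows:
  fixes g T N :: "real^3"
  assumes "\<And>v w. (g \<bullet> v) * (g \<bullet> w) + (T \<bullet> v) * (T \<bullet> w) + (N \<bullet> v) * (N \<bullet> w) = v \<bullet> w"
  shows "g \<bullet> g = 1" "T \<bullet> T = 1" "N \<bullet> N = 1" "g \<bullet> T = 0" "g \<bullet> N = 0" "T \<bullet> N = 0"
proof -
  define A :: "real^3^3" where "A = vector [g, T, N]"
  have "transpose A ** A = mat 1"
  proof -
    have "(transpose A ** A) $ i $ j = axis i 1 \<bullet> axis j (1::real)" for i j
      using assms[of "axis i 1" "axis j 1"]
      by (simp add: A_def matrix_matrix_mult_def transpose_def sum_3 inner_axis)
    then show ?thesis by (simp add: vec_eq_iff mat_def inner_axis_axis)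
  qed
  then have "A ** transpose A = mat 1" by (simp add: matrix_left_right_inverse)
  then have "(A ** transpose A) $ i $ j = (if i = j then 1 else 0)" for i j
    by (simp add: mat_def)
  then have "A $ i \<bullet> A $ j = (if i = j then 1 else 0)" for i j
    by (simp add: matrix_matrix_mult_def transpose_def inner_vec_def)
  from this[of 1 1] this[of 2 2] this[of 3 3] this[of 1 2] this[of 1 3] this[of 2 3]
  show "g \<bullet> g = 1" "T \<bullet> T = 1" "N \<bullet> N = 1" "g \<bullet> T = 0" "g \<bullet> N = 0" "T \<bullet> N = 0"
    by (simp_all add: A_def)
qed

text \<open>The normal is an unknown of its own rather than \<open>cross3\<close> of the other two,
  which makes the field linear in the state and so globally Lipschitz for bounded curvature.\<close>

definition frenet_field :: "(real \<Rightarrow> real) \<Rightarrow> real \<Rightarrow> (real^3) \<times> (real^3) \<times> (real^3) \<Rightarrow> (real^3) \<times> (real^3) \<times> (real^3)" where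
  "frenet_field \<kappa> t x = (fst (snd x), \<kappa> t *\<^sub>R snd (snd x) - fst x, - \<kappa> t *\<^sub>R fst (snd x))"

lemma frenet_field_lipschitz:
  assumes "\<bar>\<kappa> t\<bar> \<le> B"
  shows "norm (frenet_field \<kappa> t x - frenet_field \<kappa> t z) \<le> (2 + 2 * B) * norm (x - z)"
proof -
  define d where "d = x - z"
  have B: "B \<ge> 0" using assms by linarith
  have n: "norm (fst d) \<le> norm d" "norm (fst (snd d)) \<le> norm d" "norm (snd (snd d)) \<le> norm d"
    using norm_fst_le[of "fst d" "snd d"] norm_snd_le[of "snd d" "fst d"]
      norm_fst_le[of "fst (snd d)" "snd (snd d)"] norm_snd_le[of "snd (snd d)" "fst (snd d)"] by auto
  have "frenet_field \<kappa> t x - frenet_field \<kappa> t z = frenet_field \<kappa> t d"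
    by (simp add: frenet_field_def d_def algebra_simps)
  moreover have "norm (frenet_field \<kappa> t d) \<le> norm (fst (snd d)) + (norm (\<kappa> t *\<^sub>R snd (snd d) - fst d) + norm (- \<kappa> t *\<^sub>R fst (snd d)))"
    unfolding frenet_field_def by (intro order_trans[OF norm_Pair_le] add_left_mono norm_Pair_le)
  moreover have "norm (\<kappa> t *\<^sub>R snd (snd d) - fst d) \<le> B * norm d + norm d"
    using assms B n by (intro order_trans[OF norm_triangle_ineq4] add_mono) (auto intro: mult_mono)
  moreover have "norm (- \<kappa> t *\<^sub>R fst (snd d)) \<le> B * norm d"
    using assms B n by (auto intro: mult_mono)
  ultimately show ?thesis using n(2) by (simp add: d_def algebra_simps)
qed

lemma frenet_global_exists:
  fixes g0 v0 :: "real^3"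
  assumes \<kappa>: "continuous_on UNIV \<kappa>" "\<And>t. \<bar>\<kappa> t\<bar> \<le> B"
    and "norm g0 = 1" "norm v0 = 1" "g0 \<bullet> v0 = 0"
  obtains g T where "g s0 = g0" "T s0 = v0"
    "\<And>s. norm (g s) = 1" "\<And>s. norm (T s) = 1"
    "\<And>s. (g has_vector_derivative T s) (at s)"
    "\<And>s. (T has_vector_derivative \<kappa> s *\<^sub>R cross3 (g s) (T s) - g s) (at s)"
    "\<And>s. ((\<lambda>s. cross3 (g s) (T s)) has_vector_derivative - \<kappa> s *\<^sub>R T s) (at s)"
proof -
  have B: "B \<ge> 0" using \<kappa>(2)[of 0] by linarith
  have "\<exists>x. x s0 = (g0, v0, cross3 g0 v0) \<and> (\<forall>t. (x has_vector_derivative frenet_field \<kappa> t (x t)) (at t))"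
  proof (rule global_ode_solution)
    have c: "continuous_on UNIV (\<lambda>x. \<kappa> (fst x))"
      by (rule continuous_on_compose2[OF \<kappa>(1)]) (auto intro: continuous_intros)
    show "continuous_on UNIV (\<lambda>(t, x). frenet_field \<kappa> t x)"
      unfolding frenet_field_def split_beta by (intro continuous_intros c)
    show "norm (frenet_field \<kappa> t x - frenet_field \<kappa> t z) \<le> (2 + 2 * B) * norm (x - z)" for t x z
      by (rule frenet_field_lipschitz[of \<kappa> t B, OF \<kappa>(2)])
    show "norm (frenet_field \<kappa> t 0) \<le> 0" for t
      by (simp add: frenet_field_def)
  qed (use B in simp)
  then obtain x where x: "x s0 = (g0, v0, cross3 g0 v0)" "\<And>t. (x has_vector_derivative frenet_field \<kappa> t (x t)) (at t)"
    by blast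
  define g where "g t = fst (x t)" for t
  define T where "T t = fst (snd (x t))" for t
  define N where "N t = snd (snd (x t))" for t
  have dg: "(g has_vector_derivative T t) (at t)"
    and dT: "(T has_vector_derivative \<kappa> t *\<^sub>R N t - g t) (at t)"
    and dN: "(N has_vector_derivative - \<kappa> t *\<^sub>R T t) (at t)" for t
  proof -
    have d: "(x has_derivative (\<lambda>h. h *\<^sub>R frenet_field \<kappa> t (x t))) (at t)" using x(2) by (simp add: has_vector_derivative_def)
    note d' = has_derivative_snd[OF d]
    show "(g has_vector_derivative T t) (at t)"
      unfolding g_def[abs_def] has_vector_derivative_def
      using has_derivative_fst[OF d] by (simp add: frenet_field_def T_def)
    show "(T has_vector_derivative \<kappa> t *\<^sub>R N t - g t) (at t)"
      unfolding T_def[abs_def] has_vector_derivative_def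
      using has_derivative_fst[OF d'] by (simp add: frenet_field_def N_def g_def)
    show "(N has_vector_derivative - \<kappa> t *\<^sub>R T t) (at t)"
      unfolding N_def[abs_def] has_vector_derivative_def
      using has_derivative_snd[OF d'] by (simp add: frenet_field_def T_def)
  qed
  have init: "g s0 = g0" "T s0 = v0" "N s0 = cross3 g0 v0"
    using x(1) by (simp_all add: g_def T_def N_def)
  note o = orthonormal_cross[OF assms(3-5)]
  have const: "f s = f s0" if "\<And>s. (f has_real_derivative 0) (at s)" for f :: "real \<Rightarrow> real" and s
    using DERIV_isconst_all that by blast
  \<comment> \<open>The coefficients of the Frenet system are skew, so this bilinear expression has
    derivative 0 by direct cancellation. The inner products among \<open>g\<close>,
    \<open>T\<close>, \<open>N\<close> would instead satisfy a coupled system.\<close>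
  have gram: "(g s \<bullet> v) * (g s \<bullet> w) + (T s \<bullet> v) * (T s \<bullet> w) + (N s \<bullet> v) * (N s \<bullet> w) = v \<bullet> w" for s v w
  proof -
    have di: "((\<lambda>s. f s \<bullet> v) has_real_derivative f' \<bullet> v) (at s)"
      if "(f has_vector_derivative f') (at s)" for f :: "real \<Rightarrow> real^3" and f' v s
      using has_vector_derivative_inner[OF that has_vector_derivative_const[of v]]
      by (simp add: has_real_derivative_iff_has_vector_derivative)
    have "(g s \<bullet> v) * (g s \<bullet> w) + (T s \<bullet> v) * (T s \<bullet> w) + (N s \<bullet> v) * (N s \<bullet> w)
       = (g s0 \<bullet> v) * (g s0 \<bullet> w) + (T s0 \<bullet> v) * (T s0 \<bullet> w) + (N s0 \<bullet> v) * (N s0 \<bullet> w)"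
    proof (rule const[where f = "\<lambda>s. (g s \<bullet> v) * (g s \<bullet> w) + (T s \<bullet> v) * (T s \<bullet> w) + (N s \<bullet> v) * (N s \<bullet> w)"])
      fix s
      show "((\<lambda>s. (g s \<bullet> v) * (g s \<bullet> w) + (T s \<bullet> v) * (T s \<bullet> w) + (N s \<bullet> v) * (N s \<bullet> w)) has_real_derivative 0) (at s)"
        by (rule DERIV_cong[OF DERIV_add[OF DERIV_add[OF DERIV_mult[OF di[OF dg] di[OF dg]] DERIV_mult[OF di[OF dT] di[OF dT]]]
              DERIV_mult[OF di[OF dN] di[OF dN]]]])
          (simp add: inner_diff_left algebra_simps)
    qed
    also have "\<dots> = ((v \<bullet> g0) *\<^sub>R g0 + (v \<bullet> v0 / (v0 \<bullet> v0)) *\<^sub>R v0 + (v \<bullet> cross3 g0 v0 / (v0 \<bullet> v0)) *\<^sub>R cross3 g0 v0) \<bullet> w"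
      using assms by (simp add: init inner_add_left inner_add_right inner_commute norm_eq_1)
    also have "\<dots> = v \<bullet> w"
      using orthogonal_expansion_3[of g0 v0 v] assms by (metis norm_zero zero_neq_one)
    finally show ?thesis .
  qed
  note r = orthonormal_rows[OF gram]
  \<comment> \<open>Orthonormality determines \<open>N\<close> only up to sign; the constant
    determinant 1 fixes the orientation.\<close>
  have "N s \<bullet> cross3 (g s) (T s) = N s0 \<bullet> cross3 (g s0) (T s0)" for s
  proof (rule const[where f = "\<lambda>s. N s \<bullet> cross3 (g s) (T s)"])
    fix s
    have "((\<lambda>s. N s \<bullet> cross3 (g s) (T s)) has_vector_derivative
       N s \<bullet> (cross3 (g s) (\<kappa> s *\<^sub>R N s - g s) + cross3 (T s) (T s)) + (- \<kappa> s *\<^sub>R T s) \<bullet> cross3 (g s) (T s)) (at s)"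
      by (intro has_vector_derivative_inner has_vector_derivative_cross dg dT dN)
    then show "((\<lambda>s. N s \<bullet> cross3 (g s) (T s)) has_real_derivative 0) (at s)"
      by (simp add: has_real_derivative_iff_has_vector_derivative Cross3.right_diff_distrib cross_mult_right dot_cross_self)
  qed
  then have det: "N s \<bullet> cross3 (g s) (T s) = 1" for s
    by (simp add: init o)
  have n: "norm (g s) = 1" "norm (T s) = 1" for s
    using r by (simp_all add: norm_eq_1)
  have N: "N s = cross3 (g s) (T s)" for s
  proof -
    have "(N s - cross3 (g s) (T s)) \<bullet> (N s - cross3 (g s) (T s)) = 0"
      using det[of s] r(3)[of s] orthonormal_cross(5)[OF n(1)[of s] n(2)[of s] r(4)[of s]]
      by (simp add: inner_diff_left inner_diff_right inner_commute)
    then show ?thesis by simp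
  qed
  show thesis
    using that[of g T] init n dg dT dN by (simp add: N[symmetric])
qed

subsection \<open>Global critical curves\<close>

text \<open>Bootstrapping: if \<open>y\<close> and \<open>p\<close> are \<open>C^k\<close> then so
  are their derivatives, since the force is smooth for positive \<open>y\<close>.\<close>

lemma oscillator_smooth:
  assumes "oscillator lam UNIV y p"
  shows "C_k_on k y UNIV \<and> C_k_on k p UNIV"
proof (induction k)
  note o = oscillatorD[OF assms UNIV_I]
  case 0
  then show ?case
    using DERIV_isCont[OF o(2)] DERIV_isCont[OF o(3)] by (auto intro: continuous_at_imp_continuous_on)
next
  note o = oscillatorD[OF assms UNIV_I]
  case (Suc k)
  have inv: "C_k_on k (\<lambda>s. inverse (y s)) UNIV"
    using o(1) Suc by (intro C_k_on_compose_real[OF _ _ _ C_k_on_inverse]) auto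
  have "C_k_on k (\<lambda>s. inverse (y s) ^ 3 + (2 * lam) * inverse (y s) ^ 2 - y s) UNIV"
    using Suc by (intro C_k_on_diff C_k_on_add C_k_on_mult C_k_on_power C_k_on_const inv open_UNIV) auto
  then have "C_k_on k (\<lambda>s. osc_force lam (y s)) UNIV"
    by (simp add: osc_force_def divide_inverse power_inverse)
  then show ?case
    using C_k_on_vderivI[OF open_UNIV o(2)[unfolded has_real_derivative_iff_has_vector_derivative]]
      C_k_on_vderivI[OF open_UNIV o(3)[unfolded has_real_derivative_iff_has_vector_derivative]] Suc
    by blast
qed

lemma oscillator_lower_bound:
  assumes "oscillator lam I y p" "is_interval I"
  obtains m where "0 < m" "\<And>s. s \<in> I \<Longrightarrow> m \<le> y s"
proof (cases "I = {}")
  case True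
  then show thesis using that[of 1] by simp
next
  case False
  then obtain s0 where s0: "s0 \<in> I" by blast
  define h where "h = osc_energy lam (y s0) (p s0)"
  have h: "osc_energy lam (y s) (p s) = h" if "s \<in> I" for s
    unfolding h_def using osc_energy_constant[OF assms that s0] .
  show thesis
  proof (rule that)
    show "0 < 1 / (sqrt h + 2 * \<bar>lam\<bar>)"
      using osc_energy_bounds(4)[OF h[OF s0] oscillatorD(1)[OF assms(1) s0]] by (simp add: add_pos_nonneg)
    show "1 / (sqrt h + 2 * \<bar>lam\<bar>) \<le> y s" if "s \<in> I" for s
      using osc_energy_bounds(3)[OF h[OF that] oscillatorD(1)[OF assms(1) that]] .
  qed
qed

text \<open>The energy keeps \<open>y\<close> away from 0, so the prescribed curvature is bounded
  and the Frenet system is solvable on the whole line. Bootstrapping gives \<open>C^4\<close>, and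
  the oscillator equation is the Euler-Lagrange equation.\<close>

lemma critical_curve_exists:
  fixes g0 v0 :: "real^3"
  assumes osc: "oscillator lam UNIV y p" and \<sigma>: "\<sigma> = 1 \<or> \<sigma> = -1"
    and "norm g0 = 1" "norm v0 = 1" "g0 \<bullet> v0 = 0"
  obtains c where "critical_curve lam UNIV c" "c s0 = g0" "unit_tangent c s0 = v0"
    "\<And>s. geodesic_curvature c s = \<sigma> / (y s)\<^sup>2"
proof -
  note o = oscillatorD[OF osc UNIV_I]
  define \<kappa> where "\<kappa> s = \<sigma> / (y s)\<^sup>2" for s
  have C\<kappa>: "C_k_on k \<kappa> UNIV" for k
  proof -
    have "C_k_on k (\<lambda>s. inverse (y s)) UNIV"
      using o(1) oscillator_smooth[OF osc, of k] by (intro C_k_on_compose_real[OF _ _ _ C_k_on_inverse]) auto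
    then have "C_k_on k (\<lambda>s. \<sigma> * inverse (y s) ^ 2) UNIV"
      by (intro C_k_on_mult C_k_on_power C_k_on_const open_UNIV)
    then show ?thesis by (simp add: \<kappa>_def[abs_def] divide_inverse power_inverse)
  qed
  obtain m where m: "0 < m" "\<And>s. m \<le> y s"
    using oscillator_lower_bound[OF osc] by auto
  have B: "\<bar>\<kappa> s\<bar> \<le> 1 / m\<^sup>2" for s
  proof -
    have "\<bar>\<kappa> s\<bar> = 1 / (y s)\<^sup>2" using \<sigma> by (auto simp: \<kappa>_def)
    also have "\<dots> \<le> 1 / m\<^sup>2"
      using m(1) m(2)[of s] by (intro divide_left_mono power_mono mult_pos_pos) auto
    finally show ?thesis .
  qed
  obtain g T where g: "g s0 = g0" "T s0 = v0"
    and n: "\<And>s. norm (g s) = 1" "\<And>s. norm (T s) = 1"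
    and dg: "\<And>s. (g has_vector_derivative T s) (at s)"
    and dT: "\<And>s. (T has_vector_derivative \<kappa> s *\<^sub>R cross3 (g s) (T s) - g s) (at s)"
    and dN: "\<And>s. ((\<lambda>s. cross3 (g s) (T s)) has_vector_derivative - \<kappa> s *\<^sub>R T s) (at s)"
    by (rule frenet_global_exists[OF C_k_on_continuous_on[OF C\<kappa>] B assms(3-5), of s0]) blast
  have C: "C_k_on k g UNIV \<and> C_k_on k T UNIV" for k
  proof (induction k)
    case 0
    then show ?case
      using dg dT by (auto intro!: continuous_at_imp_continuous_on has_vector_derivative_continuous)
  next
    case (Suc k)
    have "C_k_on k (\<lambda>s. \<kappa> s *\<^sub>R cross3 (g s) (T s) - g s) UNIV"
      using Suc by (intro C_k_on_diff C_k_on_scaleR C_k_on_cross C\<kappa> open_UNIV) auto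
    then show ?case
      using Suc C_k_on_vderivI[OF open_UNIV dg] C_k_on_vderivI[OF open_UNIV dT] by blast
  qed
  have sp: "speed g s = 1" for s
    using dg[of s] n by (simp add: speed_def vector_derivative_at)
  have arc: "arclength_curve UNIV g"
    using n sp C[of 4] by (simp add: arclength_curve_def image_subset_iff)
  have ut: "unit_tangent g s = T s" for s
    using dg[of s] sp by (simp add: unit_tangent_def arc_deriv_def vector_derivative_at)
  have gT: "g s \<bullet> T s = 0" for s
    using arclength_frenet(3)[OF arc, of s] by (simp add: ut)
  have k: "geodesic_curvature g s = \<kappa> s" for s
  proof -
    have "T s \<noteq> 0" using n(2)[of s] by auto
    then have "geodesic_curvature g s = cross3 (g s) (T s) \<bullet> (\<kappa> s *\<^sub>R cross3 (g s) (T s) - g s) / norm (T s) ^ 3"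
      using geodesic_curvature_eq[OF open_UNIV UNIV_I n(1) dg dT] by blast
    then show ?thesis
      using orthonormal_cross[OF n(1)[of s] n(2)[of s] gT[of s]] n(2)[of s] by (simp add: inner_diff_right)
  qed
  have "critical_curve lam UNIV g"
    by (rule euler_lagrange_imp_critical[OF arc \<sigma>, of y p "\<lambda>s. osc_force lam (y s)"])
      (use o in \<open>auto simp: k \<kappa>_def osc_force_def\<close>)
  then show thesis using that[of g] g by (simp add: ut k \<kappa>_def)
qed

text \<open>Both frames solve the same Frenet system with equal initial data, and the curvature
  bound supplies the Lipschitz constant.\<close>

lemma arclength_curve_determined_by_curvature:
  assumes \<gamma>: "arclength_curve I \<gamma>" and c: "arclength_curve J c" and "I \<subseteq> J" "s0 \<in> I"
    and "c s0 = \<gamma> s0" "unit_tangent c s0 = unit_tangent \<gamma> s0"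
    and \<kappa>: "\<And>s. s \<in> I \<Longrightarrow> geodesic_curvature c s = geodesic_curvature \<gamma> s"
    and B: "\<And>s. s \<in> I \<Longrightarrow> \<bar>geodesic_curvature \<gamma> s\<bar> \<le> B" and "s \<in> I"
  shows "c s = \<gamma> s"
proof -
  let ?F = "\<lambda>c s. (c s, unit_tangent c s, unit_normal c s)"
  have d: "(?F c has_vector_derivative frenet_field (geodesic_curvature c) s (?F c s)) (at s)"
    if "arclength_curve I c" "s \<in> I" for c I s
    unfolding frenet_field_def
    using arclength_frenet(4-6)[OF that(1)] that(2) by (auto intro!: has_vector_derivative_Pair)
  have fe: "frenet_field (geodesic_curvature c) s = frenet_field (geodesic_curvature \<gamma>) s" if "s \<in> I" for s
    using \<kappa>[OF that] by (simp add: frenet_field_def fun_eq_iff)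
  have "?F c s = ?F \<gamma> s"
  proof (rule ode_unique[where x = "?F c" and z = "?F \<gamma>" and F = "frenet_field (geodesic_curvature \<gamma>)" and
        I = I and ?t0.0 = s0 and L = "2 + 2 * B"])
    show "is_interval I" using \<gamma> by (simp add: arclength_curve_def)
    show "(?F c has_vector_derivative frenet_field (geodesic_curvature \<gamma>) t (?F c t)) (at t)" if "t \<in> I" for t
      using d[OF c, of t] that \<open>I \<subseteq> J\<close> fe[OF that] by auto
    show "(?F \<gamma> has_vector_derivative frenet_field (geodesic_curvature \<gamma>) t (?F \<gamma> t)) (at t)" if "t \<in> I" for t
      using d[OF \<gamma> that] .
    show "norm (frenet_field (geodesic_curvature \<gamma>) t (?F c t) - frenet_field (geodesic_curvature \<gamma>) t (?F \<gamma> t))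
        \<le> (2 + 2 * B) * norm (?F c t - ?F \<gamma> t)" if "t \<in> I" for t
      by (rule frenet_field_lipschitz[of "geodesic_curvature \<gamma>" t B, OF B[OF that]])
  qed (use assms in \<open>auto simp: unit_normal_def\<close>)
  then show ?thesis by simp
qed

text \<open>Reversal keeps the acceleration vector and changes the sign of the tangent, hence of the
  normal.\<close>

lemma arclength_curve_reverse:
  assumes \<gamma>: "arclength_curve UNIV \<gamma>"
  shows "arclength_curve UNIV (\<lambda>s. \<gamma> (- s))"
    and "geodesic_curvature (\<lambda>s. \<gamma> (- s)) s = - geodesic_curvature \<gamma> (- s)"
proof -
  note fr = arclength_frenet[OF \<gamma>]
  have m: "((\<lambda>s. - s) has_vector_derivative - 1) (at s)" for s :: real
    unfolding has_real_derivative_iff_has_vector_derivative[symmetric] by (auto intro!: derivative_eq_intros)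
  have d1: "((\<lambda>s. \<gamma> (- s)) has_vector_derivative - unit_tangent \<gamma> (- s)) (at s)" for s
    using vector_diff_chain_at[OF m fr(4)] by (simp add: o_def)
  have d2: "((\<lambda>s. - unit_tangent \<gamma> (- s)) has_vector_derivative
      geodesic_curvature \<gamma> (- s) *\<^sub>R unit_normal \<gamma> (- s) - \<gamma> (- s)) (at s)" for s
    using has_vector_derivative_minus[OF vector_diff_chain_at[OF m fr(5)]] by (simp add: o_def)
  have "C_k_on 4 (\<lambda>s. \<gamma> (- s)) UNIV"
  proof (rule C_k_on_compose_real[OF open_UNIV open_UNIV])
    show "C_k_on 4 (\<lambda>s::real. - s) UNIV"
      by (rule C_k_on_bounded_linear) (auto intro: bounded_linear_minus bounded_linear_ident)
    show "C_k_on 4 \<gamma> UNIV" using \<gamma> by (simp add: arclength_curve_def)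
  qed simp
  then show "arclength_curve UNIV (\<lambda>s. \<gamma> (- s))"
    using fr(1,2) by (simp add: arclength_curve_def speed_def vector_derivative_at[OF d1] image_subset_iff)
  have n: "norm (\<gamma> (- s)) = 1" "norm (unit_tangent \<gamma> (- s)) = 1" for s using fr by auto
  have "unit_tangent \<gamma> (- s) \<noteq> 0" using n(2)[of s] by auto
  then have "geodesic_curvature (\<lambda>s. \<gamma> (- s)) s = cross3 (\<gamma> (- s)) (- unit_tangent \<gamma> (- s)) \<bullet>
      (geodesic_curvature \<gamma> (- s) *\<^sub>R unit_normal \<gamma> (- s) - \<gamma> (- s)) / norm (- unit_tangent \<gamma> (- s)) ^ 3"
    using geodesic_curvature_eq[OF open_UNIV UNIV_I n(1) d1 d2] by simp
  then show "geodesic_curvature (\<lambda>s. \<gamma> (- s)) s = - geodesic_curvature \<gamma> (- s)"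
    using orthonormal_cross[OF fr(1) fr(2) fr(3), of "- s"] n
    by (simp add: unit_normal_def inner_diff_right)
qed

lemma oscillator_reverse:
  assumes "oscillator lam UNIV y p"
  shows "oscillator lam UNIV (\<lambda>s. y (- s)) (\<lambda>s. - p (- s))"
  unfolding oscillator_def
proof (intro ballI conjI)
  note o = oscillatorD[OF assms UNIV_I]
  fix s
  have d: "((\<lambda>t. - t) has_real_derivative - 1) (at s)"
    by (auto intro!: derivative_eq_intros)
  show "0 < y (- s)" by (rule o)
  show "((\<lambda>t. y (- t)) has_real_derivative - p (- s)) (at s)"
    using DERIV_chain2[OF o(2) d] by simp
  show "((\<lambda>t. - p (- t)) has_real_derivative osc_force lam (y (- s))) (at s)"
    using DERIV_minus[OF DERIV_chain2[OF o(3) d]] by simp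
qed

subsection \<open>The model curves\<close>

lemma antiderivative_on_open_interval:
  fixes f :: "real \<Rightarrow> real"
  assumes C: "is_interval C" "open C" "b \<in> C" and f: "continuous_on C f"
  shows "\<exists>F. F b = k \<and> (\<forall>s\<in>C. (F has_real_derivative f s) (at s))"
proof -
  \<comment> \<open>A signed integral from \<open>b\<close> to \<open>s\<close>: at most one of the
    two intervals is nondegenerate, and the other contributes 0.\<close>
  define F where "F s = k + (integral {b..s} f - integral {s..b} f)" for s
  have "(F has_real_derivative f s) (at s)" if s: "s \<in> C" for s
  proof -
    obtain d where d: "d > 0" "cball s d \<subseteq> C" using \<open>open C\<close> s open_contains_cball by blast
    define p where "p = min b (s - d)"
    define q where "q = max b (s + d)"
    have "p \<in> C" "q \<in> C" using d C(3) by (auto simp: p_def q_def min_def max_def dist_real_def subset_iff)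
    then have pq: "{p..q} \<subseteq> C" using C(1) by (meson atLeastAtMost_iff mem_is_interval_1_I subsetI)
    have pbq: "p \<le> b" "b \<le> q" "p < s" "s < q" using d by (auto simp: p_def q_def)
    have cf: "continuous_on {u..v} f" if "p \<le> u" "v \<le> q" for u v
      using that by (intro continuous_on_subset[OF f] order_trans[OF _ pq]) auto
    have F: "F x = k + (integral {p..x} f - integral {p..b} f)" if x: "x \<in> {p..q}" for x
    proof (cases "b \<le> x")
      case True
      have "integral {p..b} f + integral {b..x} f = integral {p..x} f"
        using True pbq x by (intro Henstock_Kurzweil_Integration.integral_combine integrable_continuous_real cf) auto
      moreover have "integral {x..b} f = 0" using True by (cases "x = b") auto
      ultimately show ?thesis by (simp add: F_def)
    next
      case False
      have "integral {p..x} f + integral {x..b} f = integral {p..b} f"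
        using False pbq x by (intro Henstock_Kurzweil_Integration.integral_combine integrable_continuous_real cf) auto
      then show ?thesis using False by (simp add: F_def)
    qed
    have "((\<lambda>x. integral {p..x} f) has_vector_derivative f s) (at s within {p..q})"
      using pbq by (intro integral_has_vector_derivative cf) auto
    then have "((\<lambda>x. integral {p..x} f) has_real_derivative f s) (at s)"
      using pbq at_within_interior[of s "{p..q}"] by (simp add: has_real_derivative_iff_has_vector_derivative)
    then have "((\<lambda>x. k + (integral {p..x} f - integral {p..b} f)) has_real_derivative f s) (at s)"
      by (auto intro!: derivative_eq_intros)
    then show ?thesis
      by (rule has_field_derivative_transform_within_open[of _ _ _ "{p<..<q}"]) (use pbq F in auto)
  qed
  moreover have "F b = k" by (simp add: F_def)
  ultimately show ?thesis by blast
qed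

lemma angle_lift_interval:
  fixes u v \<omega> :: "real \<Rightarrow> real"
  assumes C: "is_interval C" "open C" and \<omega>: "continuous_on C \<omega>"
    and u: "\<And>s. s \<in> C \<Longrightarrow> (u has_real_derivative - \<omega> s * v s) (at s)"
    and v: "\<And>s. s \<in> C \<Longrightarrow> (v has_real_derivative \<omega> s * u s) (at s)"
    and uv: "\<And>s. s \<in> C \<Longrightarrow> (u s)\<^sup>2 + (v s)\<^sup>2 = 1"
  shows "\<exists>\<theta>. \<forall>s\<in>C. (\<theta> has_real_derivative \<omega> s) (at s) \<and> u s = cos (\<theta> s) \<and> v s = sin (\<theta> s)"
proof (cases "C = {}")
  case False
  then obtain b where b: "b \<in> C" by blast
  obtain k where k: "u b = cos k" "v b = sin k"
    using sincos_total_2pi[of "u b" "v b"] uv[OF b] by metis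
  obtain \<theta> where \<theta>: "\<theta> b = k" "\<And>s. s \<in> C \<Longrightarrow> (\<theta> has_real_derivative \<omega> s) (at s)"
    using antiderivative_on_open_interval[OF C b \<omega>, of k] by blast
  \<comment> \<open>The inner product of the unit vectors \<open>(u, v)\<close> and
    \<open>(cos \<theta>, sin \<theta>)\<close>. Both rotate with angular velocity
    \<open>\<omega>\<close>, so it keeps its initial value 1, which forces the vectors to
    coincide.\<close>
  define A where "A s = u s * cos (\<theta> s) + v s * sin (\<theta> s)" for s
  have "\<exists>c. \<forall>s\<in>C. A s = c"
  proof (rule has_field_derivative_zero_constant)
    show "convex C" using C(1) by (rule is_interval_convex)
    fix s assume s: "s \<in> C"
    have "(A has_real_derivative 0) (at s)"
      unfolding A_def[abs_def]
      by (auto intro!: derivative_eq_intros u[OF s] v[OF s] \<theta>(2)[OF s] simp: algebra_simps)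
    then show "(A has_real_derivative 0) (at s within C)" by (rule has_field_derivative_at_within)
  qed
  then obtain c where c: "\<And>s. s \<in> C \<Longrightarrow> A s = c" by blast
  have "A b = 1" using k \<theta>(1) by (simp add: A_def flip: power2_eq_square)
  then have A1: "A s = 1" if "s \<in> C" for s using c b that by metis
  have "u s = cos (\<theta> s) \<and> v s = sin (\<theta> s)" if "s \<in> C" for s
  proof -
    have "(u s - cos (\<theta> s))\<^sup>2 + (v s - sin (\<theta> s))\<^sup>2
        = ((u s)\<^sup>2 + (v s)\<^sup>2) + ((sin (\<theta> s))\<^sup>2 + (cos (\<theta> s))\<^sup>2) - 2 * A s"
      by (simp add: A_def power2_eq_square algebra_simps)
    also have "\<dots> = 0" unfolding uv[OF that] A1[OF that] sin_cos_squared_add by simp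
    finally show ?thesis by (simp add: sum_power2_eq_zero_iff)
  qed
  then show ?thesis using \<theta>(2) by blast
qed simp

text \<open>Each component of \<open>D\<close> gets its own lift with its own constant of
  integration, which is the freedom that \<open>angle_function\<close> allows.\<close>

lemma angle_lift_open:
  fixes u v \<omega> :: "real \<Rightarrow> real"
  assumes D: "open D" and \<omega>: "continuous_on D \<omega>"
    and u: "\<And>s. s \<in> D \<Longrightarrow> (u has_real_derivative - \<omega> s * v s) (at s)"
    and v: "\<And>s. s \<in> D \<Longrightarrow> (v has_real_derivative \<omega> s * u s) (at s)"
    and uv: "\<And>s. s \<in> D \<Longrightarrow> (u s)\<^sup>2 + (v s)\<^sup>2 = 1"
  shows "\<exists>\<theta>. \<forall>s\<in>D. (\<theta> has_real_derivative \<omega> s) (at s) \<and> u s = cos (\<theta> s) \<and> v s = sin (\<theta> s)"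
proof -
  define C where "C s = connected_component_set D s" for s
  have C: "is_interval (C s)" "open (C s)" "C s \<subseteq> D" for s
    using D by (auto simp: C_def is_interval_connected_1 open_connected_component connected_component_subset
        intro: connected_component_in)
  have ex: "\<exists>\<theta>. \<forall>t\<in>C s. (\<theta> has_real_derivative \<omega> t) (at t) \<and> u t = cos (\<theta> t) \<and> v t = sin (\<theta> t)" for s
    using C(3)[of s] by (intro angle_lift_interval C continuous_on_subset[OF \<omega>] u v uv) auto
  \<comment> \<open>The choice is indexed by the component as a set, so all points of one component
    receive the same lift.\<close>
  have "\<exists>\<theta>. (\<exists>s. X = C s) \<longrightarrow> (\<forall>t\<in>X. (\<theta> has_real_derivative \<omega> t) (at t) \<and> u t = cos (\<theta> t) \<and> v t = sin (\<theta> t))" for X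
    using ex by blast
  then obtain \<Theta> where \<Theta>: "\<And>X s t. X = C s \<Longrightarrow> t \<in> X \<Longrightarrow>
      (\<Theta> X has_real_derivative \<omega> t) (at t) \<and> u t = cos (\<Theta> X t) \<and> v t = sin (\<Theta> X t)"
    by metis
  define \<theta> where "\<theta> s = \<Theta> (C s) s" for s
  have "(\<theta> has_real_derivative \<omega> s) (at s) \<and> u s = cos (\<theta> s) \<and> v s = sin (\<theta> s)" if "s \<in> D" for s
  proof -
    have sC: "s \<in> C s" using that by (simp add: C_def)
    have "\<Theta> (C s) t = \<theta> t" if "t \<in> C s" for t
      using that connected_component_eq[of t D s] by (simp add: \<theta>_def C_def)
    then have "(\<theta> has_real_derivative \<omega> s) (at s)"
      using \<Theta>[OF refl sC] C(2) sC by (auto intro: has_field_derivative_transform_within_open)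
    then show ?thesis using \<Theta>[OF refl sC] by (simp add: \<theta>_def)
  qed
  then show ?thesis by blast
qed

text \<open>The last hypothesis is the angular momentum identity: \<open>\<omega>\<close> is the
  angular velocity of the plane curve \<open>(f, g)\<close>, and normalization to the unit circle
  leaves only the rotation.\<close>

lemma polar_unit_deriv:
  fixes X' Y' \<omega> :: real and f g :: "real \<Rightarrow> real"
  assumes f: "(f has_real_derivative X') (at s)" and g: "(g has_real_derivative Y') (at s)"
    and pos: "(f s)\<^sup>2 + (g s)\<^sup>2 > 0" and \<omega>: "f s * Y' - g s * X' = \<omega> * ((f s)\<^sup>2 + (g s)\<^sup>2)"
  shows "((\<lambda>s. f s / sqrt ((f s)\<^sup>2 + (g s)\<^sup>2)) has_real_derivative - \<omega> * (g s / sqrt ((f s)\<^sup>2 + (g s)\<^sup>2))) (at s)"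
    and "((\<lambda>s. g s / sqrt ((f s)\<^sup>2 + (g s)\<^sup>2)) has_real_derivative \<omega> * (f s / sqrt ((f s)\<^sup>2 + (g s)\<^sup>2))) (at s)"
proof -
  define r where "r = sqrt ((f s)\<^sup>2 + (g s)\<^sup>2)"
  have r: "r > 0" "r * r = (f s)\<^sup>2 + (g s)\<^sup>2" using pos by (simp_all add: r_def)
  have dr: "((\<lambda>s. sqrt ((f s)\<^sup>2 + (g s)\<^sup>2)) has_real_derivative (f s * X' + g s * Y') / r) (at s)"
    by (rule DERIV_cong[OF DERIV_chain2[OF DERIV_real_sqrt[OF pos] DERIV_add[OF DERIV_power[OF f, of 2] DERIV_power[OF g, of 2]]]])
      (use r(1) in \<open>simp add: r_def[symmetric] divide_simps\<close>)
  have rn: "r \<noteq> 0" using r by simp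
  note q = r_def[symmetric]
  have W: "f s * Y' - g s * X' = \<omega> * (r * r)" using \<omega> r by simp
  have 1: "(X' * r - f s * ((f s * X' + g s * Y') / r)) / (r * r) = - \<omega> * (g s / r)"
  proof -
    have *: "X' * (r * r) - f s * (f s * X' + g s * Y') = - \<omega> * g s * (r * r)"
      using W r(2) by algebra
    have "(X' * r - f s * ((f s * X' + g s * Y') / r)) / (r * r)
        = (X' * (r * r) - f s * (f s * X' + g s * Y')) / (r * (r * r))"
      using rn by (simp add: field_simps)
    then show ?thesis unfolding * using rn by simp
  qed
  have 2: "(Y' * r - g s * ((f s * X' + g s * Y') / r)) / (r * r) = \<omega> * (f s / r)"
  proof -
    have *: "Y' * (r * r) - g s * (f s * X' + g s * Y') = \<omega> * f s * (r * r)"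
      using W r(2) by algebra
    have "(Y' * r - g s * ((f s * X' + g s * Y') / r)) / (r * r)
        = (Y' * (r * r) - g s * (f s * X' + g s * Y')) / (r * (r * r))"
      using rn by (simp add: field_simps)
    then show ?thesis unfolding * using rn by simp
  qed
  show "((\<lambda>s. f s / sqrt ((f s)\<^sup>2 + (g s)\<^sup>2)) has_real_derivative - \<omega> * (g s / sqrt ((f s)\<^sup>2 + (g s)\<^sup>2))) (at s)"
    using DERIV_divide[OF f dr] rn unfolding q 1 by blast
  show "((\<lambda>s. g s / sqrt ((f s)\<^sup>2 + (g s)\<^sup>2)) has_real_derivative \<omega> * (f s / sqrt ((f s)\<^sup>2 + (g s)\<^sup>2))) (at s)"
    using DERIV_divide[OF g dr] rn unfolding q 2 by blast
qed

section \<open>The conserved momentum and the normal form of the curve\<close>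

text \<open>In the derivative of \<open>J\<close> the component along \<open>c\<close> cancels, the
  one along the normal cancels because the curvature is \<open>1 / y^2\<close>, and the tangential
  one is the oscillator equation.\<close>

lemma momentum_constant:
  assumes c: "arclength_curve UNIV c" and osc: "oscillator lam UNIV y p"
    and \<kappa>: "\<And>s. geodesic_curvature c s = 1 / (y s)\<^sup>2"
  obtains J where "\<And>s. c s \<bullet> J = y s" "\<And>s. unit_normal c s \<bullet> J = 1 / y s + 2 * lam"
    "\<And>s. J \<bullet> J = osc_energy lam (y s) (p s)"
proof -
  note fr = arclength_frenet(1-6)[OF c UNIV_I] and o = oscillatorD[OF osc UNIV_I]
  note on = orthonormal_cross[OF fr(1) fr(2) fr(3), folded unit_normal_def]
  define J where "J s = y s *\<^sub>R c s + p s *\<^sub>R unit_tangent c s + (1 / y s + 2 * lam) *\<^sub>R unit_normal c s" for s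
  have dJ: "(J has_vector_derivative 0) (at s)" for s
  proof -
    have yn: "y s \<noteq> 0" using o(1)[of s] by simp
    have d\<mu>: "((\<lambda>s. 1 / y s + 2 * lam) has_real_derivative - p s / (y s)\<^sup>2) (at s)"
      using DERIV_add[OF DERIV_divide[OF DERIV_const[of 1] o(2) yn] DERIV_const[of "2 * lam"]]
      by (simp add: power2_eq_square)
    have "(J has_vector_derivative
        (y s *\<^sub>R unit_tangent c s + p s *\<^sub>R c s)
        + (p s *\<^sub>R (geodesic_curvature c s *\<^sub>R unit_normal c s - c s) + osc_force lam (y s) *\<^sub>R unit_tangent c s)
        + ((1 / y s + 2 * lam) *\<^sub>R (- geodesic_curvature c s *\<^sub>R unit_tangent c s) + (- p s / (y s)\<^sup>2) *\<^sub>R unit_normal c s)) (at s)"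
      unfolding J_def[abs_def]
      by (intro has_vector_derivative_add has_vector_derivative_scaleR fr o d\<mu>)
    moreover have "(y s *\<^sub>R unit_tangent c s + p s *\<^sub>R c s)
        + (p s *\<^sub>R (geodesic_curvature c s *\<^sub>R unit_normal c s - c s) + osc_force lam (y s) *\<^sub>R unit_tangent c s)
        + ((1 / y s + 2 * lam) *\<^sub>R (- geodesic_curvature c s *\<^sub>R unit_tangent c s) + (- p s / (y s)\<^sup>2) *\<^sub>R unit_normal c s)
      = (y s + osc_force lam (y s) - (1 / y s + 2 * lam) / (y s)\<^sup>2) *\<^sub>R unit_tangent c s"
      by (simp add: \<kappa> algebra_simps add_divide_distrib)
    moreover have "y s + osc_force lam (y s) - (1 / y s + 2 * lam) / (y s)\<^sup>2 = 0"
      using yn by (simp add: osc_force_def field_simps power2_eq_square power3_eq_cube)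
    ultimately show ?thesis by simp
  qed
  have J: "J s = J 0" for s
    using has_vector_derivative_zero_constant[of UNIV J] dJ
    by (metis UNIV_I convex_UNIV has_vector_derivative_at_within)
  show thesis
  proof (rule that[of "J 0"])
    fix s
    have e: "c s \<bullet> c s = 1" "unit_tangent c s \<bullet> unit_tangent c s = 1"
      using fr(1,2)[of s] by (simp_all add: norm_eq_1)
    note e = e fr(3)[of s] on[of s]
    show "c s \<bullet> J 0 = y s" unfolding J[of s, symmetric]
      using e by (simp add: J_def inner_add_right inner_commute)
    show "unit_normal c s \<bullet> J 0 = 1 / y s + 2 * lam" unfolding J[of s, symmetric]
      using e by (simp add: J_def inner_add_right inner_commute)
    show "J 0 \<bullet> J 0 = osc_energy lam (y s) (p s)" unfolding J[of s, symmetric]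
      using e by (simp add: J_def inner_add_right inner_add_left inner_commute osc_energy_def power2_eq_square)
  qed
qed

lemma model_curve:
  assumes c: "arclength_curve UNIV c" and osc: "oscillator lam UNIV y p"
    and \<kappa>: "\<And>s. geodesic_curvature c s = 1 / (y s)\<^sup>2"
  defines "\<mu> \<equiv> \<lambda>s. sqrt (geodesic_curvature c s)"
  shows "\<exists>\<xi> \<theta> R. \<xi> > 0 \<and> rotation_matrix (R :: real^3^3) \<and> solves_mu_ode lam \<xi> \<mu> \<and>
      angle_function lam \<xi> \<mu> \<theta> \<and> (\<forall>s. R *v c s = gamma_xi \<xi> \<mu> \<theta> s)"
proof -
  note fr = arclength_frenet(1-6)[OF c UNIV_I] and o = oscillatorD[OF osc UNIV_I]
  have \<mu>: "\<mu> = (\<lambda>s. 1 / y s)"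
    using less_imp_le[OF o(1)] by (auto simp: \<mu>_def \<kappa> real_sqrt_divide)
  obtain J where J: "\<And>s. c s \<bullet> J = y s" "\<And>s. unit_normal c s \<bullet> J = 1 / y s + 2 * lam"
    "\<And>s. J \<bullet> J = osc_energy lam (y s) (p s)"
    using momentum_constant[OF c osc \<kappa>] by blast
  define \<xi> where "\<xi> = norm J / 2"
  have "J \<noteq> 0" using J(1)[of 0] o(1)[of 0] by auto
  then have \<xi>: "\<xi> > 0" by (simp add: \<xi>_def)
  have \<xi>2: "4 * \<xi>\<^sup>2 = osc_energy lam (y s) (p s)" for s
    using J(3)[of s] by (simp add: \<xi>_def power_divide power2_norm_eq_inner)
  have ode: "solves_mu_ode lam \<xi> \<mu>"
    unfolding solves_mu_ode_def
  proof (intro allI conjI)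
    fix s
    have yn: "y s \<noteq> 0" using o(1)[of s] by simp
    have d: "(\<mu> has_real_derivative - p s / (y s)\<^sup>2) (at s)"
      using DERIV_divide[OF DERIV_const[of 1] o(2) yn] by (simp add: \<mu> power2_eq_square)
    then show "\<mu> differentiable at s" using real_differentiable_def by blast
    define u where "u = 1 / y s"
    have u: "y s * u = 1" using yn by (simp add: u_def)
    have e: "4 * \<xi>\<^sup>2 = (p s)\<^sup>2 + (y s)\<^sup>2 + (u + 2 * lam)\<^sup>2"
      using \<xi>2[of s] by (simp add: osc_energy_def u_def)
    have "(deriv \<mu> s)\<^sup>2 = (- p s * u\<^sup>2)\<^sup>2"
      using DERIV_imp_deriv[OF d] by (simp add: u_def power_divide)
    \<comment> \<open>Solving the energy identity for \<open>p^2\<close> and using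
      \<open>y * u = 1\<close> turns \<open>p^2 * u^4\<close> into the polynomial in
      \<open>u\<close>.\<close>
    also have "\<dots> = - u\<^sup>2 * (u ^ 4 + 4 * lam * u ^ 3 + 4 * (lam\<^sup>2 - \<xi>\<^sup>2) * u\<^sup>2 + 1)"
      using u e by algebra
    finally show "(deriv \<mu> s)\<^sup>2 = - (\<mu> s)\<^sup>2 * (\<mu> s ^ 4 + 4 * lam * \<mu> s ^ 3 + 4 * (lam\<^sup>2 - \<xi>\<^sup>2) * (\<mu> s)\<^sup>2 + 1)"
      by (simp add: \<mu> u_def)
  qed
  \<comment> \<open>\<open>A\<close> takes the first axis to the direction of \<open>J\<close>, so
    its transpose \<open>R\<close> makes \<open>J\<close> point along the first axis.\<close>
  obtain A :: "real^3^3" where A: "rotation_matrix A" "A *v axis 1 1 = J /\<^sub>R norm J"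
    using rotation_matrix_exists_basis[of "J /\<^sub>R norm J" 1] \<open>J \<noteq> 0\<close> by auto
  define R where "R = transpose A"
  have R: "rotation_matrix R"
    using A(1) by (simp add: R_def rotation_matrix_def det_transpose orthogonal_matrix_transpose)
  have oR: "orthogonal_transformation ((*v) R)"
    using R by (simp add: rotation_matrix_def orthogonal_transformation_matrix matrix_vector_mul_linear)
  have R1: "(R *v w) $ 1 = w \<bullet> J / (2 * \<xi>)" for w
  proof -
    have "(R *v w) $ 1 = (R *v w) \<bullet> axis 1 1" by (simp add: inner_axis)
    also have "\<dots> = w \<bullet> (A *v axis 1 1)"
    proof -
      have "R *v w = w v* A" by (simp add: R_def)
      then show ?thesis by (simp only: dot_lmul_matrix)
    qed
    also have "\<dots> = w \<bullet> J / norm J"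
      unfolding A(2) inner_scaleR_right divide_inverse by (rule mult.commute)
    finally show ?thesis by (simp add: \<xi>_def)
  qed
  \<comment> \<open>The minus sign matches the second coordinate
    \<open>- sqrt (...) * cos \<theta>\<close> of the model curve.\<close>
  define f where "f s = - (R *v c s) $ 2" for s
  define g where "g s = (R *v c s) $ 3" for s
  define f' where "f' s = - (R *v unit_tangent c s) $ 2" for s
  define g' where "g' s = (R *v unit_tangent c s) $ 3" for s
  have comp: "((\<lambda>s. (R *v c s) $ i) has_real_derivative (R *v unit_tangent c s) $ i) (at s)" for i s
  proof -
    have "bounded_linear (\<lambda>w::real^3. (R *v w) $ i)"
      by (intro bounded_linear_compose[OF bounded_linear_vec_nth] matrix_vector_mul_bounded_linear)
    from bounded_linear.has_vector_derivative[OF this fr(4)]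
    show ?thesis by (simp add: has_real_derivative_iff_has_vector_derivative)
  qed
  have df: "(f has_real_derivative f' s) (at s)" and dg: "(g has_real_derivative g' s) (at s)" for s
    unfolding f_def[abs_def] f'_def g_def[abs_def] g'_def by (intro DERIV_minus comp)+
  define \<omega> where "\<omega> s = 2 * \<xi> * ((\<mu> s)\<^sup>2 * (\<mu> s + 2 * lam) / (1 - 4 * \<xi>\<^sup>2 * (\<mu> s)\<^sup>2))" for s
  have fg: "(f s)\<^sup>2 + (g s)\<^sup>2 = 1 - (y s)\<^sup>2 / (4 * \<xi>\<^sup>2)" for s
  proof -
    have "(R *v c s) \<bullet> (R *v c s) = 1"
      using oR fr(1)[of s] by (simp add: orthogonal_transformation_def norm_eq_1)
    then have "((R *v c s) $ 1)\<^sup>2 + (f s)\<^sup>2 + (g s)\<^sup>2 = 1"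
      by (simp add: inner_vec_def sum_3 f_def g_def power2_eq_square)
    then show ?thesis by (simp add: R1 J(1) power_divide power_mult_distrib)
  qed
  \<comment> \<open>The angular momentum about the first axis is the first coordinate of the rotated
    normal, which the momentum identity gives; \<open>f\<close> reverses its sign.\<close>
  have wr: "f s * g' s - g s * f' s = - (1 / y s + 2 * lam) / (2 * \<xi>)" for s
  proof -
    have "cross3 (R *v c s) (R *v unit_tangent c s) = R *v unit_normal c s"
      by (simp add: cross_rotation_matrix[OF R] unit_normal_def)
    then have "(R *v c s) $ 2 * g' s - g s * (R *v unit_tangent c s) $ 2 = (1 / y s + 2 * lam) / (2 * \<xi>)"
      using R1[of "unit_normal c s"] J(2)[of s] cross_components(1)[of "R *v c s" "R *v unit_tangent c s"]
      by (simp add: g_def g'_def)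
    moreover have "f s * g' s - g s * f' s = - ((R *v c s) $ 2 * g' s - g s * (R *v unit_tangent c s) $ 2)"
      by (simp add: f_def f'_def)
    ultimately show ?thesis by (simp only: minus_divide_left)
  qed
  \<comment> \<open>The times at which the curve is off the axis of \<open>J\<close>: the excluded
    equation means \<open>y s = 2 * \<xi>\<close>, so that the rotated point is the pole.\<close>
  define D where "D = {s. 1 - 4 * \<xi>\<^sup>2 * (\<mu> s)\<^sup>2 \<noteq> 0}"
  have cy: "continuous_on S y" for S
    using DERIV_isCont[OF o(2)] by (auto intro: continuous_at_imp_continuous_on)
  have yn: "y s \<noteq> 0" for s using o(1)[of s] by simp
  have c\<mu>: "continuous_on S \<mu>" for S
    unfolding \<mu> by (intro continuous_intros cy) (simp add: yn)
  have oD: "open D"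
    unfolding D_def by (intro open_Collect_neq continuous_intros c\<mu>)
  have c\<omega>: "continuous_on D \<omega>"
    unfolding \<omega>_def[abs_def] by (intro continuous_intros c\<mu>) (simp add: D_def)
  have r: "(f s)\<^sup>2 + (g s)\<^sup>2 = (4 * \<xi>\<^sup>2 * (\<mu> s)\<^sup>2 - 1) / (2 * \<xi> * \<mu> s)\<^sup>2" for s
    unfolding fg \<mu> using \<xi> yn[of s] by (simp add: field_simps power2_eq_square)
  have pos: "(f s)\<^sup>2 + (g s)\<^sup>2 > 0" if "s \<in> D" for s
  proof -
    have "(f s)\<^sup>2 + (g s)\<^sup>2 \<noteq> 0"
      unfolding r using that \<xi> yn[of s] by (auto simp: D_def \<mu>)
    moreover have "(f s)\<^sup>2 + (g s)\<^sup>2 \<ge> 0" by simp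
    ultimately show ?thesis by linarith
  qed
  have w: "f s * g' s - g s * f' s = \<omega> s * ((f s)\<^sup>2 + (g s)\<^sup>2)" if "s \<in> D" for s
  proof -
    have n: "1 - 4 * \<xi>\<^sup>2 * (\<mu> s)\<^sup>2 \<noteq> 0" using that by (simp add: D_def)
    have m0: "\<mu> s \<noteq> 0" using yn[of s] by (simp add: \<mu>)
    define E where "E = 1 - 4 * \<xi>\<^sup>2 * (\<mu> s)\<^sup>2"
    have "\<omega> s * ((f s)\<^sup>2 + (g s)\<^sup>2) = 2 * \<xi> * ((\<mu> s)\<^sup>2 * (\<mu> s + 2 * lam) / E) * (- E / (2 * \<xi> * \<mu> s)\<^sup>2)"
      unfolding r by (simp add: \<omega>_def E_def)
    also have "\<dots> = - (\<mu> s + 2 * lam) / (2 * \<xi>)"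
      using n[folded E_def] m0 \<xi> by (simp add: field_simps power2_eq_square)
    finally show ?thesis by (simp add: wr \<mu>)
  qed
  obtain \<theta> where \<theta>: "\<And>s. s \<in> D \<Longrightarrow> (\<theta> has_real_derivative \<omega> s) (at s)"
     "\<And>s. s \<in> D \<Longrightarrow> f s / sqrt ((f s)\<^sup>2 + (g s)\<^sup>2) = cos (\<theta> s)" "\<And>s. s \<in> D \<Longrightarrow> g s / sqrt ((f s)\<^sup>2 + (g s)\<^sup>2) = sin (\<theta> s)"
  proof -
    have "(f s / sqrt ((f s)\<^sup>2 + (g s)\<^sup>2))\<^sup>2 + (g s / sqrt ((f s)\<^sup>2 + (g s)\<^sup>2))\<^sup>2 = 1" if "s \<in> D" for s
      using pos[OF that] by (auto simp: power_divide add_divide_distrib[symmetric])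
    from angle_lift_open[OF oD c\<omega> polar_unit_deriv[OF df dg pos w] this]
    show thesis using that by blast
  qed
  have "angle_function lam \<xi> \<mu> \<theta>"
    unfolding angle_function_def using \<theta>(1) by (auto simp: D_def \<omega>_def)
  moreover have "R *v c s = gamma_xi \<xi> \<mu> \<theta> s" for s
  proof -
    have rr: "sqrt ((f s)\<^sup>2 + (g s)\<^sup>2) = sqrt (4 * \<xi>\<^sup>2 * (\<mu> s)\<^sup>2 - 1) / (2 * \<xi> * \<mu> s)"
      unfolding r using \<xi> o(1)[of s] by (simp add: real_sqrt_divide \<mu>)
    have "f s = sqrt ((f s)\<^sup>2 + (g s)\<^sup>2) * cos (\<theta> s) \<and> g s = sqrt ((f s)\<^sup>2 + (g s)\<^sup>2) * sin (\<theta> s)"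
    proof (cases "s \<in> D")
      case True
      then show ?thesis using \<theta>(2,3)[OF True, symmetric] pos[OF True] by simp
    next
      \<comment> \<open>At the pole the radius is 0, so the formula holds for any value of the
        angle.\<close>
      case False
      then have "(f s)\<^sup>2 + (g s)\<^sup>2 = 0" unfolding r by (simp add: D_def)
      then show ?thesis by (simp add: sum_power2_eq_zero_iff)
    qed
    then have "(R *v c s) $ 2 = - (sqrt (4 * \<xi>\<^sup>2 * (\<mu> s)\<^sup>2 - 1) / (2 * \<xi> * \<mu> s) * cos (\<theta> s))"
      "(R *v c s) $ 3 = sqrt (4 * \<xi>\<^sup>2 * (\<mu> s)\<^sup>2 - 1) / (2 * \<xi> * \<mu> s) * sin (\<theta> s)"
      unfolding rr by (simp_all add: f_def g_def)
    moreover have "(R *v c s) $ 1 = 1 / (2 * \<xi> * \<mu> s)"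
      by (simp add: R1 J(1) \<mu>)
    ultimately show ?thesis
      by (simp add: gamma_xi_def vec_eq_iff forall_3)
  qed
  ultimately show ?thesis using \<xi> R ode by blast
qed

subsection \<open>Maximal critical curves\<close>

text \<open>Where \<open>\<sigma> * \<kappa>\<close> is positive, \<open>y\<close> is
  \<open>C^2\<close> as a smooth function of the curvature, which is enough to apply the
  Euler-Lagrange equation pointwise.\<close>

lemma critical_oscillator_near:
  assumes crit: "critical_curve lam I \<gamma>" and \<sigma>: "\<sigma> = 1 \<or> \<sigma> = -1"
  defines "S \<equiv> {s \<in> I. 0 < \<sigma> * geodesic_curvature \<gamma> s}"
    and "y \<equiv> \<lambda>s. inverse (sqrt (\<sigma> * geodesic_curvature \<gamma> s))"
  shows "open S" and "\<exists>p. oscillator lam S y p"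
    and "\<And>s. s \<in> S \<Longrightarrow> geodesic_curvature \<gamma> s = \<sigma> / (y s)\<^sup>2"
proof -
  let ?\<kappa> = "geodesic_curvature \<gamma>"
  have \<gamma>: "arclength_curve I \<gamma>" using crit by (simp add: critical_curve_def)
  have I: "open I" using \<gamma> by (simp add: arclength_curve_def)
  note C2 = arclength_frenet(8)[OF \<gamma>]
  have "S = I \<inter> (\<lambda>s. \<sigma> * ?\<kappa> s) -` {0<..}" by (auto simp: S_def)
  then show S: "open S"
    using C_k_on_continuous_on[OF C2] I
    by (auto intro!: continuous_open_preimage continuous_intros)
  have \<sigma>\<sigma>: "\<sigma> * \<sigma> = 1" using \<sigma> by auto
  have y0: "0 < y s" if "s \<in> S" for s using that by (simp add: S_def y_def)
  show \<kappa>: "?\<kappa> s = \<sigma> / (y s)\<^sup>2" if "s \<in> S" for s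
  proof -
    have "\<sigma> / (y s)\<^sup>2 = \<sigma> * (\<sigma> * ?\<kappa> s)"
      using that by (simp add: S_def y_def power_inverse divide_inverse)
    also have "\<dots> = ?\<kappa> s" using \<sigma>\<sigma> by (metis mult.assoc mult_1)
    finally show ?thesis by simp
  qed
  have CS: "C_k_on 2 (\<lambda>s. \<sigma> * ?\<kappa> s) S"
    using C_k_on_subset[OF C2, of S] by (intro C_k_on_mult C_k_on_const S) (auto simp: S_def)
  have "C_k_on 2 (\<lambda>s. sqrt (\<sigma> * ?\<kappa> s)) S"
    by (rule C_k_on_compose_real[OF S open_greaterThan _ C_k_on_sqrt CS]) (auto simp: S_def)
  then have Cy: "C_k_on 2 y S"
    unfolding y_def by (rule C_k_on_compose_real[OF S open_greaterThan _ C_k_on_inverse, rotated]) (auto simp: S_def)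
  define p where "p s = vector_derivative y (at s)" for s
  define q where "q s = vector_derivative p (at s)" for s
  have Cy': "C_k_on (Suc 1) y S" using Cy by (simp add: numeral_2_eq_2)
  have Cp: "C_k_on (Suc 0) p S" unfolding p_def[abs_def] using C_k_on_vderivD(2)[OF S Cy'] by simp
  have Cq: "continuous_on S q" unfolding q_def[abs_def] using C_k_on_vderivD(2)[OF S Cp] by simp
  have dy: "(y has_real_derivative p s) (at s)" if "s \<in> S" for s
    using C_k_on_vderivD(1)[OF S Cy' that] by (simp add: p_def has_real_derivative_iff_has_vector_derivative)
  have dp: "(p has_real_derivative q s) (at s)" if "s \<in> S" for s
    using C_k_on_vderivD(1)[OF S Cp that] by (simp add: q_def has_real_derivative_iff_has_vector_derivative)
  have "q s = osc_force lam (y s)" if "s \<in> S" for s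
    using critical_imp_euler_lagrange[OF crit S _ \<sigma> y0 \<kappa> dy dp Cq that] by (auto simp: S_def osc_force_def)
  then have "oscillator lam S y p"
    using y0 dy dp by (auto simp: oscillator_def)
  then show "\<exists>p. oscillator lam S y p" by blast
qed

lemma oscillator_subset: "oscillator lam I y p \<Longrightarrow> J \<subseteq> I \<Longrightarrow> oscillator lam J y p"
  by (auto simp: oscillator_def)

text \<open>
  Conservation of energy bounds the curvature away from zero on a component of the set of
  non-inflection points, so that this component has no end point in \<open>I\<close>.
\<close>

lemma critical_oscillator:
  assumes crit: "critical_curve lam I \<gamma>" and s0: "s0 \<in> I" "geodesic_curvature \<gamma> s0 \<noteq> 0"
  obtains \<sigma> y p where "\<sigma> = 1 \<or> \<sigma> = -1" "oscillator lam I y p"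
    "\<And>s. s \<in> I \<Longrightarrow> geodesic_curvature \<gamma> s = \<sigma> / (y s)\<^sup>2"
proof -
  let ?\<kappa> = "geodesic_curvature \<gamma>"
  have \<gamma>: "arclength_curve I \<gamma>" using crit by (simp add: critical_curve_def)
  have I: "open I" "is_interval I" using \<gamma> by (simp_all add: arclength_curve_def)
  have c\<kappa>: "continuous_on I ?\<kappa>" using C_k_on_continuous_on[OF arclength_frenet(8)[OF \<gamma>]] .
  define \<sigma> where "\<sigma> = sgn (?\<kappa> s0)"
  have \<sigma>: "\<sigma> = 1 \<or> \<sigma> = -1" using s0(2) by (auto simp: \<sigma>_def sgn_real_def)
  define S where "S = {s \<in> I. 0 < \<sigma> * ?\<kappa> s}"
  define y where "y s = inverse (sqrt (\<sigma> * ?\<kappa> s))" for s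
  note near = critical_oscillator_near[OF crit \<sigma>, folded S_def y_def]
  obtain p where osc: "oscillator lam S y p" using near(2) by blast
  have s0S: "s0 \<in> S" using s0 by (auto simp: S_def \<sigma>_def sgn_real_def)
  define C where "C = connected_component_set S s0"
  have C: "is_interval C" "open C" "C \<subseteq> S" "s0 \<in> C" "connected C"
    using near(1) s0S by (auto simp: C_def is_interval_connected_1 open_connected_component connected_component_subset
        intro: connected_component_in)
  have CI: "C \<subseteq> I" using C(3) by (auto simp: S_def)
  have oC: "oscillator lam C y p" using oscillator_subset[OF osc C(3)] .
  define h where "h = osc_energy lam (y s0) (p s0)"
  have yh: "y s \<le> sqrt h" "0 < sqrt h" "0 < y s" if "s \<in> C" for s
  proof -
    have "osc_energy lam (y s) (p s) = h" unfolding h_def by (rule osc_energy_constant[OF oC C(1) that C(4)])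
    then show "y s \<le> sqrt h" "0 < sqrt h" using osc_energy_bounds(1,4) oscillatorD(1)[OF oC that] by blast+
    show "0 < y s" by (rule oscillatorD(1)[OF oC that])
  qed
  have h: "h > 0" using yh(2)[OF C(4)] by simp
  \<comment> \<open>The uniform form of \<open>y \<le> sqrt h\<close>; as a non-strict inequality it
    passes to limit points of \<open>C\<close> in \<open>I\<close>, and it excludes zero curvature
    there.\<close>
  have \<kappa>h: "1 / h \<le> \<sigma> * ?\<kappa> s" if "s \<in> C" for s
  proof -
    have "\<sigma> * ?\<kappa> s = 1 / (y s)\<^sup>2" using near(3)[of s] that C(3) \<sigma> by auto
    moreover have "(y s)\<^sup>2 \<le> h" using yh[OF that] h by (metis less_imp_le power_mono real_sqrt_pow2)
    ultimately show ?thesis using yh(3)[OF that] h by (simp add: divide_left_mono)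
  qed
  \<comment> \<open>A limit point in \<open>I\<close> still has
    \<open>\<sigma> * \<kappa> > 0\<close>, so adjoining it to \<open>C\<close> gives a connected
    subset of \<open>S\<close>; by maximality of the component it already lies in \<open>C\<close>.
    Connectedness of \<open>I\<close> then gives \<open>C = I\<close>.\<close>
  have "closedin (top_of_set I) C"
    unfolding closedin_closed_eq
  proof -
    have "x \<in> C" if x: "x \<in> I" "x \<in> closure C" for x
    proof -
      have "connected (insert x C)"
        by (rule connected_intermediate_closure[OF C(5)]) (use x closure_subset[of C] in auto)
      have "1 / h \<le> \<sigma> * ?\<kappa> x"
      proof -
        have "closedin (top_of_set I) (I \<inter> (\<lambda>s. \<sigma> * ?\<kappa> s) -` {1 / h..})"
          by (intro continuous_closedin_preimage continuous_intros c\<kappa>)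
        then obtain K where K: "closed K" "I \<inter> (\<lambda>s. \<sigma> * ?\<kappa> s) -` {1 / h..} = I \<inter> K"
          by (auto simp: closedin_closed)
        have "C \<subseteq> K" using \<kappa>h CI K(2) by auto
        then have "closure C \<subseteq> K" using K(1) closure_minimal by blast
        then show ?thesis using x K(2) by auto
      qed
      moreover have "0 < 1 / h" using h by simp
      ultimately have "0 < \<sigma> * ?\<kappa> x" by linarith
      then have "x \<in> S" using x by (simp add: S_def)
      then have "insert x C \<subseteq> C"
        unfolding C_def using C(3,4) \<open>connected (insert x C)\<close>
        by (intro connected_component_maximal) (auto simp: C_def)
      then show "x \<in> C" by blast
    qed
    then have "C = I \<inter> closure C" using CI closure_subset[of C] by blast
    then show "closedin (top_of_set I) C" by (metis closed_closure closedin_closed_Int)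
  qed
  moreover have "openin (top_of_set I) C" using C(2) CI by (simp add: open_subset)
  ultimately have "C = I"
    using I(2) C(4) connected_clopen[of I] by (metis empty_iff is_interval_connected)
  then show thesis
    using that[OF \<sigma> oC[unfolded \<open>C = I\<close>]] near(3) C(3) by blast
qed

lemma oscillator_imp_B_curve:
  assumes c: "arclength_curve UNIV c" and osc: "oscillator lam UNIV y p"
    and \<kappa>: "\<And>s. geodesic_curvature c s = 1 / (y s)\<^sup>2"
    and "\<not> geodesic_curvature c constant_on UNIV"
  shows "B_curve lam c"
proof -
  note o = oscillatorD[OF osc UNIV_I]
  have "critical_curve lam UNIV c"
    by (rule euler_lagrange_imp_critical[OF c, of 1 y p "\<lambda>s. osc_force lam (y s)"])
      (use o in \<open>auto simp: \<kappa> osc_force_def\<close>)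
  moreover have "geodesic_curvature c s > 0" for s using o(1)[of s] by (simp add: \<kappa>)
  moreover have "\<exists>p>0. \<forall>s. geodesic_curvature c (s + p) = geodesic_curvature c s"
    using oscillator_periodic[OF osc] by (auto simp: \<kappa>)
  ultimately show ?thesis using assms(4) by (simp add: B_curve_def)
qed

theorem theorem1p1:
  fixes lam :: real and I :: "real set" and \<gamma> :: "real \<Rightarrow> real^3"
  assumes "maximal_critical_curve lam I \<gamma>"
    and "\<not> geodesic_curvature \<gamma> constant_on I"
  shows "I = UNIV \<and>
    (\<exists>c. (c = \<gamma> \<or> c = (\<lambda>s. \<gamma> (- s))) \<and>
      B_curve lam c \<and>
      (\<exists>\<xi> \<theta> R. \<xi> > 0 \<and> rotation_matrix (R :: real^3^3) \<and>
        solves_mu_ode lam \<xi> (\<lambda>s. sqrt (geodesic_curvature c s)) \<and>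
        angle_function lam \<xi> (\<lambda>s. sqrt (geodesic_curvature c s)) \<theta> \<and>
        (\<forall>s. R *v c s = gamma_xi \<xi> (\<lambda>s. sqrt (geodesic_curvature c s)) \<theta> s)))"
proof -
  have crit: "critical_curve lam I \<gamma>"
    and max: "\<And>J c. critical_curve lam J c \<Longrightarrow> I \<subseteq> J \<Longrightarrow> (\<And>s. s \<in> I \<Longrightarrow> c s = \<gamma> s) \<Longrightarrow> J = I"
    using assms(1) unfolding maximal_critical_curve_def by blast+
  have \<gamma>: "arclength_curve I \<gamma>" using crit by (simp add: critical_curve_def)
  have I: "is_interval I" using \<gamma> by (simp add: arclength_curve_def)
  \<comment> \<open>Curvature vanishing everywhere on \<open>I\<close> would be constant.\<close>
  obtain s0 where s0: "s0 \<in> I" "geodesic_curvature \<gamma> s0 \<noteq> 0"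
    using assms(2) by (auto simp: constant_on_def)
  obtain \<sigma> y p where \<sigma>: "\<sigma> = 1 \<or> \<sigma> = -1" and osc: "oscillator lam I y p"
    and \<kappa>: "\<And>s. s \<in> I \<Longrightarrow> geodesic_curvature \<gamma> s = \<sigma> / (y s)\<^sup>2"
    using critical_oscillator[OF crit s0] by metis
  \<comment> \<open>The oscillator is continued to the whole line from the data at
    \<open>s0\<close>; its curvature and the frame of \<open>\<gamma>\<close> at \<open>s0\<close>
    then determine a global curve.\<close>
  obtain z q where zq: "oscillator lam UNIV z q" "z s0 = y s0" "q s0 = p s0"
    using oscillator_global_exists[OF oscillatorD(1)[OF osc s0(1)]] by metis
  have zy: "z s = y s" if "s \<in> I" for s
    using oscillator_unique(1)[OF I oscillator_subset[OF zq(1) subset_UNIV] osc s0(1) zq(2,3) that] .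
  obtain c where c: "critical_curve lam UNIV c" "c s0 = \<gamma> s0" "unit_tangent c s0 = unit_tangent \<gamma> s0"
    "\<And>s. geodesic_curvature c s = \<sigma> / (z s)\<^sup>2"
    using critical_curve_exists[OF zq(1) \<sigma> arclength_frenet(1-3)[OF \<gamma> s0(1)]] by metis
  obtain m where m: "0 < m" "\<And>s. s \<in> I \<Longrightarrow> m \<le> y s" using oscillator_lower_bound[OF osc I] by blast
  have "c s = \<gamma> s" if "s \<in> I" for s
  proof (rule arclength_curve_determined_by_curvature[OF \<gamma> _ subset_UNIV s0(1) c(2,3)])
    show "arclength_curve UNIV c" using c(1) by (simp add: critical_curve_def)
    show "geodesic_curvature c t = geodesic_curvature \<gamma> t" if "t \<in> I" for t
      by (simp add: c(4) \<kappa> zy that)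
    show "\<bar>geodesic_curvature \<gamma> t\<bar> \<le> 1 / m\<^sup>2" if "t \<in> I" for t
    proof -
      have "\<bar>geodesic_curvature \<gamma> t\<bar> = 1 / (y t)\<^sup>2" using \<sigma> by (auto simp: \<kappa>[OF that])
      also have "\<dots> \<le> 1 / m\<^sup>2"
        using m(1) m(2)[OF that] by (intro divide_left_mono power_mono mult_pos_pos) auto
      finally show ?thesis .
    qed
  qed (rule that)
  \<comment> \<open>The global curve \<open>c\<close> is a critical extension of
    \<open>\<gamma>\<close>, so maximality identifies the domains.\<close>
  then have UNIV: "I = UNIV" using max[OF c(1) subset_UNIV] by simp
  \<comment> \<open>Negative curvature is made positive by reversing the orientation, together with
    the time of the oscillator.\<close>
  have "\<exists>c Y P. (c = \<gamma> \<or> c = (\<lambda>s. \<gamma> (- s))) \<and> arclength_curve UNIV c \<and> oscillator lam UNIV Y P \<and>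
      (\<forall>s. geodesic_curvature c s = 1 / (Y s)\<^sup>2) \<and> \<not> geodesic_curvature c constant_on UNIV"
  proof (cases "\<sigma> = 1")
    case True
    then show ?thesis using \<gamma> osc \<kappa> assms(2) unfolding UNIV by blast
  next
    case False
    then have "\<sigma> = -1" using \<sigma> by simp
    note rev = arclength_curve_reverse[OF \<gamma>[unfolded UNIV]]
    have "\<not> geodesic_curvature (\<lambda>s. \<gamma> (- s)) constant_on UNIV"
    proof
      assume "geodesic_curvature (\<lambda>s. \<gamma> (- s)) constant_on UNIV"
      then obtain k where "\<And>s. - geodesic_curvature \<gamma> (- s) = k"
        by (auto simp: constant_on_def rev(2))
      then have "geodesic_curvature \<gamma> s = - k" for s by (metis add.inverse_inverse)
      then show False using assms(2) by (auto simp: constant_on_def)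
    qed
    moreover have "geodesic_curvature (\<lambda>s. \<gamma> (- s)) s = 1 / (y (- s))\<^sup>2" for s
      using \<kappa>[unfolded UNIV, OF UNIV_I, of "- s"] \<open>\<sigma> = -1\<close> by (simp add: rev(2))
    ultimately show ?thesis
      using rev(1) oscillator_reverse[OF osc[unfolded UNIV]] by blast
  qed
  then obtain c Y P where c: "c = \<gamma> \<or> c = (\<lambda>s. \<gamma> (- s))" "arclength_curve UNIV c" "oscillator lam UNIV Y P"
    "\<And>s. geodesic_curvature c s = 1 / (Y s)\<^sup>2" "\<not> geodesic_curvature c constant_on UNIV"
    by blast
  show ?thesis
    using UNIV c(1) oscillator_imp_B_curve[OF c(2-5)] model_curve[OF c(2-4)] by blast
qed

end
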